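(* Let $x_1,\dots,x_d\in\mathbb S^2$, let $F_d=(T_{\ell;t}(x_1),\dots,T_{\ell;t}(x_d))$, and let $Z_d$ be a centred Gaussian vector in $\mathbb R^d$ with covariance matrix $\Gamma_d=(P_\ell(\langle x_i,x_j\rangle))_{i,j=1,\dots,d}$. Then $$d_3(F_d,Z_d)\le\sup_{g\in\mathcal I}B_3(g;d)\,\sqrt{\frac{3}{2\pi^3}}\;d\,\sqrt{\frac{\log\ell}{\nu_t}}+o\left(d^2\sqrt{\frac{\log\ell}{\nu_t}}\right)$$ as $\ell\to\infty$ and $\nu_t\to\infty$ jointly (the dimension $d$ may grow with $\ell$ and $\nu_t$), where $$B_3(g;d):=\frac{\sqrt{2d}}{4}M_2(g)+\frac{2d}{9}M_3(g).$$
   Context: Let $\mu$ be the Lebesgue (surface) measure on the unit sphere $\mathbb S^2\subset\mathbb R^3$, so $\mu(\mathbb S^2)=4\pi$. For $t>0$ let $\nu_t>0$ be the rate (with $\nu_t\to\infty$ as $t\to\infty$) and let $N_t$ be a Poisson random measure on $\mathbb S^2$ with intensity measure $\nu_t\,\mu$. Let $P_\ell$ be the Legendre polynomial of degree $\ell$ (normalized by $P_\ell(1)=1$). The Poisson spherical random wave is $$T_{\ell;t}(x)=\frac{1}{\sqrt{\nu_t}}\int_{\mathbb S^2}\sqrt{\frac{2\ell+1}{4\pi}}\,P_\ell(\langle x,\xi\rangle)\,dN_t(\xi),\qquad x\in\mathbb S^2.$$ For $g\in C^{k-1}(\mathbb R^d)$, $k\ge1$, put $$M_k(g):=\sup_{x\ne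 y}\frac{\|D^{k-1}g(x)-D^{k-1}g(y)\|_{op}}{\|x-y\|_{\mathbb R^d}},$$ where $D^{k-1}g(x)$ is the $(k-1)$-th derivative viewed as a multilinear form and $\|\psi\|_{op}=\sup\{|\psi(u_1,\dots,u_j)|:\|u_i\|_2=1\}$ for a $j$-linear form $\psi$. Let $\mathcal I$ be the class of all $h\in C^3(\mathbb R^d)$ with $\|h''\|_\infty\le1$ and $\|h'''\|_\infty\le1$, where $\|h^{(j)}\|_\infty=\sup_x\|D^jh(x)\|_{op}$. For random vectors $X,Y$ in $\mathbb R^d$ with finite second moments, $d_3(X,Y)=\sup_{h\in\mathcal I}|\mathbb E[h(X)]-\mathbb E[h(Y)]|$. *)

theory Defs
  imports "HOL-Probability.Probability" "HOL-Library.Landau_Symbols"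
    "HOL-Computational_Algebra.Polynomial"
begin

subsection \<open>Legendre polynomials and surface measure\<close>

text \<open>Rodrigues' formula.\<close>

definition legendre_poly :: "nat \<Rightarrow> real poly" where
  "legendre_poly l = smult (1 / (2 ^ l * fact l)) ((pderiv ^^ l) ([:-1, 0, 1:] ^ l))"

lemma poly_legendre_poly_1: "poly (legendre_poly l) 1 = 1"
proof -
  have *: "poly ((pderiv ^^ k) ([:-1, 1:] ^ k * q)) 1 = fact k * poly q 1"
    for k :: nat and q :: "real poly"
  proof (induction k arbitrary: q)
    case (Suc k)
    have "pderiv (p ^ Suc k * q) = p ^ k * (smult (of_nat (Suc k)) q + p * pderiv q)"
      if "pderiv p = 1" for p :: "real poly"
      unfolding pderiv_mult pderiv_power_Suc that by (simp add: algebra_simps)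
    from this[of "[:-1, 1:]"]
    have "pderiv ([:-1, 1:] ^ Suc k * q)
        = [:-1, 1:] ^ k * (smult (of_nat (Suc k)) q + [:-1, 1:] * pderiv q)"
      by (simp add: pderiv_pCons one_pCons)
    then show ?case
      by (simp only: funpow_Suc_right o_apply Suc.IH) simp
  qed simp
  have "[:-1, 0, 1 :: real:] = [:-1, 1:] * [:1, 1:]"
    by simp
  then show ?thesis
    by (simp only: legendre_poly_def power_mult_distrib poly_smult *) (simp add: field_simps)
qed

text \<open>
  Surface measure on the unit sphere: \<open>\<mu> A\<close> is three times the volume of the cone
  \<open>{r \<xi> | 0 < r < 1, \<xi> \<in> A}\<close>.
\<close>

definition sphere_measure :: "(real ^ 3) measure" where
  "sphere_measure = scale_measure 3
     (distr (restrict_space lborel (ball 0 1 - {0})) (restrict_space borel (sphere 0 1))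
       (\<lambda>y. y /\<^sub>R norm y))"

lemma space_sphere_measure: "space sphere_measure = sphere 0 1"
  by (simp add: sphere_measure_def space_restrict_space space_scale_measure)

lemma emeasure_sphere_measure_sphere: "emeasure sphere_measure (sphere 0 1) = ennreal (4 * pi)"
proof -
  let ?B = "ball 0 1 - {0 :: real ^ 3}"
  have B: "?B \<in> sets lborel" by simp
  have m: "(\<lambda>y. y /\<^sub>R norm y) \<in> measurable (restrict_space lborel ?B)
      (restrict_space borel (sphere 0 (1::real)))"
    by (intro measurable_restrict_space2 measurable_restrict_space1)
       (auto simp: space_restrict_space)
  have s: "sphere 0 (1::real) \<in> sets (restrict_space borel (sphere 0 1 :: (real ^ 3) set))"
    by (metis sets.top space_borel space_restrict_space2 borel_closed closed_sphere
        sets.Int_space_eq2)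
  have "(\<lambda>y. y /\<^sub>R norm y) -` sphere 0 1 \<inter> space (restrict_space lborel ?B) = ?B"
    by (auto simp: space_restrict_space)
  then have "emeasure (distr (restrict_space lborel ?B) (restrict_space borel (sphere 0 1))
      (\<lambda>y. y /\<^sub>R norm y)) (sphere 0 1) = emeasure (restrict_space lborel ?B) ?B"
    by (subst emeasure_distr[OF m s]) simp
  also have "\<dots> = emeasure lborel ?B"
    by (subst emeasure_restrict_space) (use B in auto)
  also have "\<dots> = emeasure lborel (ball (0 :: real ^ 3) 1)"
    by (subst emeasure_Diff) auto
  also have "\<dots> = ennreal (4 / 3 * pi)"
    by (simp add: emeasure_ball unit_ball_vol_3)
  finally have "emeasure sphere_measure (sphere 0 1) = 3 * ennreal (4 / 3 * pi)"
    by (simp add: sphere_measure_def)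
  also have "\<dots> = ennreal (3 * (4 / 3 * pi))"
    by (subst ennreal_mult) auto
  finally show ?thesis by simp
qed

subsection \<open>Poisson random measures and spherical random waves\<close>

definition poisson_random_measure ::
    "'w measure \<Rightarrow> 'e measure \<Rightarrow> ('w \<Rightarrow> 'e measure) \<Rightarrow> bool" where
  "poisson_random_measure M \<Lambda> N \<longleftrightarrow>
     (\<forall>\<omega>\<in>space M. sets (N \<omega>) = sets \<Lambda>) \<and>
     (\<forall>A\<in>sets \<Lambda>. (\<lambda>\<omega>. emeasure (N \<omega>) A) \<in> borel_measurable M) \<and>
     (\<forall>A\<in>sets \<Lambda>. emeasure \<Lambda> A < \<infinity> \<longrightarrow>
        (\<forall>k::nat. measure M {\<omega>\<in>space M. emeasure (N \<omega>) A = of_nat k}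
           = measure \<Lambda> A ^ k / fact k * exp (- measure \<Lambda> A))) \<and>
     (\<forall>A\<in>sets \<Lambda>. emeasure \<Lambda> A = \<infinity> \<longrightarrow> (AE \<omega> in M. emeasure (N \<omega>) A = \<infinity>)) \<and>
     (\<forall>(A :: nat \<Rightarrow> 'e set) n. (\<forall>i<n. A i \<in> sets \<Lambda>) \<and> disjoint_family_on A {..<n} \<longrightarrow>
        prob_space.indep_vars M (\<lambda>_. borel) (\<lambda>i \<omega>. emeasure (N \<omega>) (A i)) {..<n})"

definition poisson_wave ::
    "nat \<Rightarrow> real \<Rightarrow> ('w \<Rightarrow> (real ^ 3) measure) \<Rightarrow> real ^ 3 \<Rightarrow> 'w \<Rightarrow> real" where
  "poisson_wave l \<nu> N x \<omega> =
     1 / sqrt \<nu> * (\<integral>\<xi>. sqrt ((2 * real l + 1) / (4 * pi)) * poly (legendre_poly l) (x \<bullet> \<xi>) \<partial>N \<omega>)"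

subsection \<open>Gaussian vectors\<close>

text \<open>
  Since the dimension is a variable, \<open>\<real>\<^sup>d\<close> is the set of extensional functions on \<open>{..<d}\<close>,
  with its Borel structure given by \<^term>\<open>\<Pi>\<^sub>M i\<in>{..<d}. (borel :: real measure)\<close>.
\<close>

definition Rd :: "nat \<Rightarrow> (nat \<Rightarrow> real) set" where
  "Rd d = ({..<d} \<rightarrow>\<^sub>E UNIV)"

text \<open>A constant counts as normal; covariance matrices may be singular.\<close>

definition univariate_normal :: "'w measure \<Rightarrow> ('w \<Rightarrow> real) \<Rightarrow> bool" where
  "univariate_normal M Y \<longleftrightarrow>
     (\<exists>m. (AE \<omega> in M. Y \<omega> = m)) \<and> Y \<in> borel_measurable M \<or>
     (\<exists>m s. s > 0 \<and> distributed M lborel Y (normal_density m s))"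

definition gaussian_vector :: "'w measure \<Rightarrow> nat \<Rightarrow> ('w \<Rightarrow> nat \<Rightarrow> real) \<Rightarrow> bool" where
  "gaussian_vector M d Z \<longleftrightarrow>
     Z \<in> measurable M (\<Pi>\<^sub>M i\<in>{..<d}. borel) \<and>
     (\<forall>a. univariate_normal M (\<lambda>\<omega>. \<Sum>i<d. a i * Z \<omega> i))"

definition covariance :: "'w measure \<Rightarrow> ('w \<Rightarrow> real) \<Rightarrow> ('w \<Rightarrow> real) \<Rightarrow> real" where
  "covariance M X Y =
     (\<integral>\<omega>. (X \<omega> - integral\<^sup>L M X) * (Y \<omega> - integral\<^sup>L M Y) \<partial>M)"

definition centred_gaussian_vector ::
    "'w measure \<Rightarrow> nat \<Rightarrow> (nat \<Rightarrow> nat \<Rightarrow> real) \<Rightarrow> ('w \<Rightarrow> nat \<Rightarrow> real) \<Rightarrow> bool" where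
  "centred_gaussian_vector M d \<Gamma> Z \<longleftrightarrow>
     gaussian_vector M d Z \<and>
     (\<forall>i<d. (\<integral>\<omega>. Z \<omega> i \<partial>M) = 0) \<and>
     (\<forall>i<d. \<forall>j<d. covariance M (\<lambda>\<omega>. Z \<omega> i) (\<lambda>\<omega>. Z \<omega> j) = \<Gamma> i j)"

subsection \<open>Derivatives on \<open>\<real>\<^sup>d\<close> and the distance \<open>d\<^sub>3\<close>\<close>

definition partial_deriv ::
    "nat \<Rightarrow> ((nat \<Rightarrow> real) \<Rightarrow> real) \<Rightarrow> (nat \<Rightarrow> real) \<Rightarrow> real" where
  "partial_deriv i h x = deriv (\<lambda>s. h (x(i := s))) (x i)"

definition iter_partial_deriv ::
    "nat list \<Rightarrow> ((nat \<Rightarrow> real) \<Rightarrow> real) \<Rightarrow> (nat \<Rightarrow> real) \<Rightarrow> real" where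
  "iter_partial_deriv is h = foldr partial_deriv is h"

text \<open>
  \<open>C\<^sup>k(\<real>\<^sup>d)\<close>: all iterated partial derivatives of order at most \<open>k\<close> exist and are continuous.
  The topology that \<^term>\<open>Rd d\<close> inherits from the product topology is the Euclidean one.
\<close>

definition C_k :: "nat \<Rightarrow> nat \<Rightarrow> ((nat \<Rightarrow> real) \<Rightarrow> real) set" where
  "C_k d k = {h. \<forall>is. set is \<subseteq> {..<d} \<longrightarrow>
     (length is \<le> k \<longrightarrow> continuous_on (Rd d) (iter_partial_deriv is h)) \<and>
     (length is < k \<longrightarrow> (\<forall>i<d. \<forall>x\<in>Rd d.
        (\<lambda>s. iter_partial_deriv is h (x(i := s))) field_differentiable at (x i)))}"

text \<open>
  \<open>deriv_form d j h x\<close> is the \<open>j\<close>-linear form \<open>D\<^sup>j h(x)\<close>; its arguments are the vectors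
  \<open>u 0, \<dots>, u (j - 1)\<close>.
\<close>

definition deriv_form ::
    "nat \<Rightarrow> nat \<Rightarrow> ((nat \<Rightarrow> real) \<Rightarrow> real) \<Rightarrow> (nat \<Rightarrow> real) \<Rightarrow> (nat \<Rightarrow> nat \<Rightarrow> real) \<Rightarrow> real" where
  "deriv_form d j h x u =
     (\<Sum>is\<in>{is. set is \<subseteq> {..<d} \<and> length is = j}.
        iter_partial_deriv is h x * (\<Prod>m<j. u m (is ! m)))"

definition op_norm :: "nat \<Rightarrow> nat \<Rightarrow> ((nat \<Rightarrow> nat \<Rightarrow> real) \<Rightarrow> real) \<Rightarrow> ereal" where
  "op_norm d j \<psi> =
     (SUP u \<in> {u. \<forall>m<j. u m \<in> Rd d \<and> L2_set (u m) {..<d} = 1}. ereal \<bar>\<psi> u\<bar>)"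

definition M_lip :: "nat \<Rightarrow> nat \<Rightarrow> ((nat \<Rightarrow> real) \<Rightarrow> real) \<Rightarrow> ereal" where
  "M_lip d k g =
     (SUP (x, y) \<in> {(x, y). x \<in> Rd d \<and> y \<in> Rd d \<and> x \<noteq> y}.
        op_norm d (k - 1) (\<lambda>u. deriv_form d (k - 1) g x u - deriv_form d (k - 1) g y u)
          / ereal (L2_set (\<lambda>i. x i - y i) {..<d}))"

definition deriv_sup_norm :: "nat \<Rightarrow> nat \<Rightarrow> ((nat \<Rightarrow> real) \<Rightarrow> real) \<Rightarrow> ereal" where
  "deriv_sup_norm d j h = (SUP x \<in> Rd d. op_norm d j (deriv_form d j h x))"

definition test_functions :: "nat \<Rightarrow> ((nat \<Rightarrow> real) \<Rightarrow> real) set" where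
  "test_functions d = {h \<in> C_k d 3. deriv_sup_norm d 2 h \<le> 1 \<and> deriv_sup_norm d 3 h \<le> 1}"

definition dist_3 ::
    "nat \<Rightarrow> 'v measure \<Rightarrow> ('v \<Rightarrow> nat \<Rightarrow> real) \<Rightarrow> 'w measure \<Rightarrow> ('w \<Rightarrow> nat \<Rightarrow> real) \<Rightarrow> ereal" where
  "dist_3 d M X M' Y =
     (SUP h \<in> test_functions d. ereal \<bar>(\<integral>\<omega>. h (X \<omega>) \<partial>M) - (\<integral>\<omega>. h (Y \<omega>) \<partial>M')\<bar>)"

definition B_3 :: "((nat \<Rightarrow> real) \<Rightarrow> real) \<Rightarrow> nat \<Rightarrow> ereal" where
  "B_3 g d = ereal (sqrt (2 * real d) / 4) * M_lip d 2 g + ereal (2 * real d / 9) * M_lip d 3 g"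

end

theory Submission
  imports Defs
begin

text \<open>
  The covariance matrices of the two vectors agree by the reproducing property of the zonal kernels
  \<open>P\<^sub>l (\<langle>x, \<xi>\<rangle>)\<close>, so only third moments enter a comparison of expectations of test functions. Both vectors
  are infinitely divisible: splitting them into about \<open>4 \<pi> \<nu>\<close> independent copies (compound Poisson and Gaussian
  ones) and exchanging the copies one by one bounds \<open>d\<^sub>3\<close> by a constant times
  \<open>d\<^sup>2 / sqrt \<nu>\<close> times the third absolute moment of the kernel \<open>sqrt ((2 l + 1) / 4\<pi>) P\<^sub>l\<close>. By the Bernstein type
  inequality \<open>sqrt (1 - t\<^sup>2) (P\<^sub>l t)\<^sup>2 \<le> C / l\<close> this moment, unlike the fourth one, is bounded in \<open>l\<close> without a
  logarithm. Hence the whole distance is already of the order of the remainder.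
\<close>

subsection \<open>Legendre polynomials\<close>

text \<open>Bounded second and third derivatives allow test functions of quadratic growth, so third
  absolute moments are the natural price of an exchange. The cube of a Euclidean norm, split over
  coordinates, costs d^2, which is exactly the power of d in the remainder. What has to be gained is
  the factor sqrt (log l). It is gained because |P_l|^3 is dominated by l^(-3/2) (1 - t^2)^(-3/4),
  which is integrable over the sphere, whereas the same bound for the fourth power involves (1 -
  t^2)^(-1), whose integral diverges logarithmically. The main term then only has to be nonnegative.
  The vectors live on given probability spaces, so the exchange is carried out on laws, with
  convolution powers in place of independent copies; the laws are identified by the characteristic
  functions of linear combinations. As the dimension is a variable, vectors are functions on natural
  numbers, and uniqueness of laws and the chain rule are built up one coordinate at a time.\<close>

text \<open>Consecutive central coefficients have ratio 2 (2m + 1) / (m + 1). As (2m + 1)(2m + 3)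
  \<le> 4 (m + 1)^2, the weighted square grows by a factor of at most 16; the weight 2m + 1 is what
  makes the induction close.\<close>

lemma binomial_le_central_even: "(real ((2 * m) choose m))\<^sup>2 * (2 * real m + 1) \<le> 16 ^ m"
proof (induction m)
  case (Suc m)
  have "Suc m * ((2 * Suc m) choose Suc m) = (2 * Suc m) * ((2 * m + 1) choose m)"
    using Suc_times_binomial_eq[of "2 * m + 1" m] by (simp add: algebra_simps)
  moreover have "Suc m * ((2 * m + 1) choose m) = (2 * m + 1) * ((2 * m) choose m)"
    using Suc_times_binomial_add[of m m] binomial_symmetric[of m "2 * m + 1"] Suc_times_binomial_eq[of "2*m" m]
    by (simp add: mult_2)
  ultimately have e: "(real m + 1) * real ((2 * Suc m) choose Suc m) = 2 * (2 * real m + 1) * real ((2 * m) choose m)"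
    (is "?a * ?b = ?c * ?d")
  proof -
    assume h: "Suc m * ((2 * Suc m) choose Suc m) = (2 * Suc m) * ((2 * m + 1) choose m)"
      "Suc m * ((2 * m + 1) choose m) = (2 * m + 1) * ((2 * m) choose m)"
    then have "Suc m * ((2 * Suc m) choose Suc m) = 2 * ((2 * m + 1) * ((2 * m) choose m))"
      by (simp only: mult.assoc)
    then have "real (Suc m * ((2 * Suc m) choose Suc m)) = real (2 * ((2 * m + 1) * ((2 * m) choose m)))"
      by (simp only:)
    then show ?thesis by (simp only: of_nat_mult of_nat_Suc of_nat_add of_nat_1 of_nat_numeral mult.assoc add.commute)
  qed
  define u where "u = real ((2 * m) choose m)"
  define v where "v = real ((2 * Suc m) choose Suc m)"
  have "(real m + 1)\<^sup>2 * (v\<^sup>2 * (2 * real (Suc m) + 1)) = ((real m + 1) * v)\<^sup>2 * (2 * real m + 3)"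
    by (simp add: power2_eq_square algebra_simps)
  also have "\<dots> = 4 * ((2 * real m + 1) * (2 * real m + 3)) * (u\<^sup>2 * (2 * real m + 1))"
    using e unfolding u_def[symmetric] v_def[symmetric] by (simp add: power2_eq_square) (simp add: algebra_simps)
  also have "\<dots> \<le> 4 * (4 * (real m + 1)\<^sup>2) * 16 ^ m"
  proof (rule mult_mono)
    show "4 * ((2 * real m + 1) * (2 * real m + 3)) \<le> 4 * (4 * (real m + 1)\<^sup>2)"
      by (simp add: power2_eq_square algebra_simps)
    show "u\<^sup>2 * (2 * real m + 1) \<le> 16 ^ m" using Suc unfolding u_def[symmetric] .
  qed auto
  also have "\<dots> = (real m + 1)\<^sup>2 * 16 ^ Suc m" by simp
  finally show ?case unfolding v_def[symmetric] by simp
qed simp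

text \<open>No coefficient exceeds the middle one. For n = 2m that is the central case; for n = 2m +
  1 the middle coefficient is half of the central one of order 2m + 2. The size 2^n sqrt (2 / n) is
  the source of the decay of P_l at 0.\<close>

lemma binomial_sq_bound:
  assumes "n \<ge> 1" shows "(real (n choose k))\<^sup>2 * real n \<le> 2 * 4 ^ n"
proof -
  have mono: "real (n choose k) \<le> real (n choose (n div 2))"
    by (simp add: binomial_maximum)
  have main: "(real (n choose (n div 2)))\<^sup>2 * real n \<le> 2 * 4 ^ n"
  proof (cases "even n")
    case True
    then obtain m where m: "n = 2 * m" by auto
    have "(real ((2 * m) choose m))\<^sup>2 * (2 * real m) \<le> (real ((2 * m) choose m))\<^sup>2 * (2 * real m + 1)"
      by (intro mult_left_mono) auto
    also have "\<dots> \<le> 16 ^ m" by (rule binomial_le_central_even)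
    also have "(16::real) ^ m \<le> 2 * 16 ^ m" by simp
    finally show ?thesis using m by (simp add: power_mult)
  next
    case False
    then obtain m where m: "n = 2 * m + 1" by (metis oddE)
    have "(2 * Suc m) choose Suc m = ((2 * m + 1) choose m) + ((2 * m + 1) choose Suc m)"
      by simp
    moreover have "(2 * m + 1) choose Suc m = (2 * m + 1) choose m"
      using binomial_symmetric[of m "2 * m + 1"] by (simp add: mult_2)
    ultimately have e: "real ((2 * Suc m) choose Suc m) = 2 * real ((2 * m + 1) choose m)"
      by simp
    have "4 * ((real ((2 * m + 1) choose m))\<^sup>2 * (2 * real m + 1))
        \<le> 4 * ((real ((2 * m + 1) choose m))\<^sup>2 * (2 * real (Suc m) + 1))"
      by (intro mult_left_mono) auto
    also have "\<dots> = (real ((2 * Suc m) choose Suc m))\<^sup>2 * (2 * real (Suc m) + 1)"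
      unfolding e by (simp add: power2_eq_square)
    also have "\<dots> \<le> 16 ^ Suc m" by (rule binomial_le_central_even)
    finally have "(real ((2 * m + 1) choose m))\<^sup>2 * (2 * real m + 1) \<le> 4 * 16 ^ m"
      by (simp del: binomial_Suc_Suc add: mult.commute)
    then have "(real ((2 * m + 1) choose m))\<^sup>2 * (2 * real m + 1) \<le> 2 * (4 * 16 ^ m)"
      using zero_le_power[of "16 :: real" m] by linarith
    then show ?thesis using m by (simp add: power_mult power_add add.commute)
  qed
  have "(real (n choose k))\<^sup>2 * real n \<le> (real (n choose (n div 2)))\<^sup>2 * real n"
    using mono by (intro mult_right_mono power_mono) auto
  with main show ?thesis by linarith
qed

section \<open>Legendre polynomials as coefficients, and their differential equation\<close>

lemma higher_pderiv_pcompose_shift: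
  fixes p :: "real poly"
  shows "(pderiv ^^ k) (pcompose p [:t, 1:]) = pcompose ((pderiv ^^ k) p) [:t, 1:]"
  by (induction k) (auto simp: pderiv_pcompose pderiv_pCons)

text \<open>Taylor's formula: after the shift by t, the k-th derivative at t is a
  coefficient.\<close>

lemma poly_higher_pderiv_eq_coeff:
  fixes p :: "real poly"
  shows "poly ((pderiv ^^ k) p) t = fact k * coeff (pcompose p [:t, 1:]) k"
proof -
  have "poly ((pderiv ^^ k) p) t = coeff ((pderiv ^^ k) (pcompose p [:t, 1:])) 0"
    by (simp add: higher_pderiv_pcompose_shift flip: poly_0_coeff_0)
       (simp add: poly_pcompose)
  also have "\<dots> = fact k * coeff (pcompose p [:t, 1:]) k"
    by (simp add: coeff_higher_pderiv pochhammer_fact[symmetric])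
  finally show ?thesis .
qed

lemma pcompose_power: "pcompose (p ^ n) q = pcompose p q ^ n"
  for p q :: "real poly"
  by (induction n) (auto simp: pcompose_mult pcompose_1)

text \<open>Rodrigues' formula read through Taylor's: (t + y)^2 - 1 = (t^2 - 1) + 2 t y + y^2.
  Extracting the coefficient of y^l is the algebraic form of Schlaefli's contour integral.\<close>

lemma poly_legendre_eq_coeff:
  "poly (legendre_poly l) t = coeff ([:t\<^sup>2 - 1, 2 * t, 1:] ^ l) l / 2 ^ l"
proof -
  have "pcompose [:-1, 0, 1:] [:t, 1:] = [:t\<^sup>2 - 1, 2 * t, 1:]"
    by (simp add: pcompose_pCons power2_eq_square)
  then show ?thesis
    unfolding legendre_poly_def by (simp add: poly_higher_pderiv_eq_coeff pcompose_power)
qed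

lemma degree_legendre_le: "degree (legendre_poly l) \<le> l"
proof -
  have "degree ((pderiv ^^ k) p) \<le> degree p - k" for k and p :: "real poly"
    by (induction k) (auto simp: degree_pderiv)
  from this[of l "[:-1, 0, 1:] ^ l"] have "degree ((pderiv ^^ l) ([:-1, 0, 1 :: real:] ^ l)) \<le> l"
    by (simp add: degree_power_eq)
  then show ?thesis unfolding legendre_poly_def by (meson degree_smult_le le_trans)
qed

lemma coeff_legendre_top: "coeff (legendre_poly l) l = real ((2 * l) choose l) / 2 ^ l"
proof -
  have c: "coeff ([:-1, 0, 1 :: real:] ^ l) (l + l) = 1"
    using lead_coeff_power[of "[:-1, 0, 1 :: real:]" l] by (simp add: degree_power_eq mult_2)
  have "fact (2 * l) = fact l * pochhammer (1 + real l) l"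
    using pochhammer_product[of l "2 * l" "1 :: real"] by (simp add: pochhammer_fact)
  moreover have "real (pochhammer (Suc l) l) = pochhammer (1 + real l) l"
    by (simp add: pochhammer_of_nat[symmetric])
  ultimately have "pochhammer (1 + real l) l = fact (2 * l) / fact l"
    by simp
  moreover have "real ((2 * l) choose l) = fact (2 * l) / (fact l * fact l)"
    by (simp add: binomial_fact)
  ultimately show ?thesis
    unfolding legendre_poly_def by (simp add: coeff_higher_pderiv c)
qed

text \<open>With v = (x^2 - 1)^l one has (x^2 - 1) v' = 2 l x v. \<open>step\<close> is this
  relation differentiated k + 1 times; k = l gives Legendre's equation for the l-th derivative of v,
  which is P_l up to a constant.\<close>

lemma legendre_ode_poly:
  "[:-1, 0, 1:] * pderiv (pderiv (legendre_poly l)) + smult 2 ([:0, 1:] * pderiv (legendre_poly l))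
    = smult (real l * (real l + 1)) (legendre_poly l)"
proof -
  define v where "v = [:-1, 0, 1 :: real:] ^ l"
  define D where "D k = (pderiv ^^ k) v" for k
  have DS: "pderiv (D k) = D (Suc k)" for k by (simp add: D_def)
  have q: "pderiv [:-1, 0, 1 :: real:] = smult 2 [:0, 1:]" "pderiv [:0, 1::real:] = 1"
    by (simp_all add: pderiv_pCons one_pCons)
  have z: "[:-1, 0, 1:] * D 1 = smult (2 * real l) ([:0, 1:] * D 0)"
  proof (cases l)
    case (Suc m)
    show ?thesis
      unfolding D_def v_def Suc by (simp add: pderiv_power_Suc q del: power_Suc) (simp add: algebra_simps)
  qed (simp add: D_def v_def)
  have step: "[:-1, 0, 1:] * D (k + 2) = smult (2 * real l - 2 * real k - 2) ([:0, 1:] * D (k + 1))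
      + smult ((real k + 1) * (2 * real l - real k)) (D k)" for k
  proof (induction k)
    case 0
    have "pderiv ([:-1, 0, 1:] * D 1) = pderiv (smult (2 * real l) ([:0, 1:] * D 0))"
      using z by simp
    then have "[:-1, 0, 1:] * D 2 + D 1 * smult 2 [:0, 1:] = smult (2 * real l) ([:0, 1:] * D 1 + D 0)"
      by (simp only: pderiv_mult pderiv_smult q DS) (simp add: numeral_2_eq_2)
    then have "[:-1, 0, 1:] * D 2 = smult (2 * real l) ([:0, 1:] * D 1 + D 0) - D 1 * smult 2 [:0, 1:]"
      by (simp only: eq_diff_eq)
    also have "\<dots> = smult (2 * real l - 2) ([:0, 1:] * D 1) + smult (2 * real l) (D 0)"
      by (rule poly_eqI) (simp add: algebra_simps coeff_pCons split: nat.split)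
    finally show ?case by (simp add: numeral_2_eq_2)
  next
    case (Suc k)
    have "pderiv ([:-1, 0, 1:] * D (k + 2)) = pderiv (smult (2 * real l - 2 * real k - 2) ([:0, 1:] * D (k + 1))
      + smult ((real k + 1) * (2 * real l - real k)) (D k))"
      using Suc by simp
    then have "[:-1, 0, 1:] * D (k + 3) + D (k + 2) * smult 2 [:0, 1:]
       = smult (2 * real l - 2 * real k - 2) ([:0, 1:] * D (k + 2) + D (k + 1))
      + smult ((real k + 1) * (2 * real l - real k)) (D (k + 1))"
      by (simp only: pderiv_mult pderiv_smult pderiv_add q DS) (simp add: numeral_eq_Suc)
    then have "[:-1, 0, 1:] * D (k + 3)
       = smult (2 * real l - 2 * real k - 2) ([:0, 1:] * D (k + 2) + D (k + 1))
      + smult ((real k + 1) * (2 * real l - real k)) (D (k + 1)) - D (k + 2) * smult 2 [:0, 1:]"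
      by (simp only: eq_diff_eq)
    also have "\<dots> = smult (2 * real l - 2 * real (Suc k) - 2) ([:0, 1:] * D (k + 2))
      + smult ((real (Suc k) + 1) * (2 * real l - real (Suc k))) (D (k + 1))"
      by (rule poly_eqI) (simp add: algebra_simps coeff_pCons split: nat.split)
    finally show ?case by (simp add: numeral_eq_Suc)
  qed
  define c where "c = 1 / (2 ^ l * fact l :: real)"
  have L: "legendre_poly l = smult c (D l)" by (simp add: legendre_poly_def c_def D_def v_def)
  have "[:-1, 0, 1:] * D (Suc (Suc l)) + smult 2 ([:0, 1:] * D (Suc l)) = smult (real l * (real l + 1)) (D l)"
    using step[of l] by (simp only: numeral_2_eq_2 add_Suc_right Nat.add_0_right One_nat_def)
      (rule poly_eqI, simp add: algebra_simps coeff_pCons split: nat.split)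
  then have "smult c ([:-1, 0, 1:] * D (Suc (Suc l)) + smult 2 ([:0, 1:] * D (Suc l)))
      = smult c (smult (real l * (real l + 1)) (D l))" by simp
  then show ?thesis
    unfolding L pderiv_smult DS by (simp only: mult_smult_right smult_add_right smult_smult mult.commute[of _ c] mult.commute[of 2])
qed

lemma legendre_ode:
  "(1 - t\<^sup>2) * poly (pderiv (pderiv (legendre_poly l))) t
    = 2 * t * poly (pderiv (legendre_poly l)) t - real l * (real l + 1) * poly (legendre_poly l) t"
  using arg_cong[OF legendre_ode_poly[of l], of "\<lambda>p. poly p t"]
  by (simp add: algebra_simps power2_eq_square)

text \<open>Only even exponents occur, with binomial coefficients up to sign. For odd j the
  coefficient is 0, so the rounding in \<open>j div 2\<close> is harmless.\<close>

lemma abs_coeff_power_le: "\<bar>coeff ([:-1, 0, 1 :: real:] ^ l) j\<bar> \<le> real (l choose (j div 2))"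
proof -
  have e: "[:-1, 0, 1 :: real:] = monom 1 2 + [:-1:]"
    by (simp add: monom_altdef numeral_2_eq_2 one_pCons)
  have "coeff ([:-1, 0, 1 :: real:] ^ l) j = (\<Sum>k\<le>l. coeff (of_nat (l choose k) * monom 1 2 ^ k * [:-1:] ^ (l - k)) j)"
    unfolding e binomial_ring by (simp add: coeff_sum)
  also have "\<dots> = (\<Sum>k\<le>l. if j = 2 * k then real (l choose k) * (-1) ^ (l - k) else 0)"
  proof (intro sum.cong refl)
    fix k
    have "of_nat (l choose k) * monom 1 2 ^ k * [:-1 :: real:] ^ (l - k)
        = monom (real (l choose k) * (-1) ^ (l - k)) (2 * k)"
      by (simp add: monom_power of_nat_poly mult_monom poly_const_pow smult_monom mult.commute)
    then show "coeff (of_nat (l choose k) * monom 1 2 ^ k * [:-1 :: real:] ^ (l - k)) j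
        = (if j = 2 * k then real (l choose k) * (-1) ^ (l - k) else 0)"
      by simp
  qed
  also have "\<bar>\<dots>\<bar> \<le> real (l choose (j div 2))"
  proof (cases "even j \<and> j div 2 \<le> l")
    case True
    then have "(\<Sum>k\<le>l. if j = 2 * k then real (l choose k) * (-1) ^ (l - k) else 0)
        = (\<Sum>k\<in>{j div 2}. real (l choose k) * (-1) ^ (l - k))"
      by (intro sum.mono_neutral_cong_right) auto
    then show ?thesis by (simp add: abs_mult power_abs)
  next
    case False
    then have "(\<Sum>k\<le>l. if j = 2 * k then real (l choose k) * (-1) ^ (l - k) else 0) = 0"
      by (intro sum.neutral) auto
    then show ?thesis by simp
  qed
  finally show ?thesis .
qed

section \<open>Averages over roots of unity and Laplace's integral\<close>

text \<open>A geometric sum; |j| < M and j \<noteq> 0 keep the ratio \<open>z\<close> away from 1.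
  The phase \<psi> is a common factor only, and will later be the azimuth of a point on the
  sphere.\<close>

lemma sum_cis_roots_shift:
  fixes j :: int and M :: nat and \<psi> :: real
  assumes "0 < M" "\<bar>j\<bar> < int M" "j \<noteq> 0"
  shows "(\<Sum>k<M. cis (real_of_int j * (2 * pi * real k / real M - \<psi>))) = 0"
proof -
  define z where "z = cis (real_of_int j * (2 * pi / real M))"
  have z1: "z \<noteq> 1"
  proof
    assume "z = 1"
    then have "cos (real_of_int j * (2 * pi / real M)) = 1" by (auto simp: z_def complex_eq_iff)
    then obtain n :: int where "real_of_int j * (2 * pi / real M) = of_int n * 2 * pi"
      using cos_one_2pi_int[of "real_of_int j * (2 * pi / real M)"] by blast
    then have "real_of_int j = real_of_int (n * int M)" using assms(1) by (simp add: field_simps)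
    then have "j = n * int M" by (simp only: of_int_eq_iff)
    then have "int M dvd j" by simp
    with assms show False using zdvd_not_zless[of "\<bar>j\<bar>" "int M"] by auto
  qed
  have "z ^ M = 1"
  proof -
    have "real M * (real_of_int j * (2 * pi / real M)) = 2 * pi * real_of_int j"
      using assms(1) by simp
    then show ?thesis
      unfolding z_def Complex.DeMoivre using cis_multiple_2pi[of "real_of_int j"] by (simp only: Ints_of_int simp_thms)
  qed
  then have "(\<Sum>k<M. z ^ k) = 0" using geometric_sum[OF z1, of M] by simp
  moreover have "(\<Sum>k<M. cis (real_of_int j * (2 * pi * real k / real M - \<psi>)))
     = cis (- (real_of_int j * \<psi>)) * (\<Sum>k<M. z ^ k)"
    unfolding sum_distrib_left z_def
    unfolding Complex.DeMoivre cis_mult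
    by (intro sum.cong refl arg_cong[of _ _ cis]) (simp add: right_diff_distrib)
  ultimately show ?thesis by simp
qed

lemma poly_map_of_real_pCons:
  "poly (map_poly complex_of_real (pCons a p)) y = of_real a + y * poly (map_poly of_real p) y"
  by (simp add: map_poly_pCons)

lemma poly_map_of_real_add:
  "poly (map_poly complex_of_real (p + q)) y = poly (map_poly of_real p) y + poly (map_poly of_real q) y"
proof -
  have "map_poly complex_of_real (p + q) = map_poly of_real p + map_poly of_real q"
    by (rule poly_eqI) (simp add: coeff_map_poly)
  then show ?thesis by simp
qed

lemma poly_map_of_real_smult:
  "poly (map_poly complex_of_real (smult c q)) y = of_real c * poly (map_poly of_real q) y"
proof -
  have "map_poly complex_of_real (smult c q) = smult (of_real c) (map_poly of_real q)"
    by (rule poly_eqI) (simp add: coeff_map_poly)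
  then show ?thesis by simp
qed

lemma poly_map_of_real_mult:
  "poly (map_poly complex_of_real (p * q)) y = poly (map_poly of_real p) y * poly (map_poly of_real q) y"
  by (induction p)
     (simp_all add: poly_map_of_real_add poly_map_of_real_smult poly_map_of_real_pCons distrib_right)

lemma poly_map_of_real_power:
  "poly (map_poly complex_of_real (p ^ n)) y = poly (map_poly of_real p) y ^ n"
  by (induction n) (simp_all add: poly_map_of_real_mult)

lemma degree_quadratic_power: "degree ([:a, b, 1 :: real:] ^ l) = 2 * l"
  by (simp add: degree_power_eq)

text \<open>A discrete form of Laplace's integral: averaging over the \<open>M\<close>-th roots of unity extracts the
  coefficient that \<open>poly_legendre_eq_coeff\<close> asks for.\<close>

lemma legendre_laplace:
  fixes t \<psi> :: real and l M :: nat
  assumes t: "\<bar>t\<bar> \<le> 1" and M: "l < M"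
  shows "of_real (poly (legendre_poly l) t)
    = (1 / of_nat M) * (\<Sum>k<M. (of_real t + \<i> * of_real (sqrt (1 - t\<^sup>2) * cos (2 * pi * real k / real M - \<psi>))) ^ l)"
proof -
  define \<rho> where "\<rho> = sqrt (1 - t\<^sup>2)"
  have r2: "\<rho>\<^sup>2 = 1 - t\<^sup>2" using t by (simp add: \<rho>_def abs_square_le_1)
  define \<theta> where "\<theta> k = 2 * pi * real k / real M - \<psi>" for k :: nat
  define q where "q = [:t\<^sup>2 - 1, 2 * t, 1:] ^ l"
  have M0: "M > 0" using M by simp
  define E where "E j k = cis (real_of_int (int j - int l) * \<theta> k)" for j k
  \<comment> \<open>For y = i \<rho> e^(i \<theta>) with \<rho>^2 = 1 - t^2, the quadratic t^2 - 1 +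
    2 t y + y^2 collapses to 2 (t + i \<rho> cos \<theta>) y. Taking l-th powers and moving e^(i l
    \<theta>) to the side of the coefficients leaves the frequencies j - l in
    \<open>E\<close>.\<close>
  have key: "(of_real t + \<i> * of_real (\<rho> * cos (\<theta> k))) ^ l * (\<i> * of_real \<rho>) ^ l
      = (\<Sum>j\<le>2*l. of_real (coeff q j) * (\<i> * of_real \<rho>) ^ j * E j k) / 2 ^ l" for k
  proof -
    define y where "y = \<i> * of_real \<rho> * cis (\<theta> k)"
    have gen: "(a * b * c) * (a * b * c) = (a * a) * (b * b) * (c * c)" for a b c :: complex
      by (simp add: mult_ac)
    have gen2: "2 * (a * (b * d)) * (a * b * c) = (a * a) * (b * b) * (d * 2 * c)" for a b c d :: complex
      by (simp add: mult_ac)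
    have gen3: "of_real (s - 1) + of_real (2 * t) * z + z\<^sup>2 = 2 * (of_real t + X) * z"
      if "2 * X * z = z * z - of_real (1 - s)" for X z :: complex and s t :: real
      using that by (simp add: algebra_simps power2_eq_square)
    have y2: "y * y = - of_real (\<rho>\<^sup>2) * cis (2 * \<theta> k)"
    proof -
      have "y * y = (\<i> * \<i>) * (of_real \<rho> * of_real \<rho>) * (cis (\<theta> k) * cis (\<theta> k))"
        unfolding y_def by (rule gen)
      then show ?thesis by (simp add: cis_mult power2_eq_square)
    qed
    have c: "complex_of_real (cos (\<theta> k)) * 2 * cis (\<theta> k) = cis (2 * \<theta> k) + 1"
    proof (rule complex_eqI)
      show "Re (complex_of_real (cos (\<theta> k)) * 2 * cis (\<theta> k)) = Re (cis (2 * \<theta> k) + 1)"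
        using cos_double_cos[of "\<theta> k"] by (simp add: power2_eq_square)
      show "Im (complex_of_real (cos (\<theta> k)) * 2 * cis (\<theta> k)) = Im (cis (2 * \<theta> k) + 1)"
        using sin_double[of "\<theta> k"] by simp
    qed
    have 1: "(of_real (t\<^sup>2 - 1) + of_real (2 * t) * y + y\<^sup>2)
        = 2 * (of_real t + \<i> * of_real (\<rho> * cos (\<theta> k))) * y"
    proof -
      have "2 * (\<i> * of_real (\<rho> * cos (\<theta> k))) * y = - (of_real (\<rho>\<^sup>2)) * (complex_of_real (cos (\<theta> k)) * 2 * cis (\<theta> k))"
      proof -
        have "2 * (\<i> * of_real (\<rho> * cos (\<theta> k))) * y
            = (\<i> * \<i>) * (of_real \<rho> * of_real \<rho>) * (complex_of_real (cos (\<theta> k)) * 2 * cis (\<theta> k))"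
          unfolding y_def of_real_mult by (rule gen2)
        moreover have "\<i> * \<i> * (of_real \<rho> * of_real \<rho>) = - complex_of_real (\<rho>\<^sup>2)"
          by (simp add: power2_eq_square)
        ultimately show ?thesis by (simp only:)
      qed
      also have "\<dots> = y * y - of_real (\<rho>\<^sup>2)"
        unfolding c y2 by (simp only: distrib_left mult_1_right minus_mult_left[symmetric] add_uminus_conv_diff)
      finally show ?thesis unfolding r2 by (rule gen3)
    qed
    have "(of_real (t\<^sup>2 - 1) + of_real (2 * t) * y + y\<^sup>2) ^ l = poly (map_poly of_real q) y"
      by (simp add: q_def poly_map_of_real_power poly_map_of_real_pCons power2_eq_square distrib_left)
         (simp add: ac_simps)
    also have "poly (map_poly of_real q) y = (\<Sum>j\<le>2*l. of_real (coeff q j) * y ^ j)"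
    proof -
      have "degree (map_poly complex_of_real q) = 2 * l"
        by (simp add: q_def degree_quadratic_power degree_map_poly)
      then show ?thesis by (simp add: poly_altdef coeff_map_poly)
    qed
    finally have e: "(\<Sum>j\<le>2*l. of_real (coeff q j) * y ^ j)
       = 2 ^ l * (of_real t + \<i> * of_real (\<rho> * cos (\<theta> k))) ^ l * y ^ l"
      unfolding 1 power_mult_distrib by (rule sym)
    have yE: "y ^ j * cis (- (real l * \<theta> k)) = (\<i> * of_real \<rho>) ^ j * E j k" for j
    proof -
      have "cis (\<theta> k) ^ j * cis (- (real l * \<theta> k)) = E j k"
        unfolding E_def Complex.DeMoivre cis_mult by (rule arg_cong[of _ _ cis]) (simp add: left_diff_distrib)
      then show ?thesis unfolding y_def power_mult_distrib by (simp only: mult.assoc)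
    qed
    have "(\<Sum>j\<le>2*l. of_real (coeff q j) * (\<i> * of_real \<rho>) ^ j * E j k)
      = (\<Sum>j\<le>2*l. of_real (coeff q j) * y ^ j) * cis (- (real l * \<theta> k))"
      unfolding sum_distrib_right by (intro sum.cong refl) (simp only: mult.assoc yE)
    also have "\<dots> = 2 ^ l * (of_real t + \<i> * of_real (\<rho> * cos (\<theta> k))) ^ l * ((\<i> * of_real \<rho>) ^ l * E l k)"
      unfolding e mult.assoc yE by simp
    finally show ?thesis by (simp add: E_def)
  qed
  show ?thesis
  proof (cases "\<rho> = 0")
    case False
    have "(\<Sum>k<M. (of_real t + \<i> * of_real (\<rho> * cos (\<theta> k))) ^ l) * (\<i> * of_real \<rho>) ^ l
      = (\<Sum>j\<le>2*l. of_real (coeff q j) * (\<i> * of_real \<rho>) ^ j * (\<Sum>k<M. E j k)) / 2 ^ l"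
      unfolding sum_distrib_right key sum_divide_distrib[symmetric]
      by (subst sum.swap) (simp add: sum_distrib_left)
    also have "(\<Sum>j\<le>2*l. of_real (coeff q j) * (\<i> * of_real \<rho>) ^ j * (\<Sum>k<M. E j k))
      = (\<Sum>j\<in>{l}. of_real (coeff q j) * (\<i> * of_real \<rho>) ^ j * (\<Sum>k<M. E j k))"
    proof (rule sum.mono_neutral_right)
      show "\<forall>j\<in>{..2 * l} - {l}. of_real (coeff q j) * (\<i> * of_real \<rho>) ^ j * (\<Sum>k<M. E j k) = 0"
      proof
        fix j assume "j \<in> {..2 * l} - {l}"
        \<comment> \<open>l < M prevents aliasing: j - l runs from -l to l, where 0 is the only
          multiple of M.\<close>
        then have "\<bar>int j - int l\<bar> < int M" "int j - int l \<noteq> 0" using M by auto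
        then have "(\<Sum>k<M. E j k) = 0"
          unfolding E_def \<theta>_def using sum_cis_roots_shift[OF M0] by blast
        then show "of_real (coeff q j) * (\<i> * of_real \<rho>) ^ j * (\<Sum>k<M. E j k) = 0" by simp
      qed
    qed auto
    also have "\<dots> = of_real (coeff q l) * of_nat M * (\<i> * of_real \<rho>) ^ l"
      by (simp add: E_def)
    finally have "(\<Sum>k<M. (of_real t + \<i> * of_real (\<rho> * cos (\<theta> k))) ^ l) = of_real (coeff q l) * of_nat M / 2 ^ l"
      using False by (simp add: field_simps)
    then show ?thesis
      using M0 unfolding \<theta>_def \<rho>_def poly_legendre_eq_coeff q_def by simp
  next
    \<comment> \<open>At t = 1 or t = -1 the factor (i \<rho>)^l cannot be divided out. There the
      quadratic is y (2 t + y), and the coefficient is read off directly.\<close>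
    case True
    then have t2: "t\<^sup>2 = 1" using r2 by simp
    have "[:t\<^sup>2 - 1, 2 * t, 1:] = [:0, 1:] * [:2 * t, 1:]" using t2 by simp
    then have "q = monom 1 l * [:2 * t, 1:] ^ l"
      unfolding q_def by (simp only: power_mult_distrib) (simp add: monom_altdef)
    then have "coeff q l = coeff ([:2 * t, 1:] ^ l) 0"
      by (simp add: coeff_monom_mult)
    also have "\<dots> = (2 * t) ^ l" by (simp add: coeff_0_power)
    finally have "poly (legendre_poly l) t = t ^ l"
      by (simp add: poly_legendre_eq_coeff q_def power_mult_distrib)
    then show ?thesis using True M0 by (simp add: \<rho>_def)
  qed
qed

text \<open>The right-hand side is the value at \<open>0\<close> of Sonin's function \<open>S\<close> for the differential equation satisfied by
  \<open>sqrt (sin \<theta>) P\<^sub>l (cos \<theta>)\<close>; \<open>S\<close> decreases away from \<open>0\<close> on both sides.\<close>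

lemma legendre_sonin:
  fixes l :: nat and x :: real
  defines "P \<equiv> poly (legendre_poly l)" and "P1 \<equiv> poly (pderiv (legendre_poly l))"
  assumes x: "\<bar>x\<bar> < 1"
  shows "sqrt (1 - x\<^sup>2) * (P x)\<^sup>2 \<le> (P 0)\<^sup>2 + 4 * (P1 0)\<^sup>2 / ((2 * real l + 1)\<^sup>2 + 1)"
proof -
  define c where "c = (2 * real l + 1)\<^sup>2"
  define P2 where "P2 = poly (pderiv (pderiv (legendre_poly l)))"
  define w where "w y = 1 - y\<^sup>2" for y :: real
  \<comment> \<open>With y = cos \<theta> and u = sqrt (sin \<theta>) P (cos \<theta>), the squared
    \<theta>-derivative of u is \<open>Q\<close>^2 / (4 sqrt \<open>w\<close>), and u'' + \<phi> u =
    0 with \<phi> = \<open>D\<close> / (4 \<open>w\<close>). Hence \<open>S\<close> is u^2 + u'^2 /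
    \<phi>.\<close>
  define Q where "Q y = 2 * w y * P1 y - y * P y" for y
  define D where "D y = c * w y + 1" for y
  define S where "S y = sqrt (w y) * ((P y)\<^sup>2 + (Q y)\<^sup>2 / D y)" for y
  have c0: "c \<ge> 0" by (simp add: c_def)
  have ode: "w y * P2 y = 2 * y * P1 y - real l * (real l + 1) * P y" for y
    using legendre_ode[of y l] by (simp add: w_def P_def P1_def P2_def)
  have dP: "(P has_field_derivative P1 y) (at y)" for y
    unfolding P_def P1_def by (rule poly_DERIV)
  have dP1: "(P1 has_field_derivative P2 y) (at y)" for y
    unfolding P1_def P2_def by (rule poly_DERIV)
  have wpos: "w y > 0" if "\<bar>y\<bar> < 1" for y
    using that by (simp add: w_def abs_square_less_1)
  have dw: "(w has_field_derivative (-2 * y)) (at y)" for y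
    unfolding w_def[abs_def] by (auto intro!: derivative_eq_intros)
  have dQ: "(Q has_field_derivative (- (2 * (real l * (real l + 1)) + 1) * P y - y * P1 y)) (at y)" for y
  proof -
    have "(Q has_field_derivative (2 * (-2 * y) * P1 y + P2 y * (2 * w y) - (1 * P y + P1 y * y))) (at y)"
      unfolding Q_def[abs_def] by (auto intro!: derivative_eq_intros dw dP dP1)
    moreover have "2 * (-2 * y) * P1 y + P2 y * (2 * w y) - (1 * P y + P1 y * y)
      = - (2 * (real l * (real l + 1)) + 1) * P y - y * P1 y"
      using ode[of y] by (simp add: algebra_simps)
    ultimately show ?thesis by simp
  qed
  \<comment> \<open>Only the variation of \<phi> survives when Sonin's function is differentiated,
    so the sign is opposite to that of y and the maximum sits at y = 0.\<close>
  have dS: "(S has_field_derivative (- 2 * y * (Q y)\<^sup>2 / ((D y)\<^sup>2 * sqrt (w y)))) (at y)" if y: "\<bar>y\<bar> < 1" for y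
  proof -
    have w: "w y > 0" using wpos[OF y] .
    have Dp: "D y > 0" unfolding D_def using w c0 by (simp add: add_nonneg_pos)
    have dD: "(D has_field_derivative (- 2 * c * y)) (at y)"
      unfolding D_def[abs_def] by (auto intro!: derivative_eq_intros dw)
    define Q' where "Q' = - (2 * (real l * (real l + 1)) + 1) * P y - y * P1 y"
    have dsw: "((\<lambda>y. sqrt (w y)) has_field_derivative (inverse (sqrt (w y)) / 2 * (-2 * y))) (at y)"
      by (rule DERIV_chain2[OF DERIV_real_sqrt[OF w] dw])
    have dP2: "((\<lambda>y. (P y)\<^sup>2) has_field_derivative (2 * P y * P1 y)) (at y)"
      using DERIV_power[OF dP, of 2 y] by (simp add: mult_ac)
    have dQ2: "((\<lambda>y. (Q y)\<^sup>2) has_field_derivative (2 * Q y * Q')) (at y)"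
      using DERIV_power[OF dQ, of 2 y] by (simp add: Q'_def mult_ac)
    have "(S has_field_derivative
       (inverse (sqrt (w y)) / 2 * (-2 * y) * ((P y)\<^sup>2 + (Q y)\<^sup>2 / D y)
       + (2 * P y * P1 y + (2 * Q y * Q' * D y - (Q y)\<^sup>2 * (-2 * c * y)) / (D y * D y)) * sqrt (w y))) (at y)"
      unfolding S_def[abs_def] using Dp
      by (intro DERIV_mult[OF dsw DERIV_add[OF dP2 DERIV_divide[OF dQ2 dD]]]) simp
    moreover have "inverse (sqrt (w y)) / 2 * (-2 * y) * ((P y)\<^sup>2 + (Q y)\<^sup>2 / D y)
       + (2 * P y * P1 y + (2 * Q y * Q' * D y - (Q y)\<^sup>2 * (-2 * c * y)) / (D y * D y)) * sqrt (w y)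
      = - 2 * y * (Q y)\<^sup>2 / ((D y)\<^sup>2 * sqrt (w y))"
    proof -
      define s where "s = sqrt (w y)"
      have s: "s > 0" "s * s = w y" using w by (auto simp: s_def)
      define p q d where "p = P y" and "q = Q y" and "d = D y"
      have d: "d > 0" "d = c * w y + 1" using Dp by (auto simp: d_def D_def)
      have P1e: "2 * w y * P1 y = q + y * p" by (simp add: q_def Q_def p_def)
      have w1: "w y + y\<^sup>2 = 1" by (simp add: w_def)
      have ce: "c = 4 * (real l * (real l + 1)) + 1" by (simp add: c_def power2_eq_square algebra_simps)
      have Q'e: "2 * w y * Q' = - (2 * (real l * (real l + 1)) + 1) * p * (2 * w y) - y * (q + y * p)"
        unfolding P1e[symmetric] by (simp add: Q'_def p_def algebra_simps)
      have Q'e2: "2 * w y * Q' = - p * d - y * q"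
      proof -
        have "y * y = 1 - w y" using w1 by (simp add: power2_eq_square)
        have "y * (q + y * p) = y * q + (y * y) * p" by (simp add: algebra_simps)
        then have "y * (q + y * p) = y * q + (1 - w y) * p" using \<open>y * y = 1 - w y\<close> by simp
        then show ?thesis unfolding Q'e d(2) ce by (simp add: algebra_simps)
      qed
      \<comment> \<open>Clearing denominators leaves \<open>P1\<close> and \<open>Q'\<close> only
        multiplied by 2 w, where \<open>P1e\<close> and \<open>Q'e2\<close> express them through p
        and q; d = c w + 1 then cancels all but one term.\<close>
      have "(inverse s / 2 * (-2 * y) * (p\<^sup>2 + q\<^sup>2 / d)
         + (2 * p * P1 y + (2 * q * Q' * d - q\<^sup>2 * (-2 * c * y)) / (d * d)) * s) * (d * d * s)
         = - y * (p\<^sup>2 * d + q\<^sup>2) * d + ((2 * w y * P1 y) * p * d * d + (2 * w y * Q') * q * d + 2 * (c * w y) * y * q\<^sup>2)"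
        using s(1) d(1) unfolding s(2)[symmetric] by (simp add: field_simps power2_eq_square)
      also have "\<dots> = - 2 * y * q\<^sup>2"
        unfolding P1e Q'e2 using d(2) by (simp add: power2_eq_square algebra_simps)
      finally have "inverse s / 2 * (-2 * y) * (p\<^sup>2 + q\<^sup>2 / d)
         + (2 * p * P1 y + (2 * q * Q' * d - q\<^sup>2 * (-2 * c * y)) / (d * d)) * s = - 2 * y * q\<^sup>2 / (d * d * s)"
        by (rule eq_divide_imp[rotated]) (use s(1) d(1) in simp)
      then show ?thesis by (simp add: s_def p_def q_def d_def power2_eq_square)
    qed
    ultimately show ?thesis by simp
  qed
  have sgn: "(D y)\<^sup>2 * sqrt (w y) \<ge> 0" if "\<bar>y\<bar> < 1" for y
    using wpos[OF that] by simp
  have "S x \<le> S 0"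
  proof (cases "x \<ge> 0")
    case True
    show ?thesis
    proof (rule DERIV_nonpos_imp_nonincreasing[OF True])
      fix y assume "0 \<le> y" "y \<le> x"
      then have "\<bar>y\<bar> < 1" using x by auto
      then show "\<exists>z. (S has_real_derivative z) (at y) \<and> z \<le> 0"
        using dS[of y] sgn[of y] \<open>0 \<le> y\<close> by (intro exI conjI) (auto intro!: divide_nonpos_nonneg)
    qed
  next
    case False
    then have "x \<le> 0" by simp
    then show ?thesis
    proof (rule DERIV_nonneg_imp_nondecreasing)
      fix y assume "x \<le> y" "y \<le> 0"
      then have "\<bar>y\<bar> < 1" using x by auto
      then show "\<exists>z. (S has_real_derivative z) (at y) \<and> 0 \<le> z"
      proof (intro exI conjI)
        have "0 \<le> (- 2 * y) * (Q y)\<^sup>2" using \<open>y \<le> 0\<close> mult_nonneg_nonneg[of "- 2 * y" "(Q y)\<^sup>2"] by simp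
        then show "0 \<le> - 2 * y * (Q y)\<^sup>2 / ((D y)\<^sup>2 * sqrt (w y))"
          using sgn[OF \<open>\<bar>y\<bar> < 1\<close>] by (intro divide_nonneg_nonneg)
      qed (rule dS[OF \<open>\<bar>y\<bar> < 1\<close>])
    qed
  qed
  moreover have "S 0 = (P 0)\<^sup>2 + 4 * (P1 0)\<^sup>2 / ((2 * real l + 1)\<^sup>2 + 1)"
    by (simp add: S_def w_def Q_def D_def c_def power_mult_distrib)
  moreover have "sqrt (1 - x\<^sup>2) * (P x)\<^sup>2 \<le> S x"
    using wpos[OF x] c0 by (simp add: S_def D_def w_def mult_left_mono)
  ultimately show ?thesis by linarith
qed

text \<open>Both terms of Sonin's value at 0 are coefficients of (x^2 - 1)^l: P_l (0) is the one of
  x^l over 2^l, and P_l' (0) is l + 1 times the one of x^(l+1) over 2^l. Each squared coefficient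
  over 4^l is at most \<open>b\<close> = 2 / l, the factor (l + 1)^2 is absorbed by (2l + 1)^2 + 1,
  and 1 + 4 copies of \<open>b\<close> give 10 / l.\<close>

lemma legendre_bound:
  assumes x: "\<bar>x\<bar> < 1" and l: "l \<ge> 1"
  shows "sqrt (1 - x\<^sup>2) * (poly (legendre_poly l) x)\<^sup>2 \<le> 10 / real l"
proof -
  let ?p = "legendre_poly l"
  let ?v = "[:-1, 0, 1 :: real:] ^ l"
  define b where "b = 2 / real l"
  have v: "(coeff ?v j / 2 ^ l)\<^sup>2 \<le> b" for j
  proof -
    have "(coeff ?v j)\<^sup>2 \<le> (real (l choose (j div 2)))\<^sup>2"
      using abs_coeff_power_le[of l j] by (metis abs_ge_zero power2_abs power_mono)
    then have "(coeff ?v j)\<^sup>2 * real l \<le> (real (l choose (j div 2)))\<^sup>2 * real l"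
      by (intro mult_right_mono) auto
    also have "\<dots> \<le> 2 * 4 ^ l" by (rule binomial_sq_bound[OF l])
    finally have "(coeff ?v j)\<^sup>2 * real l \<le> 2 * 4 ^ l" .
    moreover have "((2 :: real) ^ l)\<^sup>2 = 4 ^ l" by (simp add: power2_eq_square flip: power_mult_distrib)
    ultimately show ?thesis using l
      by (simp add: b_def power_divide field_simps)
  qed
  have "poly ?p 0 = coeff ?v l / 2 ^ l"
    by (simp add: poly_legendre_eq_coeff)
  then have A: "(poly ?p 0)\<^sup>2 \<le> b" using v[of l] by simp
  have "poly (pderiv ?p) 0 = coeff ?p 1" by (simp add: poly_0_coeff_0 coeff_pderiv)
  also have "\<dots> = pochhammer 2 l * coeff ?v (l + 1) / (2 ^ l * fact l)"
    by (simp add: legendre_poly_def coeff_higher_pderiv)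
  also have "pochhammer 2 l = real (l + 1) * fact l"
    using pochhammer_rec[of "1 :: real" l] pochhammer_fact[of "Suc l", where ?'a = real] by simp
  finally have "(poly (pderiv ?p) 0)\<^sup>2 = (real (l + 1))\<^sup>2 * (coeff ?v (l + 1) / 2 ^ l)\<^sup>2"
    by (simp add: power_mult_distrib power_divide)
  also have "\<dots> \<le> (real (l + 1))\<^sup>2 * b"
    using v by (intro mult_left_mono) auto
  finally have "(poly (pderiv ?p) 0)\<^sup>2 \<le> (real (l + 1))\<^sup>2 * b" .
  also have "\<dots> \<le> ((2 * real l + 1)\<^sup>2 + 1) * b"
    by (intro mult_right_mono) (auto simp: power2_eq_square b_def algebra_simps)
  finally have B: "(poly (pderiv ?p) 0)\<^sup>2 / ((2 * real l + 1)\<^sup>2 + 1) \<le> b"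
    by (subst pos_divide_le_eq) (auto simp: add_nonneg_pos mult.commute)
  show ?thesis using legendre_sonin[OF x, of l] A B by (simp add: b_def)
qed

subsection \<open>Zonal kernels on the sphere\<close>

lemma sets_sphere_measure: "sets sphere_measure = sets (restrict_space borel (sphere 0 1))"
  by (simp add: sphere_measure_def)

lemma borel_measurable_sphere_measure:
  "f \<in> measurable borel N \<Longrightarrow> f \<in> measurable sphere_measure N"
  by (simp add: measurable_cong_sets[OF sets_sphere_measure refl] measurable_restrict_space1)

lemma finite_measure_sphere_measure: "finite_measure sphere_measure"
  by (rule finite_measureI) (simp add: space_sphere_measure emeasure_sphere_measure_sphere)

text \<open>The cone definition turned into an integration formula: functions on the sphere are
  extended constantly along rays. Rotation invariance and the finiteness of the singular weight are
  both reduced to Lebesgue measure in this way.\<close>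

lemma nn_integral_sphere_measure:
  fixes f :: "real ^ 3 \<Rightarrow> ennreal"
  assumes f[measurable]: "f \<in> borel_measurable borel"
  shows "(\<integral>\<^sup>+\<xi>. f \<xi> \<partial>sphere_measure)
    = 3 * (\<integral>\<^sup>+y. f (y /\<^sub>R norm y) * indicator (ball 0 1 - {0}) y \<partial>lborel)"
proof -
  let ?B = "ball 0 1 - {0 :: real ^ 3}"
  have m: "(\<lambda>y. y /\<^sub>R norm y) \<in> measurable (restrict_space lborel ?B)
      (restrict_space borel (sphere 0 (1::real)))"
    by (intro measurable_restrict_space2 measurable_restrict_space1)
       (auto simp: space_restrict_space)
  have "(\<integral>\<^sup>+\<xi>. f \<xi> \<partial>sphere_measure)
      = 3 * (\<integral>\<^sup>+y. f (y /\<^sub>R norm y) \<partial>restrict_space lborel ?B)"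
    unfolding sphere_measure_def
    by (simp add: nn_integral_scale_measure nn_integral_distr[OF m] measurable_restrict_space1)
  also have "(\<integral>\<^sup>+y. f (y /\<^sub>R norm y) \<partial>restrict_space lborel ?B)
      = (\<integral>\<^sup>+y. f (y /\<^sub>R norm y) * indicator ?B y \<partial>lborel)"
    by (subst nn_integral_restrict_space) auto
  finally show ?thesis .
qed

text \<open>Lebesgue measure is determined by its values on boxes, and the preimage of a box is its
  image under the inverse isometry, which has the same volume.\<close>

lemma lborel_orthogonal_transformation:
  fixes T :: "real ^ 'n::{finite, wellorder} \<Rightarrow> real ^ 'n::_"
  assumes T: "orthogonal_transformation T"
  shows "distr lborel borel T = lborel"
proof -
  have lin: "linear T" using T by (rule orthogonal_transformation_linear)
  have bij: "bij T" using T by (rule orthogonal_transformation_bij)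
  have Tm[measurable]: "T \<in> borel \<rightarrow>\<^sub>M borel"
    by (intro borel_measurable_continuous_onI linear_continuous_on linear_conv_bounded_linear[THEN iffD1] lin)
  have T': "orthogonal_transformation (inv T)"
    using T by (rule orthogonal_transformation_inv)
  have "lborel = distr lborel borel T"
  proof (rule lborel_eqI)
    fix l u :: "real ^ 'n::_" assume le: "\<And>b. b \<in> Basis \<Longrightarrow> l \<bullet> b \<le> u \<bullet> b"
    have "emeasure (distr lborel borel T) (box l u) = emeasure lborel (T -` box l u)"
      by (subst emeasure_distr) auto
    also have "T -` box l u = inv T ` box l u"
      using bij by (simp add: bij_vimage_eq_inv_image)
    also have "emeasure lborel (inv T ` box l u) = emeasure lebesgue (inv T ` box l u)"
    proof -
      have "T -` box l u \<in> sets borel" by (rule measurable_sets_borel[OF Tm]) auto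
      then have "inv T ` box l u \<in> sets lborel" using bij by (simp add: bij_vimage_eq_inv_image)
      then show ?thesis by simp
    qed
    also have "\<dots> = ennreal (measure lebesgue (inv T ` box l u))"
      by (rule emeasure_eq_measure2[OF measurable_orthogonal_image[OF T' lmeasurable_box]])
    also have "\<dots> = ennreal (measure lebesgue (box l u))"
      by (simp only: measure_orthogonal_image[OF T' lmeasurable_box])
    also have "\<dots> = (\<Prod>b\<in>Basis. (u - l) \<bullet> b)"
      using le by (simp add: measure_lborel_box_eq prod_nonneg inner_diff_left)
    finally show "emeasure (distr lborel borel T) (box l u) = (\<Prod>b\<in>Basis. (u - l) \<bullet> b)" .
  qed simp
  then show ?thesis by simp
qed

text \<open>T commutes with the radial projection and preserves the punctured ball, so the
  invariance is inherited from Lebesgue measure.\<close>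

lemma distr_sphere_measure_orthogonal:
  assumes T: "orthogonal_transformation T"
  shows "distr sphere_measure sphere_measure T = sphere_measure"
proof (rule measure_eqI)
  have lin: "linear T" using T by (rule orthogonal_transformation_linear)
  have Tm[measurable]: "T \<in> borel \<rightarrow>\<^sub>M borel"
    by (intro borel_measurable_continuous_onI linear_continuous_on linear_conv_bounded_linear[THEN iffD1] lin)
  have nT: "norm (T y) = norm y" for y using T by (rule orthogonal_transformation_norm)
  have Tms: "T \<in> measurable sphere_measure sphere_measure"
    unfolding measurable_cong_sets[OF sets_sphere_measure sets_sphere_measure]
    by (intro measurable_restrict_space2 measurable_restrict_space1 Tm)
       (auto simp: space_restrict_space nT)
  fix A assume "A \<in> sets (distr sphere_measure sphere_measure T)"
  then have A: "A \<in> sets sphere_measure" by simp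
  then have A': "A \<in> sets borel" "A \<subseteq> sphere 0 1"
    unfolding sets_sphere_measure by (auto simp: sets_restrict_space_iff)
  note A'(1)[measurable]
  have "emeasure (distr sphere_measure sphere_measure T) A = (\<integral>\<^sup>+\<xi>. indicator A (T \<xi>) \<partial>sphere_measure)"
  proof -
    have "emeasure (distr sphere_measure sphere_measure T) A
        = (\<integral>\<^sup>+\<xi>. indicator A \<xi> \<partial>distr sphere_measure sphere_measure T)"
      using A by (intro nn_integral_indicator[symmetric]) simp
    also have "\<dots> = (\<integral>\<^sup>+\<xi>. indicator A (T \<xi>) \<partial>sphere_measure)"
      using A by (intro nn_integral_distr[OF Tms]) simp
    finally show ?thesis .
  qed
  also have "\<dots> = 3 * (\<integral>\<^sup>+y. indicator A (T (y /\<^sub>R norm y)) * indicator (ball 0 1 - {0}) y \<partial>lborel)"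
    using A' by (subst nn_integral_sphere_measure) auto
  also have "(\<integral>\<^sup>+y. indicator A (T (y /\<^sub>R norm y)) * indicator (ball 0 1 - {0}) y \<partial>lborel)
     = (\<integral>\<^sup>+y. indicator A (T y /\<^sub>R norm (T y)) * indicator (ball 0 1 - {0}) (T y) \<partial>lborel)"
  proof (rule nn_integral_cong)
    fix y
    have mem: "z \<in> ball 0 1 - {0} \<longleftrightarrow> norm z < 1 \<and> norm z \<noteq> 0" for z :: "real ^ 3" by auto
    have "T y \<in> ball 0 1 - {0} \<longleftrightarrow> y \<in> ball 0 1 - {0}" unfolding mem nT ..
    then show "indicator A (T (y /\<^sub>R norm y)) * indicator (ball 0 1 - {0}) y
        = (indicator A (T y /\<^sub>R norm (T y)) * indicator (ball 0 1 - {0}) (T y) :: ennreal)"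
      unfolding nT linear_scale[OF lin] by (simp add: indicator_def)
  qed
  also have "\<dots> = (\<integral>\<^sup>+y. indicator A (y /\<^sub>R norm y) * indicator (ball 0 1 - {0}) y \<partial>distr lborel borel T)"
  proof -
    have "ball 0 1 - {0 :: real ^ 3} \<in> sets borel" by simp
    note this[measurable]
    have g: "(\<lambda>y. indicator A (y /\<^sub>R norm y) * indicator (ball 0 1 - {0}) y :: ennreal) \<in> borel_measurable borel"
      by measurable
    show ?thesis by (rule nn_integral_distr[symmetric]) (use g in simp_all)
  qed
  also have "\<dots> = (\<integral>\<^sup>+y. indicator A (y /\<^sub>R norm y) * indicator (ball 0 1 - {0}) y \<partial>lborel)"
    by (simp add: lborel_orthogonal_transformation[OF T])
  also have "3 * \<dots> = (\<integral>\<^sup>+\<xi>. indicator A \<xi> \<partial>sphere_measure)"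
    using A' by (subst nn_integral_sphere_measure) auto
  also have "\<dots> = emeasure sphere_measure A" using A by simp
  finally show "emeasure (distr sphere_measure sphere_measure T) A = emeasure sphere_measure A" .
qed simp

lemma orthogonal_transformation_measurable_sphere:
  assumes T: "orthogonal_transformation T"
  shows "T \<in> measurable sphere_measure sphere_measure"
proof -
  have Tm: "T \<in> borel \<rightarrow>\<^sub>M borel"
    by (intro borel_measurable_continuous_onI linear_continuous_on linear_conv_bounded_linear[THEN iffD1]
        orthogonal_transformation_linear T)
  then show ?thesis
    unfolding measurable_cong_sets[OF sets_sphere_measure sets_sphere_measure]
    by (intro measurable_restrict_space2 measurable_restrict_space1)
       (auto simp: space_restrict_space orthogonal_transformation_norm[OF T])
qed

lemma integral_sphere_orthogonal:
  fixes f :: "real ^ 3 \<Rightarrow> 'b::{banach, second_countable_topology}"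
  assumes T: "orthogonal_transformation T" and f: "f \<in> borel_measurable borel"
  shows "(\<integral>\<xi>. f (T \<xi>) \<partial>sphere_measure) = (\<integral>\<xi>. f \<xi> \<partial>sphere_measure)"
proof -
  have "(\<integral>\<xi>. f \<xi> \<partial>distr sphere_measure sphere_measure T) = (\<integral>\<xi>. f (T \<xi>) \<partial>sphere_measure)"
    by (intro integral_distr orthogonal_transformation_measurable_sphere T borel_measurable_sphere_measure f)
  then show ?thesis by (simp add: distr_sphere_measure_orthogonal[OF T])
qed

lemma integrable_sphere_continuous:
  fixes f :: "real ^ 3 \<Rightarrow> 'b::{banach, second_countable_topology}"
  assumes f: "continuous_on UNIV f"
  shows "integrable sphere_measure f"
proof -
  have "bounded (f ` sphere 0 1)"
    by (intro compact_imp_bounded compact_continuous_image continuous_on_subset[OF f]) auto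
  then obtain B where "\<forall>z\<in>f ` sphere 0 1. norm z \<le> B"
    unfolding bounded_iff by blast
  then have B: "norm (f x) \<le> B" if "x \<in> sphere 0 1" for x using that by blast
  show ?thesis
    by (rule finite_measure.integrable_const_bound[OF finite_measure_sphere_measure, of _ B])
       (use B in \<open>auto simp: space_sphere_measure intro!: AE_I2 borel_measurable_sphere_measure borel_measurable_continuous_onI f\<close>)
qed

section \<open>Polynomial identities and moments on the sphere\<close>

lemma poly_coeff_eqI_real:
  fixes p :: "real poly"
  assumes "\<And>\<beta>. (\<Sum>k\<le>m. c k * \<beta> ^ k) = poly p \<beta>" "k \<le> m"
  shows "c k = coeff p k"
proof -
  have "poly (\<Sum>k\<le>m. monom (c k) k) = poly p"
    by (rule ext) (simp add: poly_sum poly_monom assms(1))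
  then have "(\<Sum>k\<le>m. monom (c k) k) = p" by (simp only: poly_eq_poly_eq_iff)
  moreover have "coeff (\<Sum>k\<le>m. monom (c k) k) k = c k"
    using assms(2) by (simp add: coeff_sum)
  ultimately show ?thesis by simp
qed

text \<open>A nonzero polynomial has finitely many roots. This licenses evaluating at the imaginary
  unit an identity that rotation invariance provides for real parameters only.\<close>

lemma poly_eqI_on_reals:
  fixes p q :: "complex poly"
  assumes "\<And>\<beta>::real. poly p (of_real \<beta>) = poly q (of_real \<beta>)"
  shows "p = q"
proof (rule ccontr)
  assume "p \<noteq> q"
  then have "finite {z. poly (p - q) z = 0}" by (intro poly_roots_finite) simp
  moreover have "range complex_of_real \<subseteq> {z. poly (p - q) z = 0}" using assms by auto
  ultimately have "finite (range complex_of_real)" by (rule rev_finite_subset)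
  moreover have "infinite (range complex_of_real)"
    by (subst finite_image_iff) (auto simp: inj_on_def infinite_UNIV_char_0)
  ultimately show False by simp
qed

lemma poly_coeff_eqI_complex:
  fixes p :: "complex poly"
  assumes "\<And>\<beta>::real. (\<Sum>k\<le>m. c k * of_real \<beta> ^ k) = poly p (of_real \<beta>)" "k \<le> m"
  shows "c k = coeff p k"
proof -
  have "(\<Sum>k\<le>m. monom (c k) k) = p"
    by (rule poly_eqI_on_reals) (simp add: poly_sum poly_monom assms(1))
  moreover have "coeff (\<Sum>k\<le>m. monom (c k) k) k = c k"
    using assms(2) by (simp add: coeff_sum)
  ultimately show ?thesis by simp
qed

lemma coeff_1X2_power: "coeff ([:1, 0, 1 :: real:] ^ n) 0 = 1 \<and> coeff ([:1, 0, 1 :: real:] ^ n) 1 = 0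
    \<and> coeff ([:1, 0, 1 :: real:] ^ n) 2 = real n"
  by (induction n) (auto simp: coeff_pCons numeral_2_eq_2 split: nat.splits)

lemma integral_sphere_inner_power:
  fixes s :: "real ^ 3"
  shows "(\<integral>\<xi>. (s \<bullet> \<xi>) ^ m \<partial>sphere_measure) = norm s ^ m * (\<integral>\<xi>. (\<xi> $ 1) ^ m \<partial>sphere_measure)"
proof -
  have "norm (norm s *\<^sub>R axis 1 1 :: real ^ 3) = norm s" by simp
  then obtain T where T: "orthogonal_transformation T" "T (norm s *\<^sub>R axis 1 1 :: real ^ 3) = s"
    using orthogonal_transformation_exists by metis
  have "(\<integral>\<xi>. (s \<bullet> \<xi>) ^ m \<partial>sphere_measure) = (\<integral>\<xi>. (s \<bullet> T \<xi>) ^ m \<partial>sphere_measure)"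
    by (rule integral_sphere_orthogonal[OF T(1), of "\<lambda>\<xi>. (s \<bullet> \<xi>) ^ m", symmetric]) measurable
  also have "\<dots> = (\<integral>\<xi>. norm s ^ m * (\<xi> $ 1) ^ m \<partial>sphere_measure)"
  proof (rule arg_cong[of _ _ "integral\<^sup>L sphere_measure"], rule ext)
    fix \<xi> :: "real ^ 3"
    have "s \<bullet> T \<xi> = T (norm s *\<^sub>R axis 1 1) \<bullet> T \<xi>" by (simp only: T(2))
    also have "\<dots> = norm s *\<^sub>R axis 1 1 \<bullet> \<xi>" using T(1) by (simp add: orthogonal_transformation_def)
    finally show "(s \<bullet> T \<xi>) ^ m = norm s ^ m * (\<xi> $ 1) ^ m"
      by (simp add: inner_axis' power_mult_distrib)
  qed
  finally show ?thesis by simp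
qed

lemma integral_sphere_odd_power:
  assumes "odd m"
  shows "(\<integral>\<xi>. (\<xi> $ 1) ^ m \<partial>(sphere_measure)) = (0 :: real)"
proof -
  have "(\<integral>\<xi>. (- axis 1 1 \<bullet> \<xi>) ^ m \<partial>sphere_measure) = (\<integral>\<xi>. (\<xi> $ 1) ^ m \<partial>sphere_measure)"
    unfolding integral_sphere_inner_power by simp
  moreover have "(- axis 1 1 \<bullet> \<xi>) ^ m = - ((\<xi> $ 1) ^ m)" for \<xi> :: "real ^ 3"
    using assms by (simp add: inner_axis')
  ultimately show ?thesis by simp
qed

text \<open>By rotation invariance \<open>\<integral> (\<xi>\<^sub>1 + \<beta> \<xi>\<^sub>i)\<^sup>2\<^sup>n = (1 + \<beta>\<^sup>2)\<^sup>n \<integral> \<xi>\<^sub>1\<^sup>2\<^sup>n\<close>; compare the coefficients of \<open>\<beta>\<^sup>2\<close>.\<close>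

lemma integral_sphere_mixed:
  fixes i :: 3
  assumes i: "i \<noteq> 1" and n: "n \<ge> 1"
  shows "(2 * real n - 1) * (\<integral>\<xi>. (\<xi> $ 1) ^ (2 * n - 2) * (\<xi> $ i)\<^sup>2 \<partial>sphere_measure)
     = (\<integral>\<xi>. (\<xi> $ 1) ^ (2 * n) \<partial>sphere_measure)"
proof -
  let ?a = "\<integral>\<xi>. (\<xi> $ 1) ^ (2 * n) \<partial>sphere_measure"
  define c where "c k = real ((2 * n) choose k) * (\<integral>\<xi>. (\<xi> $ 1) ^ (2 * n - k) * (\<xi> $ i) ^ k \<partial>sphere_measure)" for k
  have "(\<Sum>k\<le>2*n. c k * \<beta> ^ k) = poly (smult ?a ([:1, 0, 1:] ^ n)) \<beta>" for \<beta>
  proof -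
    define s where "s = axis 1 1 + \<beta> *\<^sub>R axis i (1::real) "
    have s: "s \<bullet> \<xi> = \<beta> * \<xi> $ i + \<xi> $ 1" for \<xi> :: "real ^ 3"
      by (simp add: s_def inner_add_left inner_axis')
    have "(norm s)\<^sup>2 = s \<bullet> s" by (rule power2_norm_eq_inner)
    also have "\<dots> = 1 + \<beta>\<^sup>2" unfolding s using i by (simp add: s_def axis_def power2_eq_square)
    finally have ns: "norm s ^ (2 * n) = (1 + \<beta>\<^sup>2) ^ n" by (simp add: power_mult)
    have "(1 + \<beta>\<^sup>2) ^ n * ?a = (\<integral>\<xi>. (s \<bullet> \<xi>) ^ (2 * n) \<partial>sphere_measure)"
      unfolding integral_sphere_inner_power ns by simp
    also have "\<dots> = (\<integral>\<xi>. (\<Sum>k\<le>2*n. (real ((2 * n) choose k) * \<beta> ^ k) * ((\<xi> $ 1) ^ (2 * n - k) * (\<xi> $ i) ^ k)) \<partial>sphere_measure)"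
      unfolding s binomial_ring by (simp add: power_mult_distrib mult_ac)
    also have "\<dots> = (\<Sum>k\<le>2*n. \<integral>\<xi>. (real ((2 * n) choose k) * \<beta> ^ k) * ((\<xi> $ 1) ^ (2 * n - k) * (\<xi> $ i) ^ k) \<partial>sphere_measure)"
      by (intro Bochner_Integration.integral_sum integrable_sphere_continuous continuous_intros)
    also have "\<dots> = (\<Sum>k\<le>2*n. c k * \<beta> ^ k)"
      unfolding c_def integral_mult_right_zero by (simp only: mult_ac)
    finally show ?thesis by (simp add: power2_eq_square mult_ac)
  qed
  from poly_coeff_eqI_real[OF this, of 2] n
  have "c 2 = ?a * real n" by (simp add: coeff_1X2_power)
  moreover have "real ((2 * n) choose 2) = real n * (2 * real n - 1)"
  proof -
    have "real ((2 * n) choose 2) = real (n * (2 * n - 1))" by (simp add: choose_two)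
    then show ?thesis using n by (simp add: of_nat_diff)
  qed
  ultimately show ?thesis using n by (simp add: c_def)
qed

lemma sphere_components: "\<xi> \<in> sphere 0 1 \<Longrightarrow> (\<xi> $ 1)\<^sup>2 + (\<xi> $ 2)\<^sup>2 + (\<xi> $ 3)\<^sup>2 = 1" for \<xi> :: "real ^ 3"
  by (simp add: dist_norm norm_eq_1 inner_vec_def sum_3 power2_eq_square)

text \<open>Insert 1 = \<xi>_1^2 + \<xi>_2^2 + \<xi>_3^2 into the 2n-th moment a_n. By
  \<open>integral_sphere_mixed\<close> each of the last two summands contributes 1 / (2n + 1) of the
  next moment, so (2n + 1) a_n = (2n + 3) a_(n+1).\<close>

lemma integral_sphere_even_power:
  "(\<integral>\<xi>. (\<xi> $ 1) ^ (2 * n) \<partial>sphere_measure) = 4 * pi / (2 * real n + 1)"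
proof (induction n)
  case 0
  show ?case by (simp add: measure_def space_sphere_measure emeasure_sphere_measure_sphere)
next
  case (Suc n)
  let ?a = "\<lambda>n. \<integral>\<xi>. (\<xi> $ 1) ^ (2 * n) \<partial>sphere_measure"
  let ?b = "\<lambda>i. \<integral>\<xi>. (\<xi> $ 1) ^ (2 * n) * (\<xi> $ i)\<^sup>2 \<partial>sphere_measure"
  have b: "(2 * real n + 1) * ?b i = ?a (Suc n)" if "i \<noteq> 1" for i :: 3
    using integral_sphere_mixed[OF that, of "Suc n"] by (simp add: algebra_simps)
  have "?a n = (\<integral>\<xi>. (\<xi> $ 1) ^ (2 * Suc n) + ((\<xi> $ 1) ^ (2 * n) * (\<xi> $ 2)\<^sup>2 + (\<xi> $ 1) ^ (2 * n) * (\<xi> $ 3)\<^sup>2) \<partial>sphere_measure)"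
  proof (rule Bochner_Integration.integral_cong[OF refl])
    fix \<xi> :: "real ^ 3" assume "\<xi> \<in> space sphere_measure"
    then have 1: "(\<xi> $ 1)\<^sup>2 + (\<xi> $ 2)\<^sup>2 + (\<xi> $ 3)\<^sup>2 = 1"
      using sphere_components by (simp add: space_sphere_measure)
    have "(\<xi> $ 1) ^ (2 * n) = (\<xi> $ 1) ^ (2 * n) * ((\<xi> $ 1)\<^sup>2 + (\<xi> $ 2)\<^sup>2 + (\<xi> $ 3)\<^sup>2)" by (simp only: 1)
    then show "(\<xi> $ 1) ^ (2 * n) = (\<xi> $ 1) ^ (2 * Suc n) + ((\<xi> $ 1) ^ (2 * n) * (\<xi> $ 2)\<^sup>2 + (\<xi> $ 1) ^ (2 * n) * (\<xi> $ 3)\<^sup>2)"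
      by (simp add: distrib_left power_add[symmetric] add.assoc)
  qed
  also have "\<dots> = ?a (Suc n) + (?b 2 + ?b 3)"
    by (simp add: integrable_sphere_continuous continuous_intros)
  finally have "(2 * real n + 1) * ?a n = (2 * real n + 1) * ?a (Suc n) + ((2 * real n + 1) * ?b 2 + (2 * real n + 1) * ?b 3)"
    by (simp add: distrib_left)
  also have "\<dots> = (2 * real n + 3) * ?a (Suc n)"
    using b[of 2] b[of 3] by (simp add: algebra_simps)
  finally have "(2 * real n + 3) * ?a (Suc n) = 4 * pi" unfolding Suc by simp
  then have "?a (Suc n) = 4 * pi / (2 * real n + 3)" by (simp add: eq_divide_eq mult.commute)
  then show ?case by (simp add: algebra_simps)
qed

lemma coeff_linear_power: "coeff ([:1, c:] ^ n) k = of_nat (n choose k) * (c :: complex) ^ k"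
proof (cases "k \<le> n")
  case True
  then show ?thesis using coeff_linear_poly_power[of k n 1 c] by simp
next
  case False
  have "degree ([:1, c:] ^ n) \<le> n"
    using degree_power_le[of "[:1, c:]" n] by (auto intro: le_trans split: if_splits)
  with False show ?thesis by (simp add: coeff_eq_0)
qed

section \<open>Powers of isotropic linear forms and the reproducing property\<close>

text \<open>The form (a + i b) . \<xi>. For orthonormal a and b the complex vector is isotropic, (a
  + i b) . (a + i b) = 0, whence the name; the powers of the form are then harmonic
  polynomials.\<close>

definition null_form :: "real ^ 3 \<Rightarrow> real ^ 3 \<Rightarrow> real ^ 3 \<Rightarrow> complex" where
  "null_form a b \<xi> = Complex (a \<bullet> \<xi>) (b \<bullet> \<xi>)"

lemma continuous_null_form [continuous_intros]: "continuous_on A (null_form a b)"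
  unfolding null_form_def Complex_eq by (intro continuous_intros)

text \<open>For real \<beta>, rotation invariance evaluates the integral with s = \<alpha> a +
  \<beta> \<alpha> b + z, where s . s = \<alpha>^2 (1 + \<beta>^2) + 1 + 2 \<alpha> (a . z + \<beta>
  b . z). Both sides are polynomials in \<beta>, and \<beta> = i removes the quadratic term in
  \<alpha>. For odd m the one-dimensional moment is 0, so the rounding in \<open>m div 2\<close> is
  harmless.\<close>

lemma integral_null_form_poly:
  fixes a b z :: "real ^ 3"
  assumes ab: "norm a = 1" "norm b = 1" "a \<bullet> b = 0" and z: "norm z = 1"
  shows "(\<integral>\<xi>. (of_real \<alpha> * null_form a b \<xi> + of_real (z \<bullet> \<xi>)) ^ m \<partial>sphere_measure)
    = of_real (\<integral>\<xi>. (\<xi> $ 1) ^ m \<partial>sphere_measure) * (1 + 2 * of_real \<alpha> * null_form a b z) ^ (m div 2)"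
proof -
  let ?a = "\<integral>\<xi>. (\<xi> $ 1) ^ m \<partial>(sphere_measure) :: real"
  have dots: "a \<bullet> a = 1" "b \<bullet> b = 1" "z \<bullet> z = 1" "b \<bullet> a = 0" "a \<bullet> b = 0"
    using assms by (auto simp: norm_eq_1 inner_commute)
  define X where "X \<xi> = \<alpha> * (a \<bullet> \<xi>) + z \<bullet> \<xi>" for \<xi>
  define c :: "nat \<Rightarrow> complex" where "c k = of_nat (m choose k) * (\<integral>\<xi>. of_real (X \<xi> ^ (m - k) * (\<alpha> * (b \<bullet> \<xi>)) ^ k) \<partial>sphere_measure)" for k :: nat
  define L where "L = (\<Sum>k\<le>m. monom (c k :: complex) k)"
  define R :: "complex poly" where "R = smult (of_real ?a) ([:of_real (\<alpha>\<^sup>2 + 1 + 2 * \<alpha> * (a \<bullet> z)), of_real (2 * \<alpha> * (b \<bullet> z)), of_real (\<alpha>\<^sup>2):] ^ (m div 2))"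
  have Lint: "poly L y = (\<integral>\<xi>. (of_real (X \<xi>) + y * of_real (\<alpha> * (b \<bullet> \<xi>))) ^ m \<partial>sphere_measure)" for y
  proof -
    have "(\<integral>\<xi>. (of_real (X \<xi>) + y * of_real (\<alpha> * (b \<bullet> \<xi>))) ^ m \<partial>sphere_measure)
      = (\<integral>\<xi>. (\<Sum>k\<le>m. (of_nat (m choose k) * y ^ k) * of_real (X \<xi> ^ (m - k) * (\<alpha> * (b \<bullet> \<xi>)) ^ k)) \<partial>sphere_measure)"
      unfolding add.commute[of "of_real (X _)"] binomial_ring
      by (intro Bochner_Integration.integral_cong sum.cong refl) (simp add: power_mult_distrib mult_ac)
    also have "\<dots> = (\<Sum>k\<le>m. \<integral>\<xi>. (of_nat (m choose k) * y ^ k) * of_real (X \<xi> ^ (m - k) * (\<alpha> * (b \<bullet> \<xi>)) ^ k) \<partial>sphere_measure)"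
      unfolding X_def
      by (intro Bochner_Integration.integral_sum integrable_sphere_continuous continuous_intros)
    also have "\<dots> = (\<Sum>k\<le>m. c k * y ^ k)"
      unfolding c_def integral_mult_right_zero by (simp only: mult_ac)
    also have "\<dots> = poly L y" by (simp add: L_def poly_sum poly_monom)
    finally show ?thesis by simp
  qed
  have "L = R"
  proof (rule poly_eqI_on_reals)
    fix \<beta> :: real
    define s where "s = \<alpha> *\<^sub>R a + (\<beta> * \<alpha>) *\<^sub>R b + z"
    have "poly L (of_real \<beta>) = (\<integral>\<xi>. complex_of_real ((s \<bullet> \<xi>) ^ m) \<partial>sphere_measure)"
      unfolding Lint
      by (intro Bochner_Integration.integral_cong refl) (simp add: s_def X_def inner_add_left algebra_simps)
    also have "\<dots> = of_real (norm s ^ m * ?a)"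
      by (simp only: integral_complex_of_real integral_sphere_inner_power)
    also have "norm s ^ m * ?a = (s \<bullet> s) ^ (m div 2) * ?a"
    proof (cases "even m")
      case True
      then have "norm s ^ m = (norm s)\<^sup>2 ^ (m div 2)" by (simp flip: power_mult)
      then show ?thesis by (simp only: power2_norm_eq_inner)
    next
      case False
      then show ?thesis using integral_sphere_odd_power by simp
    qed
    also have "s \<bullet> s = (\<alpha>\<^sup>2 + 1 + 2 * \<alpha> * (a \<bullet> z)) + \<beta> * (2 * \<alpha> * (b \<bullet> z) + \<beta> * \<alpha>\<^sup>2)"
    proof -
      have "s \<bullet> s = \<alpha> * (\<alpha> * 1 + \<beta> * \<alpha> * 0 + a \<bullet> z) + \<beta> * \<alpha> * (\<alpha> * 0 + \<beta> * \<alpha> * 1 + b \<bullet> z)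
          + (\<alpha> * (a \<bullet> z) + \<beta> * \<alpha> * (b \<bullet> z) + 1)"
        unfolding s_def inner_add_left inner_add_right inner_scaleR_left inner_scaleR_right
          dots inner_commute[of z a] inner_commute[of z b] by (simp only: distrib_left)
      then show ?thesis by (simp add: power2_eq_square algebra_simps)
    qed
    finally show "poly L (of_real \<beta>) = poly R (of_real \<beta>)"
      by (simp add: R_def mult.commute)
  qed
  have "(\<integral>\<xi>. (of_real \<alpha> * null_form a b \<xi> + of_real (z \<bullet> \<xi>)) ^ m \<partial>sphere_measure) = poly L \<i>"
    unfolding Lint
    by (intro Bochner_Integration.integral_cong refl arg_cong[of _ _ "\<lambda>u. u ^ m"])
       (simp add: null_form_def X_def Complex_eq algebra_simps)
  also have "\<dots> = of_real ?a * (of_real (\<alpha>\<^sup>2 + 1 + 2 * \<alpha> * (a \<bullet> z)) + \<i> * (of_real (2 * \<alpha> * (b \<bullet> z)) + \<i> * of_real (\<alpha>\<^sup>2))) ^ (m div 2)"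
    unfolding \<open>L = R\<close> by (simp add: R_def)
  also have "of_real (\<alpha>\<^sup>2 + 1 + 2 * \<alpha> * (a \<bullet> z)) + \<i> * (of_real (2 * \<alpha> * (b \<bullet> z)) + \<i> * of_real (\<alpha>\<^sup>2))
     = 1 + 2 * of_real \<alpha> * null_form a b z"
    by (rule complex_eqI) (simp_all add: null_form_def)
  finally show ?thesis .
qed

text \<open>Compare the coefficients of \<alpha>^l in \<open>integral_null_form_poly\<close> with m
  = l + j. The right-hand side has degree at most (l + j) div 2 in \<alpha>, which reaches l only
  for j = l: powers of an isotropic form are orthogonal to lower powers of z . \<xi>.\<close>

lemma integral_null_form_power:
  fixes a b z :: "real ^ 3"
  assumes ab: "norm a = 1" "norm b = 1" "a \<bullet> b = 0" and z: "norm z = 1" and jl: "j \<le> l"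
  shows "of_nat ((l + j) choose l) * (\<integral>\<xi>. null_form a b \<xi> ^ l * of_real ((z \<bullet> \<xi>) ^ j) \<partial>sphere_measure)
    = (if j = l then of_real (4 * pi / (2 * real l + 1)) * (2 * null_form a b z) ^ l else 0)"
proof -
  define m where "m = l + j"
  let ?a = "\<integral>\<xi>. (\<xi> $ 1) ^ m \<partial>(sphere_measure) :: real"
  define c :: "nat \<Rightarrow> complex" where "c k = of_nat (m choose k) * (\<integral>\<xi>. null_form a b \<xi> ^ k * of_real ((z \<bullet> \<xi>) ^ (m - k)) \<partial>sphere_measure)" for k :: nat
  have "(\<Sum>k\<le>m. c k * of_real \<alpha> ^ k) = poly (smult (of_real ?a) ([:1, 2 * null_form a b z:] ^ (m div 2))) (of_real \<alpha>)" for \<alpha>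
  proof -
    have "(\<Sum>k\<le>m. c k * of_real \<alpha> ^ k) = (\<Sum>k\<le>m. \<integral>\<xi>. (of_nat (m choose k) * of_real \<alpha> ^ k) * (null_form a b \<xi> ^ k * of_real ((z \<bullet> \<xi>) ^ (m - k))) \<partial>sphere_measure)"
      unfolding c_def integral_mult_right_zero by (simp only: mult_ac)
    also have "\<dots> = (\<integral>\<xi>. (\<Sum>k\<le>m. (of_nat (m choose k) * of_real \<alpha> ^ k) * (null_form a b \<xi> ^ k * of_real ((z \<bullet> \<xi>) ^ (m - k)))) \<partial>sphere_measure)"
      by (intro Bochner_Integration.integral_sum[symmetric] integrable_sphere_continuous continuous_intros)
    also have "\<dots> = (\<integral>\<xi>. (of_real \<alpha> * null_form a b \<xi> + of_real (z \<bullet> \<xi>)) ^ m \<partial>sphere_measure)"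
      unfolding binomial_ring
      by (intro Bochner_Integration.integral_cong sum.cong refl) (simp add: power_mult_distrib mult_ac)
    also have "\<dots> = poly (smult (of_real ?a) ([:1, 2 * null_form a b z:] ^ (m div 2))) (of_real \<alpha>)"
      unfolding integral_null_form_poly[OF ab z] by (simp add: mult_ac)
    finally show ?thesis .
  qed
  from poly_coeff_eqI_complex[OF this, of l]
  have "c l = of_real ?a * (of_nat ((m div 2) choose l) * (2 * null_form a b z) ^ l)"
    by (simp add: m_def coeff_linear_power)
  also have "\<dots> = (if j = l then of_real (4 * pi / (2 * real l + 1)) * (2 * null_form a b z) ^ l else 0)"
  proof (cases "j = l")
    case True
    then have "m = 2 * l" by (simp add: m_def)
    then show ?thesis using True by (simp add: integral_sphere_even_power)
  next
    case False
    then have "m div 2 < l" using jl by (simp add: m_def)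
    then show ?thesis using False by (simp add: binomial_eq_0)
  qed
  finally show ?thesis by (simp add: c_def m_def)
qed

lemma poly_legendre_sum: "poly (legendre_poly l) t = (\<Sum>j\<le>l. coeff (legendre_poly l) j * t ^ j)"
  unfolding poly_altdef
  by (rule sum.mono_neutral_left) (use degree_legendre_le in \<open>auto simp: coeff_eq_0\<close>)

lemma continuous_legendre [continuous_intros]:
  "continuous_on A f \<Longrightarrow> continuous_on A (\<lambda>x. poly (legendre_poly l) (f x))"
  by (rule continuous_on_poly)

text \<open>A null vector \<open>a + \<i> b\<close> makes \<open>((a + \<i> b) \<bullet> \<xi>)\<^sup>l\<close> a spherical harmonic, so only the top coefficient of
  the Legendre polynomial contributes.\<close>

lemma integral_null_form_legendre:
  fixes a b z :: "real ^ 3"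
  assumes ab: "norm a = 1" "norm b = 1" "a \<bullet> b = 0" and z: "norm z = 1"
  shows "(\<integral>\<xi>. null_form a b \<xi> ^ l * of_real (poly (legendre_poly l) (z \<bullet> \<xi>)) \<partial>sphere_measure)
    = of_real (4 * pi / (2 * real l + 1)) * null_form a b z ^ l"
proof -
  let ?J = "\<lambda>j. \<integral>\<xi>. null_form a b \<xi> ^ l * of_real ((z \<bullet> \<xi>) ^ j) \<partial>sphere_measure"
  have J0: "?J j = 0" if "j < l" for j
    using integral_null_form_power[OF ab z, of j l] that by (simp add: binomial_eq_0_iff)
  have "(\<integral>\<xi>. null_form a b \<xi> ^ l * of_real (poly (legendre_poly l) (z \<bullet> \<xi>)) \<partial>sphere_measure)
     = (\<integral>\<xi>. (\<Sum>j\<le>l. of_real (coeff (legendre_poly l) j) * (null_form a b \<xi> ^ l * of_real ((z \<bullet> \<xi>) ^ j))) \<partial>sphere_measure)"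
    unfolding poly_legendre_sum of_real_sum sum_distrib_left
    by (intro Bochner_Integration.integral_cong sum.cong refl) (simp add: mult_ac)
  also have "\<dots> = (\<Sum>j\<le>l. \<integral>\<xi>. of_real (coeff (legendre_poly l) j) * (null_form a b \<xi> ^ l * of_real ((z \<bullet> \<xi>) ^ j)) \<partial>sphere_measure)"
    by (intro Bochner_Integration.integral_sum integrable_sphere_continuous continuous_intros)
  also have "\<dots> = (\<Sum>j\<le>l. of_real (coeff (legendre_poly l) j) * ?J j)"
    by (simp only: integral_mult_right_zero)
  also have "\<dots> = (\<Sum>j\<in>{l}. of_real (coeff (legendre_poly l) j) * ?J j)"
    by (rule sum.mono_neutral_right) (auto simp: J0 simp del: of_real_power)
  \<comment> \<open>The leading coefficient (2l choose l) / 2^l carries precisely the binomial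
    factor of \<open>integral_null_form_power\<close>; the remaining powers of 2 cancel.\<close>
  also have "\<dots> = of_real (1 / 2 ^ l) * (of_nat ((l + l) choose l) * ?J l)"
    by (simp add: coeff_legendre_top mult_2)
  also have "\<dots> = of_real (1 / 2 ^ l) * (of_real (4 * pi / (2 * real l + 1)) * (2 * null_form a b z) ^ l)"
    unfolding integral_null_form_power[OF ab z le_refl] by simp
  finally show ?thesis by (simp add: power_mult_distrib)
qed

text \<open>Write \<xi>_2 + i \<xi>_3 = \<rho> e^(i \<psi>). Then \<xi>_1 + i \<rho> cos (\<theta> -
  \<psi>) is an isotropic form of \<xi> built from e_1 and cos \<theta> e_2 + sin \<theta> e_3,
  which are the same for all \<xi>. The discrete Laplace formula thus displays the zonal function as
  a fixed finite average of powers of isotropic forms.\<close>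

lemma legendre_laplace_sphere:
  fixes \<xi> :: "real ^ 3"
  assumes \<xi>: "norm \<xi> = 1" and M: "l < M"
  shows "of_real (poly (legendre_poly l) (\<xi> $ 1)) = (1 / of_nat M) *
    (\<Sum>k<M. null_form (axis 1 1) (cos (2 * pi * real k / real M) *\<^sub>R axis 2 1 + sin (2 * pi * real k / real M) *\<^sub>R axis 3 1) \<xi> ^ l)"
proof -
  have 1: "(\<xi> $ 1)\<^sup>2 + (\<xi> $ 2)\<^sup>2 + (\<xi> $ 3)\<^sup>2 = 1" using \<xi> sphere_components[of \<xi>] by simp
  define \<psi> where "\<psi> = Arg (Complex (\<xi> $ 2) (\<xi> $ 3))"
  define \<rho> where "\<rho> = sqrt (1 - (\<xi> $ 1)\<^sup>2)"
  have "cmod (Complex (\<xi> $ 2) (\<xi> $ 3)) = \<rho>" using 1 by (simp add: \<rho>_def cmod_def algebra_simps)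
  then have "Complex (\<xi> $ 2) (\<xi> $ 3) = of_real \<rho> * cis \<psi>"
    using rcis_cmod_Arg[of "Complex (\<xi> $ 2) (\<xi> $ 3)"] by (simp add: \<psi>_def rcis_def)
  then have 23: "\<xi> $ 2 = \<rho> * cos \<psi>" "\<xi> $ 3 = \<rho> * sin \<psi>" by (auto simp: complex_eq_iff)
  have "(\<xi> $ 1)\<^sup>2 \<le> 1" using 1 by (smt (verit) zero_le_power2)
  then have t: "\<bar>\<xi> $ 1\<bar> \<le> 1" by (simp add: abs_square_le_1)
  have "null_form (axis 1 1) (cos \<theta> *\<^sub>R axis 2 1 + sin \<theta> *\<^sub>R axis 3 1) \<xi>
      = of_real (\<xi> $ 1) + \<i> * of_real (\<rho> * cos (\<theta> - \<psi>))" for \<theta>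
    by (rule complex_eqI) (simp_all add: null_form_def inner_axis' inner_add_left 23 cos_diff algebra_simps)
  then show ?thesis
    using legendre_laplace[OF t M, of \<psi>] by (simp add: \<rho>_def)
qed

lemma norm_axis_circle: "norm (cos \<theta> *\<^sub>R axis 2 1 + sin \<theta> *\<^sub>R axis 3 1 :: real ^ 3) = 1"
  by (simp add: norm_eq_1 inner_vec_def sum_3 axis_def power2_eq_square[symmetric])

text \<open>After rotating x to the first axis, P_l (\<xi>_1) is an average of l-th powers of
  isotropic forms. Each of them is reproduced by integration against P_l (z . \<xi>), up to 4 \<pi>
  / (2l + 1), and averaging the reproduced values at the rotated z gives P_l again. The mean
  vanishes since for l > 0 these powers are orthogonal to constants.\<close>

lemma integral_legendre_product:
  fixes x z :: "real ^ 3"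
  assumes x: "norm x = 1" and z: "norm z = 1"
  shows "(\<integral>\<xi>. poly (legendre_poly l) (x \<bullet> \<xi>) * poly (legendre_poly l) (z \<bullet> \<xi>) \<partial>sphere_measure)
     = 4 * pi / (2 * real l + 1) * poly (legendre_poly l) (x \<bullet> z)"
    and "l > 0 \<Longrightarrow> (\<integral>\<xi>. poly (legendre_poly l) (x \<bullet> \<xi>) \<partial>sphere_measure) = 0"
proof -
  let ?P = "\<lambda>t. poly (legendre_poly l) t"
  obtain T where T: "orthogonal_transformation T" "T (axis 1 1 :: real ^ 3) = x"
    using orthogonal_transformation_exists[of "axis 1 1" x] x by auto
  have xT: "x \<bullet> T \<xi> = \<xi> $ 1" for \<xi>
  proof -
    have "x \<bullet> T \<xi> = T (axis 1 1) \<bullet> T \<xi>" by (simp only: T(2))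
    also have "\<dots> = axis 1 1 \<bullet> \<xi>" using T(1) unfolding orthogonal_transformation_def by blast
    finally show ?thesis by (simp add: inner_axis')
  qed
  obtain w where w: "T w = z"
    using orthogonal_transformation_surj[OF T(1)] by (metis surjD)
  have nw: "norm w = 1" using z w T(1) by (metis orthogonal_transformation_norm)
  have zT: "z \<bullet> T \<xi> = w \<bullet> \<xi>" for \<xi> using T(1) w by (auto simp: orthogonal_transformation_def)
  have xz: "x \<bullet> z = w $ 1" using xT w by auto
  define b :: "nat \<Rightarrow> real ^ 3" where "b k = cos (2 * pi * real k / real (Suc l)) *\<^sub>R axis 2 1 + sin (2 * pi * real k / real (Suc l)) *\<^sub>R axis 3 (1::real)" for k
  have nb: "norm (b k :: real ^ 3) = 1" for k unfolding b_def by (rule norm_axis_circle)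
  have ab: "axis 1 1 \<bullet> (b k :: real ^ 3) = 0" for k by (simp add: b_def inner_axis') (simp add: axis_def)
  have na: "norm (axis 1 1 :: real ^ 3) = 1" by simp
  have lap: "of_real (?P (\<xi> $ 1)) = (1 / of_nat (Suc l)) * (\<Sum>k<Suc l. null_form (axis 1 1) (b k) \<xi> ^ l)"
    if "norm \<xi> = 1" for \<xi> :: "real ^ 3"
    unfolding b_def by (rule legendre_laplace_sphere[OF that lessI])
  have I1: "(\<integral>\<xi>. of_real (?P (\<xi> $ 1)) * g \<xi> \<partial>sphere_measure)
     = (1 / of_nat (Suc l)) * (\<Sum>k<Suc l. \<integral>\<xi>. null_form (axis 1 1) (b k) \<xi> ^ l * g \<xi> \<partial>sphere_measure)"
    if g: "continuous_on UNIV g" for g :: "real ^ 3 \<Rightarrow> complex"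
  proof -
    have "(\<integral>\<xi>. of_real (?P (\<xi> $ 1)) * g \<xi> \<partial>sphere_measure)
      = (\<integral>\<xi>. (1 / of_nat (Suc l)) * (\<Sum>k<Suc l. null_form (axis 1 1) (b k) \<xi> ^ l * g \<xi>) \<partial>sphere_measure)"
      by (intro Bochner_Integration.integral_cong refl)
         (simp only: space_sphere_measure mem_sphere_0 lap sum_distrib_right mult.assoc)
    also have "\<dots> = (1 / of_nat (Suc l)) * (\<integral>\<xi>. (\<Sum>k<Suc l. null_form (axis 1 1) (b k) \<xi> ^ l * g \<xi>) \<partial>sphere_measure)"
      by (simp only: integral_mult_right_zero)
    also have "(\<integral>\<xi>. (\<Sum>k<Suc l. null_form (axis 1 1) (b k) \<xi> ^ l * g \<xi>) \<partial>sphere_measure)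
       = (\<Sum>k<Suc l. \<integral>\<xi>. null_form (axis 1 1) (b k) \<xi> ^ l * g \<xi> \<partial>sphere_measure)"
      by (intro Bochner_Integration.integral_sum integrable_sphere_continuous continuous_intros g)
    finally show ?thesis .
  qed
  have "complex_of_real (\<integral>\<xi>. ?P (x \<bullet> \<xi>) * ?P (z \<bullet> \<xi>) \<partial>sphere_measure)
      = of_real (\<integral>\<xi>. ?P (x \<bullet> T \<xi>) * ?P (z \<bullet> T \<xi>) \<partial>sphere_measure)"
    by (intro arg_cong[of _ _ of_real] integral_sphere_orthogonal[OF T(1), symmetric]
        borel_measurable_continuous_onI continuous_intros)
  also have "\<dots> = (\<integral>\<xi>. of_real (?P (\<xi> $ 1)) * of_real (?P (w \<bullet> \<xi>)) \<partial>sphere_measure)"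
    unfolding xT zT by (simp flip: integral_complex_of_real)
  also have "\<dots> = (1 / of_nat (Suc l)) * (\<Sum>k<Suc l. of_real (4 * pi / (2 * real l + 1)) * null_form (axis 1 1) (b k) w ^ l)"
    by (subst I1) (auto simp only: integral_null_form_legendre[OF na nb ab nw] intro!: continuous_intros)
  also have "\<dots> = of_real (4 * pi / (2 * real l + 1)) * of_real (?P (w $ 1))"
    unfolding lap[OF nw] by (simp only: sum_distrib_left mult_ac)
  also have "\<dots> = of_real (4 * pi / (2 * real l + 1) * ?P (x \<bullet> z))" by (simp only: xz of_real_mult)
  finally show "(\<integral>\<xi>. ?P (x \<bullet> \<xi>) * ?P (z \<bullet> \<xi>) \<partial>sphere_measure) = 4 * pi / (2 * real l + 1) * ?P (x \<bullet> z)"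
    by (simp only: of_real_eq_iff)
  assume l: "l > 0"
  have J: "(\<integral>\<xi>. null_form (axis 1 1) (b k) \<xi> ^ l * 1 \<partial>sphere_measure) = 0" for k
    using integral_null_form_power[OF na nb ab z, of 0 l] l by simp
  have "complex_of_real (\<integral>\<xi>. ?P (x \<bullet> \<xi>) \<partial>sphere_measure) = of_real (\<integral>\<xi>. ?P (x \<bullet> T \<xi>) \<partial>sphere_measure)"
    by (intro arg_cong[of _ _ of_real] integral_sphere_orthogonal[OF T(1), symmetric]
        borel_measurable_continuous_onI continuous_intros)
  also have "\<dots> = (\<integral>\<xi>. of_real (?P (\<xi> $ 1)) * 1 \<partial>sphere_measure)"
    unfolding xT by (simp flip: integral_complex_of_real)
  also have "\<dots> = 0" by (subst I1) (auto simp only: J intro!: continuous_intros, simp)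
  finally show "(\<integral>\<xi>. ?P (x \<bullet> \<xi>) \<partial>sphere_measure) = 0" by simp
qed

text \<open>Since \<open>u\<^sup>2 + v\<^sup>2 \<ge> \<bar>u v\<bar>\<close>, a singularity along an axis is dominated by a product of one-dimensional
  integrable weights; no polar coordinates are needed.\<close>

definition singular_weight :: "real \<Rightarrow> ennreal" where
  "singular_weight u = (if u = 0 then \<infinity> else ennreal (\<bar>u\<bar> powr (-3/4))) * indicator {-1..1} u"

lemma singular_weight_measurable [measurable]: "singular_weight \<in> borel_measurable borel"
  unfolding singular_weight_def[abs_def] by measurable

text \<open>The exponent -3/4 is above -1; each half of the interval contributes 4, and the infinite
  value at 0 sits on a null set.\<close>

lemma nn_integral_singular_weight: "(\<integral>\<^sup>+u. singular_weight u \<partial>lborel) < \<infinity>"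
proof -
  let ?g = "\<lambda>u::real. ennreal (u powr (-3/4)) * indicator {0..1} u"
  have "((\<lambda>x. x powr (-3/4)) has_integral (1 powr (-3/4 + 1) / (-3/4 + 1))) {0..1::real}"
    by (rule has_integral_powr_from_0) auto
  then have "((\<lambda>x. x powr (-3/4)) has_integral 4) {0..1::real}" by simp
  then have "(\<integral>\<^sup>+u. ennreal (indicator {0..1} u * u powr (-3/4)) \<partial>lborel) = ennreal 4"
  proof (intro nn_integral_has_integral_lborel)
    assume "((\<lambda>x. x powr (-3/4)) has_integral 4) {0..1::real}"
    then have "((\<lambda>x. if x \<in> {0..1} then x powr (-3/4) else 0) has_integral 4) (UNIV :: real set)"
      by (simp only: has_integral_restrict_UNIV)
    moreover have "(\<lambda>x. if x \<in> {0..1} then x powr (-3/4) else 0) = (\<lambda>u. indicator {0..1} u * u powr (-3/4) :: real)"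
      by (auto simp: indicator_def)
    ultimately show "((\<lambda>u. indicator {0..1} u * u powr (-3/4)) has_integral 4) (UNIV :: real set)" by simp
  qed auto
  moreover have "(\<lambda>u. ennreal (indicator {0..1} u * u powr (-3/4))) = ?g"
    by (auto simp: indicator_def)
  ultimately have A: "(\<integral>\<^sup>+u. ?g u \<partial>lborel) = ennreal 4" by simp
  have "(\<integral>\<^sup>+u. ?g u \<partial>lborel) = (\<integral>\<^sup>+u. ?g (- u) \<partial>lborel)"
    using nn_integral_real_affine[of ?g "-1" 0] by simp
  then have B: "(\<integral>\<^sup>+u. ?g (- u) \<partial>lborel) = ennreal 4" using A by simp
  have "(\<integral>\<^sup>+u. singular_weight u \<partial>lborel) \<le> (\<integral>\<^sup>+u. ?g u + ?g (- u) \<partial>lborel)"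
  proof (rule nn_integral_mono_AE)
    show "AE u in lborel. singular_weight u \<le> ?g u + ?g (- u)"
      using AE_lborel_singleton[of 0]
    proof eventually_elim
      case (elim u)
      then show ?case by (auto simp: singular_weight_def indicator_def abs_if)
    qed
  qed
  also have "\<dots> = (\<integral>\<^sup>+u. ?g u \<partial>lborel) + (\<integral>\<^sup>+u. ?g (- u) \<partial>lborel)"
    by (rule nn_integral_add) auto
  also have "\<dots> = ennreal 4 + ennreal 4" by (simp only: A B)
  also have "\<dots> < \<infinity>" by (simp add: ennreal_add_eq_top less_top[symmetric])
  finally show ?thesis .
qed

text \<open>The power is decreasing and |u v| \<le> w. The value \<infinity> at 0 keeps the
  inequality true at every point, including the axis w = 0.\<close>

lemma weight_le_singular_product:
  assumes "\<bar>u\<bar> \<le> 1" "\<bar>v\<bar> \<le> 1" "u\<^sup>2 + v\<^sup>2 \<le> w"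
  shows "(if w = 0 then \<infinity> else ennreal (w powr (-3/4))) \<le> singular_weight u * singular_weight v"
proof -
  have i: "indicator {-1..1} u = (1 :: ennreal)" "indicator {-1..1} v = (1 :: ennreal)"
    using assms by (auto simp: indicator_def)
  show ?thesis
  proof (cases "u = 0 \<or> v = 0")
    case True
    then have "singular_weight u * singular_weight v = \<infinity>"
      by (auto simp: singular_weight_def i ennreal_top_mult ennreal_mult_top)
    then show ?thesis by simp
  next
    case False
    have "2 * (\<bar>u\<bar> * \<bar>v\<bar>) \<le> u\<^sup>2 + v\<^sup>2"
      using sum_squares_bound[of "\<bar>u\<bar>" "\<bar>v\<bar>"] by simp
    moreover have "0 \<le> \<bar>u\<bar> * \<bar>v\<bar>" by simp
    ultimately have uv: "\<bar>u\<bar> * \<bar>v\<bar> \<le> w" "\<bar>u\<bar> * \<bar>v\<bar> > 0" using assms(3) False by (linarith, simp)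
    then have "w powr (-3/4) \<le> (\<bar>u\<bar> * \<bar>v\<bar>) powr (-3/4)"
      by (intro powr_mono2') auto
    also have "\<dots> = \<bar>u\<bar> powr (-3/4) * \<bar>v\<bar> powr (-3/4)" by (simp add: powr_mult)
    finally have "w powr (-3/4) \<le> \<bar>u\<bar> powr (-3/4) * \<bar>v\<bar> powr (-3/4)" .
    moreover have "w \<noteq> 0" using uv by auto
    ultimately show ?thesis using False
      by (auto simp: singular_weight_def i ennreal_mult[symmetric] intro!: ennreal_leI)
  qed
qed

text \<open>For y in the punctured ball, 1 minus the squared first component of y / |y| is (y_2^2 +
  y_3^2) / |y|^2, at least y_2^2 + y_3^2 because |y| < 1. The integrand is therefore below a product
  over the coordinates, and Tonelli leaves 2 from the first coordinate and one weight integral from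
  each of the others.\<close>

lemma nn_integral_sphere_weight:
  "(\<integral>\<^sup>+\<xi>. (if 1 - (\<xi> $ 1)\<^sup>2 = 0 then \<infinity> else ennreal ((1 - (\<xi> $ 1)\<^sup>2) powr (-3/4))) \<partial>sphere_measure) < \<infinity>"
proof -
  let ?I = "\<integral>\<^sup>+u. singular_weight u \<partial>lborel"
  define f where "f b u = (if b = (axis 1 1 :: real ^ 3) then indicator {-1..1} u else singular_weight u)" for b and u :: real
  have [measurable]: "f b \<in> borel_measurable borel" for b
    unfolding f_def by measurable
  have prodB: "(\<Prod>b\<in>(Basis :: (real ^ 3) set). h b) = h (axis 1 1) * (h (axis 2 1) * h (axis 3 1))"
    for h :: "real ^ 3 \<Rightarrow> ennreal"
  proof -
    have B: "(Basis :: (real ^ 3) set) = {axis 1 1, axis 2 1, axis 3 1}"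
      by (auto simp: Basis_vec_def UNIV_3)
    show ?thesis unfolding B by (simp add: axis_eq_axis)
  qed
  have ne: "axis 2 1 \<noteq> (axis 1 1 :: real ^ 3)" "axis 3 1 \<noteq> (axis 1 1 :: real ^ 3)"
    by (simp_all add: axis_eq_axis)
  have "(\<integral>\<^sup>+\<xi>. (if 1 - (\<xi> $ 1)\<^sup>2 = 0 then \<infinity> else ennreal ((1 - (\<xi> $ 1)\<^sup>2) powr (-3/4))) \<partial>sphere_measure)
     = 3 * (\<integral>\<^sup>+(y :: real ^ 3). (if 1 - ((y /\<^sub>R norm y) $ 1)\<^sup>2 = 0 then \<infinity> else ennreal ((1 - ((y /\<^sub>R norm y) $ 1)\<^sup>2) powr (-3/4)))
        * indicator (ball 0 1 - {0}) y \<partial>lborel)"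
    by (rule nn_integral_sphere_measure[of "\<lambda>\<xi>. if 1 - (\<xi> $ 1)\<^sup>2 = 0 then \<infinity> else ennreal ((1 - (\<xi> $ 1)\<^sup>2) powr (-3/4))"]) measurable
  also have "\<dots> \<le> 3 * (\<integral>\<^sup>+(y :: real ^ 3). (\<Prod>b\<in>Basis. f b (y \<bullet> b)) \<partial>lborel)"
  proof (intro mult_left_mono nn_integral_mono)
    fix y :: "real ^ 3"
    let ?w = "1 - ((y /\<^sub>R norm y) $ 1)\<^sup>2"
    show "(if ?w = 0 then \<infinity> else ennreal (?w powr (-3/4))) * indicator (ball 0 1 - {0}) y \<le> (\<Prod>b\<in>Basis. f b (y \<bullet> b))"
    proof (cases "y \<in> ball 0 1 - {0}")
      case True
      then have n: "0 < norm y" "norm y < 1" by auto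
      have c: "\<bar>y $ i\<bar> \<le> 1" for i using component_le_norm_cart[of y i] n by linarith
      have ny: "(norm y)\<^sup>2 = (y $ 1)\<^sup>2 + (y $ 2)\<^sup>2 + (y $ 3)\<^sup>2"
        unfolding power2_norm_eq_inner by (simp add: inner_vec_def sum_3 power2_eq_square)
      have "?w = ((y $ 2)\<^sup>2 + (y $ 3)\<^sup>2) / (norm y)\<^sup>2"
      proof -
        have "1 - ((y /\<^sub>R norm y) $ 1)\<^sup>2 = ((norm y)\<^sup>2 - (y $ 1)\<^sup>2) / (norm y)\<^sup>2"
          using n by (simp add: power_mult_distrib power_inverse diff_divide_distrib) (simp add: divide_inverse mult.commute)
        then show ?thesis by (simp add: ny)
      qed
      moreover have "(norm y)\<^sup>2 \<le> 1" using n by (simp add: power_le_one)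
      ultimately have "(y $ 2)\<^sup>2 + (y $ 3)\<^sup>2 \<le> ?w"
        using n by (simp add: pos_le_divide_eq) (metis add_nonneg_nonneg mult_left_le zero_le_power2)
      from weight_le_singular_product[OF c c this]
      show ?thesis using True c[of 1] by (simp add: prodB f_def ne inner_axis indicator_def abs_le_iff)
    qed simp
  qed simp
  also have "(\<integral>\<^sup>+(y :: real ^ 3). (\<Prod>b\<in>Basis. f b (y \<bullet> b)) \<partial>lborel) = (\<Prod>b\<in>(Basis :: (real ^ 3) set). (\<integral>\<^sup>+u. f b u \<partial>lborel))"
    by (rule nn_integral_lborel_prod) auto
  also have "\<dots> = 2 * (?I * ?I)"
    by (simp add: prodB f_def ne)
  also have "3 * \<dots> < \<infinity>"
    using nn_integral_singular_weight by (simp add: ennreal_mult_less_top)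
  finally show ?thesis .
qed

section \<open>Cubes of Legendre polynomials\<close>

text \<open>The Bernstein type bound on P_l^2, raised to the power 3/2; the exponent -3/4 is -1/2
  times 3/2.\<close>

lemma legendre_cube_le_weight:
  assumes t: "\<bar>t\<bar> < 1" and l: "l \<ge> 1"
  shows "\<bar>poly (legendre_poly l) t\<bar> ^ 3 \<le> (10 / real l) powr (3/2) * (1 - t\<^sup>2) powr (-3/4)"
proof -
  define w where "w = 1 - t\<^sup>2"
  define p where "p = \<bar>poly (legendre_poly l) t\<bar>"
  have w: "w > 0" using t by (simp add: w_def abs_square_less_1)
  have "sqrt w * p\<^sup>2 \<le> 10 / real l"
    using legendre_bound[OF t l] by (simp add: w_def p_def)
  then have "p\<^sup>2 \<le> (10 / real l) / sqrt w" using w by (simp add: pos_le_divide_eq mult.commute del: divide_divide_eq_left)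
  then have "(p\<^sup>2) powr (3/2) \<le> ((10 / real l) / sqrt w) powr (3/2)"
    by (intro powr_mono2) auto
  also have "\<dots> = (10 / real l) powr (3/2) / (sqrt w) powr (3/2)"
    using w by (simp add: powr_divide powr_mult)
  also have "(sqrt w) powr (3/2) = w powr (3/4)"
    using w by (simp add: powr_half_sqrt[symmetric] powr_powr)
  also have "(p\<^sup>2) powr (3/2) = p ^ 3"
  proof (cases "p = 0")
    case False
    then have "p > 0" by (simp add: p_def)
    then show ?thesis by (simp add: powr_powr flip: powr_numeral)
  qed simp
  finally show ?thesis by (simp add: w_def p_def powr_minus_divide)
qed

text \<open>The integral is finite by \<open>nn_integral_sphere_weight\<close>, so
  \<open>enn2real\<close> preserves its value.\<close>

definition sphere_L3_const :: real where
  "sphere_L3_const = enn2real (\<integral>\<^sup>+\<xi>. (if 1 - (\<xi> $ 1)\<^sup>2 = 0 then \<infinity> else ennreal ((1 - (\<xi> $ 1)\<^sup>2) powr (-3/4))) \<partial>sphere_measure)"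

text \<open>Rotation reduces to x = e_1. At the two poles, which the pointwise bound leaves out, the
  weight is \<infinity>. The decay l^(-3/2) is what compensates the cube of the normalisation sqrt
  ((2l + 1) / 4 \<pi>).\<close>

lemma integral_legendre_cube_le:
  fixes x :: "real ^ 3"
  assumes x: "norm x = 1" and l: "l \<ge> 1"
  shows "(\<integral>\<xi>. \<bar>poly (legendre_poly l) (x \<bullet> \<xi>)\<bar> ^ 3 \<partial>sphere_measure) \<le> (10 / real l) powr (3/2) * sphere_L3_const"
proof -
  let ?P = "\<lambda>t. poly (legendre_poly l) t"
  let ?k = "\<lambda>\<xi> :: real ^ 3. (if 1 - (\<xi> $ 1)\<^sup>2 = 0 then \<infinity> else ennreal ((1 - (\<xi> $ 1)\<^sup>2) powr (-3/4)))"
  let ?c = "(10 / real l) powr (3/2)"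
  have cpos: "?c > 0" using l by simp
  obtain T where T: "orthogonal_transformation T" "T (axis 1 1 :: real ^ 3) = x"
    using orthogonal_transformation_exists[of "axis 1 1" x] x by auto
  have xT: "x \<bullet> T \<xi> = \<xi> $ 1" for \<xi>
  proof -
    have "x \<bullet> T \<xi> = T (axis 1 1) \<bullet> T \<xi>" by (simp only: T(2))
    also have "\<dots> = axis 1 1 \<bullet> \<xi>" using T(1) unfolding orthogonal_transformation_def by blast
    finally show ?thesis by (simp add: inner_axis')
  qed
  have cont: "continuous_on UNIV (\<lambda>\<xi> :: real ^ 3. \<bar>?P (f \<xi>)\<bar> ^ 3)" if "continuous_on UNIV f" for f
    by (intro continuous_intros continuous_on_poly that)
  have "(\<integral>\<xi>. \<bar>?P (x \<bullet> \<xi>)\<bar> ^ 3 \<partial>sphere_measure) = (\<integral>\<xi>. \<bar>?P (x \<bullet> T \<xi>)\<bar> ^ 3 \<partial>sphere_measure)"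
    by (intro integral_sphere_orthogonal[OF T(1), of "\<lambda>\<xi>. \<bar>?P (x \<bullet> \<xi>)\<bar> ^ 3", symmetric]
        borel_measurable_continuous_onI cont continuous_intros)
  then have 1: "(\<integral>\<xi>. \<bar>?P (x \<bullet> \<xi>)\<bar> ^ 3 \<partial>sphere_measure) = (\<integral>\<xi>. \<bar>?P (\<xi> $ 1)\<bar> ^ 3 \<partial>sphere_measure)"
    by (simp only: xT)
  have "ennreal (\<integral>\<xi>. \<bar>?P (\<xi> $ 1)\<bar> ^ 3 \<partial>sphere_measure) = (\<integral>\<^sup>+\<xi>. ennreal (\<bar>?P (\<xi> $ 1)\<bar> ^ 3) \<partial>sphere_measure)"
    by (intro nn_integral_eq_integral[symmetric] integrable_sphere_continuous cont continuous_intros) auto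
  also have "\<dots> \<le> (\<integral>\<^sup>+\<xi>. ennreal ?c * ?k \<xi> \<partial>sphere_measure)"
  proof (rule nn_integral_mono)
    fix \<xi> :: "real ^ 3" assume "\<xi> \<in> space sphere_measure"
    then have "norm \<xi> = 1" by (simp add: space_sphere_measure)
    then have a: "\<bar>\<xi> $ 1\<bar> \<le> 1" using component_le_norm_cart[of \<xi> 1] by simp
    show "ennreal (\<bar>?P (\<xi> $ 1)\<bar> ^ 3) \<le> ennreal ?c * ?k \<xi>"
    proof (cases "\<bar>\<xi> $ 1\<bar> = 1")
      case True
      then have "(\<xi> $ 1)\<^sup>2 = 1" by (metis one_power2 power2_abs)
      then show ?thesis using cpos by (simp add: ennreal_mult_top)
    next
      case False
      with a have b: "\<bar>\<xi> $ 1\<bar> < 1" by simp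
      then have "1 - (\<xi> $ 1)\<^sup>2 \<noteq> 0" by (simp add: abs_square_less_1 less_imp_neq)
      then show ?thesis
        using legendre_cube_le_weight[OF b l] cpos by (simp add: ennreal_mult[symmetric] ennreal_leI)
    qed
  qed
  also have "\<dots> = ennreal ?c * (\<integral>\<^sup>+\<xi>. ?k \<xi> \<partial>sphere_measure)"
    by (intro nn_integral_cmult borel_measurable_sphere_measure) measurable
  also have "(\<integral>\<^sup>+\<xi>. ?k \<xi> \<partial>sphere_measure) = ennreal sphere_L3_const"
    unfolding sphere_L3_const_def using nn_integral_sphere_weight by (intro ennreal_enn2real[symmetric]) simp
  also have "ennreal ?c * ennreal sphere_L3_const = ennreal (?c * sphere_L3_const)"
    by (simp add: ennreal_mult sphere_L3_const_def)
  finally show ?thesis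
    unfolding 1 by (subst (asm) ennreal_le_iff) (auto simp: sphere_L3_const_def)
qed

lemma sphere_L3_const_nonneg: "sphere_L3_const \<ge> 0"
  by (simp add: sphere_L3_const_def)

subsection \<open>Laws determined by linear functionals\<close>

text \<open>Taking s = 0 shows that both weights have the same total mass \<open>c\<close>. If c >
  0, dividing by it gives probability measures whose images on the line have equal characteristic
  functions, and Levy's uniqueness theorem applies; here the weights have to be nonnegative. If c =
  0, both weights vanish almost everywhere.\<close>

lemma weighted_law_eqI:
  fixes X :: "'a \<Rightarrow> real" and Y :: "'b \<Rightarrow> real"
  assumes M: "prob_space M" and N: "prob_space N"
    and X[measurable]: "X \<in> borel_measurable M" and Y[measurable]: "Y \<in> borel_measurable N"
    and w[measurable]: "w \<in> borel_measurable M" and v[measurable]: "v \<in> borel_measurable N"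
    and w0: "\<And>\<omega>. 0 \<le> w \<omega>" "\<And>\<omega>. w \<omega> \<le> (B :: real)" and v0: "\<And>\<omega>. 0 \<le> v \<omega>" "\<And>\<omega>. v \<omega> \<le> B"
    and eq: "\<And>s. (\<integral>\<omega>. complex_of_real (w \<omega>) * iexp (s * X \<omega>) \<partial>M) = (\<integral>\<omega>. complex_of_real (v \<omega>) * iexp (s * Y \<omega>) \<partial>N)"
    and A: "A \<in> sets borel"
  shows "(\<integral>\<omega>. w \<omega> * indicator A (X \<omega>) \<partial>M) = (\<integral>\<omega>. v \<omega> * indicator A (Y \<omega>) \<partial>N)"
proof -
  interpret M: prob_space M by fact
  interpret N: prob_space N by fact
  have iw: "integrable M w" by (rule M.integrable_const_bound[of _ B]) (use w0 in auto)
  have iv: "integrable N v" by (rule N.integrable_const_bound[of _ B]) (use v0 in auto)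
  define c where "c = (\<integral>\<omega>. w \<omega> \<partial>M)"
  have "complex_of_real (\<integral>\<omega>. w \<omega> \<partial>M) = of_real (\<integral>\<omega>. v \<omega> \<partial>N)"
    using eq[of 0] by (simp flip: integral_complex_of_real)
  then have c': "c = (\<integral>\<omega>. v \<omega> \<partial>N)" by (simp add: c_def)
  have c0: "c \<ge> 0" unfolding c_def using w0 by (intro Bochner_Integration.integral_nonneg) auto
  show ?thesis
  proof (cases "c = 0")
    case True
    have "AE \<omega> in M. w \<omega> = 0"
      using True w0 unfolding c_def by (subst (asm) integral_nonneg_eq_0_iff_AE[OF iw]) auto
    then have 1: "(\<integral>\<omega>. w \<omega> * indicator A (X \<omega>) \<partial>M) = (\<integral>\<omega>. 0 \<partial>M)"
      using A by (intro integral_cong_AE) auto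
    have "AE \<omega> in N. v \<omega> = 0"
      using True v0 unfolding c' by (subst (asm) integral_nonneg_eq_0_iff_AE[OF iv]) auto
    then have 2: "(\<integral>\<omega>. v \<omega> * indicator A (Y \<omega>) \<partial>N) = (\<integral>\<omega>. 0 \<partial>N)"
      using A by (intro integral_cong_AE) auto
    show ?thesis unfolding 1 2 by simp
  next
    case False
    with c0 have c: "c > 0" by simp
    have gen: "real_distribution (distr (density L (\<lambda>\<omega>. ennreal (u \<omega> / c))) borel U)
        \<and> (\<forall>t. char (distr (density L (\<lambda>\<omega>. ennreal (u \<omega> / c))) borel U) t
            = (1 / of_real c) * (\<integral>\<omega>. complex_of_real (u \<omega>) * iexp (t * U \<omega>) \<partial>L))
        \<and> measure (distr (density L (\<lambda>\<omega>. ennreal (u \<omega> / c))) borel U) A = (1 / c) * (\<integral>\<omega>. u \<omega> * indicator A (U \<omega>) \<partial>L)"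
      if L: "prob_space L" and um[measurable]: "u \<in> borel_measurable L" and U[measurable]: "U \<in> borel_measurable L"
        and u0: "\<And>\<omega>. 0 \<le> u \<omega>" and iu: "integrable L u" and uc: "(\<integral>\<omega>. u \<omega> \<partial>L) = c"
      for L :: "'c measure" and u U :: "'c \<Rightarrow> real"
    proof (intro conjI allI)
      interpret L: prob_space L by fact
      let ?D = "density L (\<lambda>\<omega>. ennreal (u \<omega> / c))"
      have "emeasure ?D (space ?D) = (\<integral>\<^sup>+\<omega>. ennreal (u \<omega> / c) \<partial>L)"
        by (simp add: emeasure_density cong: nn_integral_cong)
      also have "\<dots> = ennreal (\<integral>\<omega>. u \<omega> / c \<partial>L)"
        using u0 c iu by (intro nn_integral_eq_integral) auto
      also have "\<dots> = 1" using uc c by simp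
      finally interpret D: prob_space ?D by (rule prob_spaceI)
      have Um: "U \<in> borel_measurable ?D" by simp
      show "real_distribution (distr ?D borel U)" by (rule D.real_distribution_distr[OF Um])
      show "char (distr ?D borel U) t = (1 / of_real c) * (\<integral>\<omega>. complex_of_real (u \<omega>) * iexp (t * U \<omega>) \<partial>L)" for t
      proof -
        have "char (distr ?D borel U) t = (\<integral>\<omega>. iexp (t * U \<omega>) \<partial>?D)"
          unfolding char_def by (rule integral_distr[OF Um]) measurable
        also have "\<dots> = (\<integral>\<omega>. (u \<omega> / c) *\<^sub>R iexp (t * U \<omega>) \<partial>L)"
          using u0 c by (intro integral_density) auto
        also have "\<dots> = (\<integral>\<omega>. (1 / of_real c) * (complex_of_real (u \<omega>) * iexp (t * U \<omega>)) \<partial>L)"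
          by (simp add: scaleR_conv_of_real)
        finally show ?thesis by simp
      qed
      have "measure (distr ?D borel U) A = (\<integral>x. indicator A x \<partial>distr ?D borel U)"
        using A by simp
      also have "\<dots> = (\<integral>\<omega>. indicator A (U \<omega>) \<partial>?D)"
        by (rule integral_distr[OF Um]) (use A in simp)
      also have "\<dots> = (\<integral>\<omega>. (u \<omega> / c) *\<^sub>R indicator A (U \<omega>) \<partial>L)"
        using u0 c A by (intro integral_density) auto
      also have "\<dots> = (\<integral>\<omega>. (1 / c) * (u \<omega> * indicator A (U \<omega>)) \<partial>L)" by simp
      finally show "measure (distr ?D borel U) A = (1 / c) * (\<integral>\<omega>. u \<omega> * indicator A (U \<omega>) \<partial>L)" by (simp only: integral_mult_right_zero)
    qed
    note gM = gen[OF M w X w0(1) iw c_def[symmetric]]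
    note gN = gen[OF N v Y v0(1) iv c'[symmetric]]
    have "distr (density M (\<lambda>\<omega>. ennreal (w \<omega> / c))) borel X = distr (density N (\<lambda>\<omega>. ennreal (v \<omega> / c))) borel Y"
      using gM gN eq by (intro Levy_uniqueness) (auto simp: fun_eq_iff)
    then have "(1 / c) * (\<integral>\<omega>. w \<omega> * indicator A (X \<omega>) \<partial>M) = (1 / c) * (\<integral>\<omega>. v \<omega> * indicator A (Y \<omega>) \<partial>N)"
      using gM gN by metis
    then show ?thesis using c by simp
  qed
qed

text \<open>The coordinates are localised one at a time. Weighting with the nonnegative function
  \<open>1 + cos (b + \<theta> \<bullet> X)\<close> turns a mixed expectation into a one-dimensional characteristic function.\<close>

lemma cramer_wold:
  fixes X :: "'a \<Rightarrow> nat \<Rightarrow> real" and Y :: "'b \<Rightarrow> nat \<Rightarrow> real"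
  assumes M: "prob_space M" and N: "prob_space N"
    and X[measurable]: "X \<in> measurable M (\<Pi>\<^sub>M i\<in>{..<d}. borel)"
    and Y[measurable]: "Y \<in> measurable N (\<Pi>\<^sub>M i\<in>{..<d}. borel)"
    and eq: "\<And>a. (\<integral>\<omega>. iexp (\<Sum>i<d. a i * X \<omega> i) \<partial>M) = (\<integral>\<omega>. iexp (\<Sum>i<d. a i * Y \<omega> i) \<partial>N)"
  shows "distr M (\<Pi>\<^sub>M i\<in>{..<d}. borel) X = distr N (\<Pi>\<^sub>M i\<in>{..<d}. borel) Y"
proof -
  interpret M: prob_space M by fact
  interpret N: prob_space N by fact
  have Xi[measurable]: "(\<lambda>\<omega>. X \<omega> i) \<in> borel_measurable M" if "i < d" for i
    using measurable_compose[OF X measurable_component_singleton[of i]] that by simp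
  have Yi[measurable]: "(\<lambda>\<omega>. Y \<omega> i) \<in> borel_measurable N" if "i < d" for i
    using measurable_compose[OF Y measurable_component_singleton[of i]] that by simp
  define I :: "(nat \<Rightarrow> real set) \<Rightarrow> nat \<Rightarrow> (nat \<Rightarrow> real) \<Rightarrow> real" where "I A k x = (\<Prod>i<k. indicator (A i) (x i))" for A k x
  define S where "S \<theta> x = (\<Sum>i<d. \<theta> i * x i)" for \<theta> x :: "nat \<Rightarrow> real"
  have I01: "0 \<le> I A k x" "I A k x \<le> 1" for A k x
    unfolding I_def by (auto intro!: prod_nonneg prod_le_1 simp: indicator_def)
  have IX[measurable]: "(\<lambda>\<omega>. I A k (X \<omega>)) \<in> borel_measurable M" "(\<lambda>\<omega>. I A k (Y \<omega>)) \<in> borel_measurable N"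
    if "k \<le> d" "\<And>i. i < k \<Longrightarrow> A i \<in> sets borel" for A k
  proof -
    have "(\<lambda>\<omega>. indicator (A i) (X \<omega> i) :: real) \<in> borel_measurable M"
         "(\<lambda>\<omega>. indicator (A i) (Y \<omega> i) :: real) \<in> borel_measurable N" if "i < k" for i
      using that \<open>k \<le> d\<close> \<open>\<And>i. i < k \<Longrightarrow> A i \<in> sets borel\<close>
      by (auto intro!: measurable_compose[OF Xi borel_measurable_indicator] measurable_compose[OF Yi borel_measurable_indicator])
    then show "(\<lambda>\<omega>. I A k (X \<omega>)) \<in> borel_measurable M" "(\<lambda>\<omega>. I A k (Y \<omega>)) \<in> borel_measurable N"
      unfolding I_def by (auto intro!: borel_measurable_prod)
  qed
  have SX[measurable]: "(\<lambda>\<omega>. S \<theta> (X \<omega>)) \<in> borel_measurable M" "(\<lambda>\<omega>. S \<theta> (Y \<omega>)) \<in> borel_measurable N" for \<theta>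
    unfolding S_def by measurable
  \<comment> \<open>\<open>I\<close> localises the first k coordinates. For k = 0 the claim follows
    from the hypothesis on characteristic functions; for k = d with \<theta> = 0 and b = 0 it gives
    the probabilities of boxes. The phase b is kept free so that sines are covered as shifted
    cosines.\<close>
  have main: "(\<integral>\<omega>. I A k (X \<omega>) * cos (b + S \<theta> (X \<omega>)) \<partial>M) = (\<integral>\<omega>. I A k (Y \<omega>) * cos (b + S \<theta> (Y \<omega>)) \<partial>N)"
    if "k \<le> d" "\<And>i. i < k \<Longrightarrow> A i \<in> sets borel" for A k b \<theta>
    using that
  proof (induction k arbitrary: b \<theta>)
    case 0
    have cosE: "complex_of_real (cos (b + s)) = (cis b * iexp s + cis (- b) * iexp (- s)) / 2" for s
      unfolding cis_conv_exp[symmetric] by (simp add: complex_eq_iff cos_add sin_add)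
    have neg: "S (\<lambda>i. - \<theta> i) x = - S \<theta> x" for x by (simp add: S_def sum_negf)
    have g: "(\<integral>\<omega>. complex_of_real (cos (b + S \<theta> (U \<omega>))) \<partial>L)
       = (cis b * (\<integral>\<omega>. iexp (S \<theta> (U \<omega>)) \<partial>L) + cis (- b) * (\<integral>\<omega>. iexp (S (\<lambda>i. - \<theta> i) (U \<omega>)) \<partial>L)) / 2"
      if "prob_space L" "\<And>\<theta>. (\<lambda>\<omega>. S \<theta> (U \<omega>)) \<in> borel_measurable L" for L :: "'c measure" and U
    proof -
      interpret L: prob_space L by fact
      have "integrable L (\<lambda>\<omega>. iexp (S \<theta> (U \<omega>)))" for \<theta>
        by (rule L.integrable_const_bound[of _ 1]) (use that(2) in auto)
      from this[of \<theta>] this[of "\<lambda>i. - \<theta> i"] show ?thesis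
        unfolding cosE neg by simp
    qed
    have "complex_of_real (\<integral>\<omega>. cos (b + S \<theta> (X \<omega>)) \<partial>M) = of_real (\<integral>\<omega>. cos (b + S \<theta> (Y \<omega>)) \<partial>N)"
      unfolding integral_complex_of_real[symmetric] g[OF M SX(1)] g[OF N SX(2)]
      unfolding S_def by (simp only: eq)
    then show ?case by (simp add: I_def)
  next
    case (Suc k)
    then have kd: "k < d" "k \<le> d" and Am: "\<And>i. i < k \<Longrightarrow> A i \<in> sets borel" "A k \<in> sets borel" by auto
    note IXk = IX[OF kd(2) Am(1)]
    note IH = Suc.IH[OF kd(2) Am(1)]
    have int: "integrable M (\<lambda>\<omega>. I A k (X \<omega>) * f (X \<omega>))" if "(\<lambda>\<omega>. f (X \<omega>)) \<in> borel_measurable M" "\<And>x. \<bar>f x\<bar> \<le> 2" for f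
    proof (rule M.integrable_const_bound[of _ 2])
      have "\<bar>I A k x * f x\<bar> \<le> 1 * 2" for x
        unfolding abs_mult by (intro mult_mono) (use that(2) I01 in auto)
      then show "AE \<omega> in M. norm (I A k (X \<omega>) * f (X \<omega>)) \<le> 2" by auto
      show "(\<lambda>\<omega>. I A k (X \<omega>) * f (X \<omega>)) \<in> borel_measurable M"
        using that(1) IXk by (intro borel_measurable_times)
    qed
    have int': "integrable N (\<lambda>\<omega>. I A k (Y \<omega>) * f (Y \<omega>))" if "(\<lambda>\<omega>. f (Y \<omega>)) \<in> borel_measurable N" "\<And>x. \<bar>f x\<bar> \<le> 2" for f
    proof (rule N.integrable_const_bound[of _ 2])
      have "\<bar>I A k x * f x\<bar> \<le> 1 * 2" for x
        unfolding abs_mult by (intro mult_mono) (use that(2) I01 in auto)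
      then show "AE \<omega> in N. norm (I A k (Y \<omega>) * f (Y \<omega>)) \<le> 2" by auto
      show "(\<lambda>\<omega>. I A k (Y \<omega>) * f (Y \<omega>)) \<in> borel_measurable N"
        using that(1) IXk by (intro borel_measurable_times)
    qed
    have kcoord: "S (\<lambda>i. if i = k then s else 0) x = s * x k" for s x
      using kd(1) by (simp add: S_def if_distrib[of "\<lambda>z. z * _"] cong: if_cong)
    \<comment> \<open>Product to sum: the frequency s in coordinate k is merged into the linear
      form, as \<theta> changed by s or -s in that place, so the induction hypothesis
      applies.\<close>
    have cc: "(\<integral>\<omega>. I A k (X \<omega>) * (cos (b + S \<theta> (X \<omega>)) * cos (c + s * X \<omega> k)) \<partial>M)
            = (\<integral>\<omega>. I A k (Y \<omega>) * (cos (b + S \<theta> (Y \<omega>)) * cos (c + s * Y \<omega> k)) \<partial>N)" for b c s \<theta>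
    proof -
      let ?p = "\<lambda>i. \<theta> i + (if i = k then s else 0)" and ?m = "\<lambda>i. \<theta> i - (if i = k then s else 0)"
      have pm: "S ?p x = S \<theta> x + s * x k" "S ?m x = S \<theta> x - s * x k" for x
        using kcoord[of s x] unfolding S_def by (simp_all add: distrib_right left_diff_distrib sum.distrib sum_subtractf)
      have e: "I A k x * (cos (b + S \<theta> x) * cos (c + s * x k))
         = (I A k x * cos ((b - c) + S ?m x) + I A k x * cos ((b + c) + S ?p x)) / 2" for x
        unfolding pm cos_times_cos by (simp add: algebra_simps)
      have i1: "integrable M (\<lambda>\<omega>. I A k (X \<omega>) * cos (b + S \<theta> (X \<omega>)))" for b \<theta>
        by (rule int) (auto intro: order_trans[OF abs_cos_le_one])
      have i2: "integrable N (\<lambda>\<omega>. I A k (Y \<omega>) * cos (b + S \<theta> (Y \<omega>)))" for b \<theta>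
        by (rule int') (auto intro: order_trans[OF abs_cos_le_one])
      show ?thesis
        unfolding e by (simp add: i1 i2 IH)
    qed
    define u where "u b \<theta> x = I A k x * (1 + cos (b + S \<theta> x))" for b \<theta> x
    have uw: "(\<integral>\<omega>. u b \<theta> (X \<omega>) * indicator (A k) (X \<omega> k) \<partial>M) = (\<integral>\<omega>. u b \<theta> (Y \<omega>) * indicator (A k) (Y \<omega> k) \<partial>N)" for b \<theta>
    proof (rule weighted_law_eqI[OF M N, where B = 2])
      show "(\<lambda>\<omega>. X \<omega> k) \<in> borel_measurable M" "(\<lambda>\<omega>. Y \<omega> k) \<in> borel_measurable N" using kd by auto
      show "(\<lambda>\<omega>. u b \<theta> (X \<omega>)) \<in> borel_measurable M" "(\<lambda>\<omega>. u b \<theta> (Y \<omega>)) \<in> borel_measurable N"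
        unfolding u_def using IXk by auto
      have c: "0 \<le> 1 + cos z" "1 + cos z \<le> 2" for z :: real
        using cos_ge_minus_one[of z] cos_le_one[of z] by linarith+
      show "0 \<le> u b \<theta> (X \<omega>)" "0 \<le> u b \<theta> (Y \<omega>')" for \<omega> \<omega>'
        unfolding u_def using c I01 by auto
      have "u b \<theta> x \<le> 1 * 2" for x unfolding u_def using c I01 by (intro mult_mono) auto
      then show "u b \<theta> (X \<omega>) \<le> 2" "u b \<theta> (Y \<omega>') \<le> 2" for \<omega> \<omega>' by auto
      show "A k \<in> sets borel" by fact
      fix s
      have P: "(\<integral>\<omega>. u b \<theta> (X \<omega>) * cos (c + s * X \<omega> k) \<partial>M) = (\<integral>\<omega>. u b \<theta> (Y \<omega>) * cos (c + s * Y \<omega> k) \<partial>N)" for c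
      proof -
        have e: "u b \<theta> x * cos (c + s * x k) = I A k x * (cos (0 + S (\<lambda>_. 0) x) * cos (c + s * x k)) + I A k x * (cos (b + S \<theta> x) * cos (c + s * x k))" for x
          by (simp add: u_def S_def algebra_simps)
        have b2: "\<bar>cos y * cos z\<bar> \<le> 2" for y z :: real
          unfolding abs_mult using mult_mono[OF abs_cos_le_one[of y] abs_cos_le_one[of z]] by simp
        have i1: "integrable M (\<lambda>\<omega>. I A k (X \<omega>) * (cos (b + S \<theta> (X \<omega>)) * cos (c + s * X \<omega> k)))" for b \<theta>
          by (rule int) (use kd b2 in auto)
        have i2: "integrable N (\<lambda>\<omega>. I A k (Y \<omega>) * (cos (b + S \<theta> (Y \<omega>)) * cos (c + s * Y \<omega> k)))" for b \<theta>
          by (rule int') (use kd b2 in auto)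
        show ?thesis unfolding e Bochner_Integration.integral_add[OF i1 i1] Bochner_Integration.integral_add[OF i2 i2] cc ..
      qed
      \<comment> \<open>As sin y = cos (y - \<pi>/2), the complex expectation consists of two phases
        of the identity \<open>P\<close>.\<close>
      have split: "(\<integral>\<omega>. complex_of_real (g \<omega>) * iexp (s * h \<omega>) \<partial>L)
          = of_real (\<integral>\<omega>. g \<omega> * cos (0 + s * h \<omega>) \<partial>L) + \<i> * of_real (\<integral>\<omega>. g \<omega> * cos (- (pi/2) + s * h \<omega>) \<partial>L)"
        if "prob_space L" "g \<in> borel_measurable L" "h \<in> borel_measurable L" "\<And>\<omega>. \<bar>g \<omega>\<bar> \<le> 2" for L :: "'c measure" and g h
      proof -
        interpret L: prob_space L by fact
        have i: "integrable L (\<lambda>\<omega>. g \<omega> * cos (c + s * h \<omega>))" for c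
        proof (rule L.integrable_const_bound[of _ 2])
          have "\<bar>g \<omega> * cos (c + s * h \<omega>)\<bar> \<le> 2 * 1" for \<omega>
            unfolding abs_mult using that(4) by (intro mult_mono) auto
          then show "AE \<omega> in L. norm (g \<omega> * cos (c + s * h \<omega>)) \<le> 2" by auto
        qed (use that in auto)
        have "complex_of_real (g \<omega>) * iexp (s * h \<omega>) = of_real (g \<omega> * cos (0 + s * h \<omega>)) + \<i> * of_real (g \<omega> * cos (- (pi/2) + s * h \<omega>))" for \<omega>
        proof -
          have "cos (- (pi/2) + y) = sin y" for y :: real unfolding cos_add by simp
          then show ?thesis unfolding cis_conv_exp[symmetric] by (simp only: complex_eq_iff) simp
        qed
        then show ?thesis using i[of 0] i[of "- (pi/2)"]
          by (simp only: Bochner_Integration.integral_add integrable_mult_right integrable_of_real integral_mult_right_zero integral_complex_of_real)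
      qed
      have ub: "\<bar>u b \<theta> x\<bar> \<le> 2" for x
        using \<open>\<And>x. u b \<theta> x \<le> 1 * 2\<close> c I01 by (auto simp: u_def)
      show "(\<integral>\<omega>. complex_of_real (u b \<theta> (X \<omega>)) * iexp (s * X \<omega> k) \<partial>M) = (\<integral>\<omega>. complex_of_real (u b \<theta> (Y \<omega>)) * iexp (s * Y \<omega> k) \<partial>N)"
        using IXk kd ub by (subst (1 2) split) (auto simp only: P M N u_def[symmetric], auto simp: u_def)
    qed
    have SI: "I A (Suc k) x * z = I A k x * z * indicator (A k) (x k)" for x z
      by (simp add: I_def mult_ac)
    have indm: "(\<lambda>\<omega>. indicator (A k) (X \<omega> k) :: real) \<in> borel_measurable M" "(\<lambda>\<omega>. indicator (A k) (Y \<omega> k) :: real) \<in> borel_measurable N"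
      using Am(2) kd by (auto intro!: measurable_compose[OF Xi borel_measurable_indicator] measurable_compose[OF Yi borel_measurable_indicator])
    have j1: "integrable M (\<lambda>\<omega>. I A k (X \<omega>) * (cos (b + S \<theta> (X \<omega>)) * indicator (A k) (X \<omega> k)))" for b \<theta>
      using indm by (intro int) (auto simp: abs_mult indicator_def intro: order_trans[OF abs_cos_le_one])
    have j2: "integrable N (\<lambda>\<omega>. I A k (Y \<omega>) * (cos (b + S \<theta> (Y \<omega>)) * indicator (A k) (Y \<omega> k)))" for b \<theta>
      using indm by (intro int') (auto simp: abs_mult indicator_def intro: order_trans[OF abs_cos_le_one])
    have e: "I A (Suc k) x * cos (b + S \<theta> x) = u b \<theta> x * indicator (A k) (x k) - I A k x * (cos (0 + S (\<lambda>_. 0) x) * indicator (A k) (x k))" for x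
      by (simp add: SI u_def S_def algebra_simps)
    \<comment> \<open>At phase \<pi>/2 with the zero linear form the cosine vanishes and the weight
      is the bare product of indicators. This is the term to subtract from \<open>u\<close> in order
      to recover the cosine.\<close>
    have "(\<integral>\<omega>. I A k (X \<omega>) * (cos (0 + S (\<lambda>_. 0) (X \<omega>)) * indicator (A k) (X \<omega> k)) \<partial>M)
        = (\<integral>\<omega>. I A k (Y \<omega>) * (cos (0 + S (\<lambda>_. 0) (Y \<omega>)) * indicator (A k) (Y \<omega> k)) \<partial>N)"
      using uw[of "pi / 2" "\<lambda>_. 0"] by (simp add: u_def S_def mult_ac)
    moreover have "u b \<theta> x * indicator (A k) (x k) = I A k x * (cos (0 + S (\<lambda>_. 0) x) * indicator (A k) (x k))
        + I A k x * (cos (b + S \<theta> x) * indicator (A k) (x k))" for x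
      by (simp add: u_def S_def algebra_simps)
    then have "integrable M (\<lambda>\<omega>. u b \<theta> (X \<omega>) * indicator (A k) (X \<omega> k))" "integrable N (\<lambda>\<omega>. u b \<theta> (Y \<omega>) * indicator (A k) (Y \<omega> k))"
      using j1[of 0 "\<lambda>_. 0"] j1[of b \<theta>] j2[of 0 "\<lambda>_. 0"] j2[of b \<theta>] by (simp_all only: Bochner_Integration.integrable_add)
    ultimately show ?case unfolding e
      using uw[of b \<theta>] j1[of 0 "\<lambda>_. 0"] j2[of 0 "\<lambda>_. 0"] by (simp only: Bochner_Integration.integral_diff)
  qed
  show ?thesis
  proof (rule measure_eqI_PiM_finite[where I = "{..<d}" and M = "\<lambda>_. borel"])
    fix A assume A: "\<And>i. i \<in> {..<d} \<Longrightarrow> A i \<in> sets (borel :: real measure)"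
    have box: "Pi\<^sub>E {..<d} A \<in> sets (\<Pi>\<^sub>M i\<in>{..<d}. borel)" using A by (intro sets_PiM_I_finite) auto
    have ind: "indicator (Pi\<^sub>E {..<d} A) x = I A d x" if "x \<in> extensional {..<d}" for x
      using that by (auto simp: I_def indicator_def PiE_def Pi_def)
    have g: "emeasure (distr L (\<Pi>\<^sub>M i\<in>{..<d}. borel) U) (Pi\<^sub>E {..<d} A) = ennreal (\<integral>\<omega>. I A d (U \<omega>) * cos (0 + S (\<lambda>_. 0) (U \<omega>)) \<partial>L)"
      if "prob_space L" "U \<in> measurable L (\<Pi>\<^sub>M i\<in>{..<d}. borel)" for L :: "'c measure" and U
    proof -
      interpret L: prob_space L by fact
      interpret D: prob_space "distr L (\<Pi>\<^sub>M i\<in>{..<d}. borel) U" using that(2) by (rule L.prob_space_distr)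
      have "emeasure (distr L (\<Pi>\<^sub>M i\<in>{..<d}. borel) U) (Pi\<^sub>E {..<d} A) = ennreal (\<integral>x. indicator (Pi\<^sub>E {..<d} A) x \<partial>distr L (\<Pi>\<^sub>M i\<in>{..<d}. borel) U)"
        using box by (simp add: D.emeasure_eq_measure)
      also have "(\<integral>x. (indicator (Pi\<^sub>E {..<d} A) x :: real) \<partial>distr L (\<Pi>\<^sub>M i\<in>{..<d}. borel) U) = (\<integral>\<omega>. (indicator (Pi\<^sub>E {..<d} A) (U \<omega>) :: real) \<partial>L)"
        using that(2) box by (intro integral_distr) auto
      also have "\<dots> = (\<integral>\<omega>. I A d (U \<omega>) * cos (0 + S (\<lambda>_. 0) (U \<omega>)) \<partial>L)"
      proof (rule Bochner_Integration.integral_cong[OF refl])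
        fix \<omega> assume "\<omega> \<in> space L"
        then have "U \<omega> \<in> extensional {..<d}" using measurable_space[OF that(2)] by (auto simp: space_PiM PiE_def)
        then show "indicator (Pi\<^sub>E {..<d} A) (U \<omega>) = I A d (U \<omega>) * cos (0 + S (\<lambda>_. 0) (U \<omega>))" by (simp add: ind S_def)
      qed
      finally show ?thesis .
    qed
    show "emeasure (distr M (\<Pi>\<^sub>M i\<in>{..<d}. borel) X) (Pi\<^sub>E {..<d} A) = emeasure (distr N (\<Pi>\<^sub>M i\<in>{..<d}. borel) Y) (Pi\<^sub>E {..<d} A)"
      unfolding g[OF M X] g[OF N Y] using main[of d A 0 "\<lambda>_. 0"] A by simp
  next
    show "range (\<lambda>n :: nat. space (\<Pi>\<^sub>M i\<in>{..<d}. borel :: real measure)) \<subseteq> prod_algebra {..<d} (\<lambda>_. borel)"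
      by (auto simp: space_PiM intro!: prod_algebraI_finite[of _ "\<lambda>_. UNIV", simplified])
    show "emeasure (distr M (\<Pi>\<^sub>M i\<in>{..<d}. borel) X) (space (\<Pi>\<^sub>M i\<in>{..<d}. borel)) \<noteq> \<infinity>" for n :: nat
      using M.prob_space_distr[OF X] prob_space.emeasure_space_1 by force
  qed (auto simp: space_PiM)
qed

subsection \<open>Taylor expansion of test functions\<close>

lemma tendsto_coordinatewise:
  fixes f :: "'a \<Rightarrow> 'b \<Rightarrow> 'c::topological_space"
  assumes "\<And>i. ((\<lambda>t. f t i) \<longlongrightarrow> l i) F"
  shows "(f \<longlongrightarrow> l) F"
proof -
  have "limitin (product_topology (\<lambda>i. euclidean) UNIV) f l F"
    using assms by (simp add: limitin_componentwise)
  then show ?thesis by (simp add: euclidean_product_topology)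
qed

lemma real_mvt_between:
  fixes g g' :: "real \<Rightarrow> real"
  assumes "\<And>s. (g has_real_derivative g' s) (at s)"
  shows "\<exists>z. \<bar>z - a\<bar> \<le> \<bar>b - a\<bar> \<and> g b - g a = (b - a) * g' z"
proof -
  consider "a = b" | "a < b" | "b < a" by linarith
  then show ?thesis
  proof cases
    case 2
    then obtain z where "a < z" "z < b" "g b - g a = (b - a) * g' z"
      using MVT2[of a b g g'] assms by blast
    then show ?thesis by (intro exI[of _ z]) auto
  next
    case 3
    then obtain z where "b < z" "z < a" "g a - g b = (a - b) * g' z"
      using MVT2[of b a g g'] assms by blast
    then show ?thesis by (intro exI[of _ z]) (auto simp: algebra_simps)
  qed auto
qed

definition line_point :: "nat \<Rightarrow> (nat \<Rightarrow> real) \<Rightarrow> (nat \<Rightarrow> real) \<Rightarrow> real \<Rightarrow> nat \<Rightarrow> real" where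
  "line_point d y c s = (\<lambda>i\<in>{..<d}. y i + s * c i)"

lemma line_point_Rd: "line_point d y c s \<in> Rd d"
  by (simp add: line_point_def Rd_def)

text \<open>The chain rule from continuous partial derivatives. The increment from p to p + t c is
  split into d steps \<open>q\<close>, each moving one coordinate. The mean value theorem expresses
  every step by a partial derivative at an intermediate point, and these points tend to p as t tends
  to 0.\<close>

lemma has_real_derivative_along_line:
  assumes diff: "\<And>i x. i < d \<Longrightarrow> x \<in> Rd d \<Longrightarrow> (\<lambda>s. f (x(i := s))) field_differentiable at (x i)"
    and cont: "\<And>i. i < d \<Longrightarrow> continuous_on (Rd d) (partial_deriv i f)"
  shows "((\<lambda>s. f (line_point d y c s)) has_real_derivative
    (\<Sum>i<d. c i * partial_deriv i f (line_point d y c s))) (at s)"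
proof -
  define p where "p = line_point d y c s"
  have pR: "p \<in> Rd d" by (simp add: p_def line_point_Rd)
  have part: "((\<lambda>u. f (z(k := u))) has_real_derivative partial_deriv k f (z(k := u))) (at u)"
    if "k < d" "z \<in> Rd d" for k z u
  proof -
    have "z(k := u) \<in> Rd d" using that by (auto simp: Rd_def PiE_def extensional_def)
    from diff[OF that(1) this] have "(\<lambda>u. f (z(k := u))) field_differentiable at u" by simp
    then have "((\<lambda>u. f (z(k := u))) has_real_derivative deriv (\<lambda>u. f (z(k := u))) u) (at u)"
      by (rule field_differentiable_derivI)
    then show ?thesis by (simp add: partial_deriv_def)
  qed
  define q where "q k t = (\<lambda>i\<in>{..<d}. if i < k then p i + t * c i else p i)" for k and t :: real
  have qR: "q k t \<in> Rd d" for k t by (simp add: q_def Rd_def)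
  have qS: "q (Suc k) t = (q k t)(k := p k + t * c k)" if "k < d" for k t
    using that by (auto simp: q_def fun_eq_iff)
  have qk: "q k t k = p k" if "k < d" for k t using that by (simp add: q_def)
  have q0: "q 0 t = p" for t using pR by (auto simp: q_def fun_eq_iff Rd_def PiE_def extensional_def)
  have qd: "q d t = line_point d y c (s + t)" for t
    by (auto simp: q_def line_point_def p_def fun_eq_iff algebra_simps)
  have "\<exists>z. \<bar>z - p k\<bar> \<le> \<bar>t * c k\<bar> \<and> f (q (Suc k) t) - f (q k t) = t * c k * partial_deriv k f ((q k t)(k := z))"
    if "k < d" for k t
  proof -
    from real_mvt_between[OF part[OF that qR[of k t]], of "p k" "p k + t * c k"]
    obtain z where "\<bar>z - p k\<bar> \<le> \<bar>t * c k\<bar>"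
      "f ((q k t)(k := p k + t * c k)) - f ((q k t)(k := p k)) = t * c k * partial_deriv k f ((q k t)(k := z))"
      by auto
    moreover have "(q k t)(k := p k) = q k t" using qk[OF that, of t] by (metis fun_upd_triv)
    ultimately show ?thesis using qS[OF that] by metis
  qed
  then obtain z where z: "\<And>k t. k < d \<Longrightarrow> \<bar>z k t - p k\<bar> \<le> \<bar>t * c k\<bar>"
    "\<And>k t. k < d \<Longrightarrow> f (q (Suc k) t) - f (q k t) = t * c k * partial_deriv k f ((q k t)(k := z k t))"
    by metis
  have lim: "((\<lambda>t. partial_deriv k f ((q k t)(k := z k t))) \<longlongrightarrow> partial_deriv k f p) (at 0)" if k: "k < d" for k
  proof (rule continuous_on_tendsto_compose[OF cont[OF k] _ pR])
    show "\<forall>\<^sub>F t in at 0. (q k t)(k := z k t) \<in> Rd d"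
      using qR[of k] k by (auto simp: Rd_def PiE_def extensional_def)
    show "((\<lambda>t. (q k t)(k := z k t)) \<longlongrightarrow> p) (at 0)"
    proof (rule tendsto_coordinatewise)
      fix i
      have zero: "((\<lambda>t. \<bar>t * c i\<bar>) \<longlongrightarrow> 0) (at 0)" by (auto intro!: tendsto_eq_intros)
      have "\<bar>((q k t)(k := z k t)) i - p i\<bar> \<le> \<bar>t * c i\<bar>" for t
        using z(1)[OF k, of t] pR by (auto simp: q_def Rd_def PiE_def extensional_def)
      then have "((\<lambda>t. ((q k t)(k := z k t)) i - p i) \<longlongrightarrow> 0) (at 0)"
        by (intro Lim_null_comparison[OF _ zero]) auto
      then show "((\<lambda>t. ((q k t)(k := z k t)) i) \<longlongrightarrow> p i) (at 0)" by (rule LIM_zero_cancel)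
    qed
  qed
  have quot: "(f (line_point d y c (s + t)) - f (line_point d y c s)) / t
      = (\<Sum>k<d. c k * partial_deriv k f ((q k t)(k := z k t)))" if "t \<noteq> 0" for t
  proof -
    have "f (line_point d y c (s + t)) - f p = (\<Sum>k<d. f (q (Suc k) t) - f (q k t))"
      using sum_lessThan_telescope[of "\<lambda>k. f (q k t)" d] by (simp only: q0 qd)
    also have "\<dots> = t * (\<Sum>k<d. c k * partial_deriv k f ((q k t)(k := z k t)))"
      unfolding sum_distrib_left by (intro sum.cong refl) (simp add: z(2) mult.assoc)
    finally show ?thesis using that by (simp add: p_def)
  qed
  have "((\<lambda>t. \<Sum>k<d. c k * partial_deriv k f ((q k t)(k := z k t))) \<longlongrightarrow> (\<Sum>k<d. c k * partial_deriv k f p)) (at 0)"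
    by (intro tendsto_sum tendsto_mult tendsto_const) (use lim in auto)
  then have "((\<lambda>t. (f (line_point d y c (s + t)) - f (line_point d y c s)) / t) \<longlongrightarrow> (\<Sum>k<d. c k * partial_deriv k f p)) (at 0)"
    by (rule Lim_transform_eventually) (auto simp: eventually_at_filter quot)
  then show ?thesis by (simp add: DERIV_def p_def)
qed

lemma C_k_has_derivative:
  assumes h: "h \<in> C_k d k" and "set is \<subseteq> {..<d}" "length is < k"
  shows "((\<lambda>s. iter_partial_deriv is h (line_point d y c s)) has_real_derivative
    (\<Sum>i<d. c i * iter_partial_deriv (i # is) h (line_point d y c s))) (at s)"
proof -
  have "iter_partial_deriv (i # is) h = partial_deriv i (iter_partial_deriv is h)" for i
    by (simp add: iter_partial_deriv_def)
  moreover have "(\<lambda>s. iter_partial_deriv is h (x(i := s))) field_differentiable at (x i)"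
    if "i < d" "x \<in> Rd d" for i x using assms that by (auto simp: C_k_def)
  moreover have "continuous_on (Rd d) (iter_partial_deriv (i # is) h)" if "i < d" for i
  proof -
    have "set (i # is) \<subseteq> {..<d}" "length (i # is) \<le> k" using assms that by auto
    then show ?thesis using h unfolding C_k_def by blast
  qed
  ultimately show ?thesis
    using has_real_derivative_along_line[of d "iter_partial_deriv is h" y c s] by simp
qed

lemma lists_Suc_eq: "{is. set is \<subseteq> A \<and> length is = Suc j} = (\<lambda>(i, is). i # is) ` (A \<times> {is. set is \<subseteq> A \<and> length is = j})"
  by (auto simp: length_Suc_conv image_iff)

text \<open>The head of the index list is the outermost derivative. Splitting it off on the diagonal
  shows the form of order j + 1 as the directional derivative of the one of order j, which is what
  differentiation along a line produces.\<close>

lemma deriv_form_Suc: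
  "deriv_form d (Suc j) h x (\<lambda>_. c) =
     (\<Sum>is | set is \<subseteq> {..<d} \<and> length is = j. (\<Sum>i<d. c i * iter_partial_deriv (i # is) h x) * (\<Prod>m<j. c (is ! m)))"
proof -
  have inj: "inj_on (\<lambda>(i, is). i # is) ({..<d} \<times> {is. set is \<subseteq> {..<d} \<and> length is = j})"
    by (auto simp: inj_on_def)
  have "deriv_form d (Suc j) h x (\<lambda>_. c)
      = (\<Sum>(i, is)\<in>{..<d} \<times> {is. set is \<subseteq> {..<d} \<and> length is = j}. iter_partial_deriv (i # is) h x * (\<Prod>m<Suc j. c ((i # is) ! m)))"
    unfolding deriv_form_def lists_Suc_eq by (subst sum.reindex[OF inj]) (simp add: case_prod_beta o_def)
  also have "\<dots> = (\<Sum>i<d. \<Sum>is | set is \<subseteq> {..<d} \<and> length is = j. iter_partial_deriv (i # is) h x * (\<Prod>m<Suc j. c ((i # is) ! m)))"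
    by (rule sum.cartesian_product[symmetric])
  also have "\<dots> = (\<Sum>is | set is \<subseteq> {..<d} \<and> length is = j. \<Sum>i<d. iter_partial_deriv (i # is) h x * (\<Prod>m<Suc j. c ((i # is) ! m)))"
    by (rule sum.swap)
  also have "\<dots> = (\<Sum>is | set is \<subseteq> {..<d} \<and> length is = j. (\<Sum>i<d. c i * iter_partial_deriv (i # is) h x) * (\<Prod>m<j. c (is ! m)))"
    unfolding sum_distrib_right by (intro sum.cong refl) (simp add: prod.lessThan_Suc_shift mult_ac del: prod.lessThan_Suc)
  finally show ?thesis .
qed

lemma deriv_form_has_derivative:
  assumes "h \<in> C_k d k" "j < k"
  shows "((\<lambda>s. deriv_form d j h (line_point d y c s) (\<lambda>_. c)) has_real_derivative
     deriv_form d (Suc j) h (line_point d y c s) (\<lambda>_. c)) (at s)"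
  unfolding deriv_form_Suc unfolding deriv_form_def
  by (intro DERIV_sum DERIV_cmult_right C_k_has_derivative[OF assms(1)]) (use assms(2) in auto)

lemma deriv_form_scale: "deriv_form d j h x (\<lambda>_ i. a * u i) = a ^ j * deriv_form d j h x (\<lambda>_. u)"
  unfolding deriv_form_def sum_distrib_left by (intro sum.cong refl) (simp add: prod.distrib mult_ac)

lemma deriv_form_cong:
  assumes "\<And>i. i < d \<Longrightarrow> u i = v i"
  shows "deriv_form d j h x (\<lambda>_. u) = deriv_form d j h x (\<lambda>_. v)"
  unfolding deriv_form_def
proof (intro sum.cong refl arg_cong2[of _ _ _ _ "(*)"] prod.cong)
  fix "is" m assume "is \<in> {is. set is \<subseteq> {..<d} \<and> length is = j}" "m \<in> {..<j}"
  then have "is ! m \<in> {..<d}" using nth_mem by blast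
  then show "u (is ! m) = v (is ! m)" using assms by simp
qed

text \<open>Homogeneity reduces c to a unit vector, restricted so as to lie in \<open>Rd d\<close>.
  The zero vector cannot be normalised, but there the form vanishes because j \<ge> 1.\<close>

lemma abs_deriv_form_le:
  assumes h: "deriv_sup_norm d j h \<le> 1" and x: "x \<in> Rd d" and j: "j \<ge> 1"
  shows "\<bar>deriv_form d j h x (\<lambda>_. c)\<bar> \<le> L2_set c {..<d} ^ j"
proof (cases "L2_set c {..<d} = 0")
  case True
  then have "c i = 0" if "i < d" for i using that by (simp add: L2_set_eq_0_iff)
  then have "deriv_form d j h x (\<lambda>_. c) = deriv_form d j h x (\<lambda>_ i. 0 * c i)" by (intro deriv_form_cong) auto
  also have "\<dots> = 0" using j unfolding deriv_form_scale by simp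
  finally show ?thesis using True j by simp
next
  case False
  define r where "r = L2_set c {..<d}"
  have r: "r > 0" using False L2_set_nonneg[of c "{..<d}"] unfolding r_def by linarith
  define u where "u = (\<lambda>i\<in>{..<d}. c i / r)"
  have uR: "u \<in> Rd d" by (simp add: u_def Rd_def)
  have "L2_set u {..<d} = L2_set (\<lambda>i. (1 / r) * c i) {..<d}"
    by (rule L2_set_cong) (auto simp: u_def)
  also have "\<dots> = (1 / r) * r" unfolding r_def[symmetric] using r
    by (subst L2_set_right_distrib[symmetric]) (auto simp: r_def)
  finally have u1: "L2_set u {..<d} = 1" using r by simp
  have "ereal \<bar>deriv_form d j h x (\<lambda>_. u)\<bar> \<le> op_norm d j (deriv_form d j h x)"
    unfolding op_norm_def by (rule SUP_upper) (use uR u1 in auto)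
  also have "\<dots> \<le> deriv_sup_norm d j h" unfolding deriv_sup_norm_def using x by (rule SUP_upper)
  also have "\<dots> \<le> 1" by (rule h)
  finally have "\<bar>deriv_form d j h x (\<lambda>_. u)\<bar> \<le> 1" by simp
  moreover have "deriv_form d j h x (\<lambda>_. c) = r ^ j * deriv_form d j h x (\<lambda>_. u)"
    unfolding deriv_form_scale[symmetric] using r by (intro deriv_form_cong) (simp add: u_def)
  ultimately show ?thesis using r by (simp add: abs_mult r_def[symmetric] mult_left_le)
qed

section \<open>Taylor's formula and measurability of test functions\<close>

text \<open>Maclaurin's formula for s \<mapsto> h (x + s v), with the operator norms bounding the
  Lagrange remainder. The coefficients are chosen before v, so that the polynomial can be integrated
  over v. The cubic remainder drives the exchange; the quadratic one gives the growth bound behind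
  integrability.\<close>

lemma test_function_taylor:
  assumes h: "h \<in> test_functions d"
  obtains A B where
    "\<And>v. \<bar>h (\<lambda>i\<in>{..<d}. x i + v i) - h (\<lambda>i\<in>{..<d}. x i) - (\<Sum>i<d. A i * v i) - (\<Sum>i<d. \<Sum>j<d. B i j * (v i * v j)) / 2\<bar>
        \<le> L2_set v {..<d} ^ 3 / 6"
    "\<And>v. \<bar>h (\<lambda>i\<in>{..<d}. x i + v i) - h (\<lambda>i\<in>{..<d}. x i) - (\<Sum>i<d. A i * v i)\<bar> \<le> L2_set v {..<d} ^ 2 / 2"
proof
  let ?x = "\<lambda>i\<in>{..<d}. x i"
  let ?A = "\<lambda>i. iter_partial_deriv [i] h ?x" and ?B = "\<lambda>i j. iter_partial_deriv [j, i] h ?x"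
  have hC: "h \<in> C_k d 3" and h2: "deriv_sup_norm d 2 h \<le> 1" and h3: "deriv_sup_norm d 3 h \<le> 1"
    using h by (auto simp: test_functions_def)
  have l0: "{is. set is \<subseteq> {..<d} \<and> length is = 0} = {[]}" by auto
  fix v
  define \<psi> where "\<psi> m s = deriv_form d m h (line_point d x v s) (\<lambda>_. v)" for m s
  have lp0: "line_point d x v 0 = ?x" by (simp add: line_point_def)
  have lp1: "line_point d x v 1 = (\<lambda>i\<in>{..<d}. x i + v i)" by (simp add: line_point_def)
  have f0: "deriv_form d 0 h z (\<lambda>_. v) = h z" for z unfolding deriv_form_def l0 by (simp add: iter_partial_deriv_def)
  have f1: "deriv_form d (Suc 0) h z (\<lambda>_. v) = (\<Sum>i<d. iter_partial_deriv [i] h z * v i)" for z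
    unfolding deriv_form_Suc l0 by (simp add: mult.commute)
  have l1: "{is. set is \<subseteq> {..<d} \<and> length is = Suc 0} = (\<lambda>i. [i]) ` {..<d}"
    unfolding lists_Suc_eq l0 by auto
  have f2: "deriv_form d 2 h z (\<lambda>_. v) = (\<Sum>i<d. \<Sum>j<d. iter_partial_deriv [j, i] h z * (v i * v j))" for z
    unfolding numeral_2_eq_2 deriv_form_Suc l1
    by (subst sum.reindex) (auto simp: inj_on_def sum_distrib_right sum_distrib_left mult_ac intro!: sum.cong)
  have D: "((\<psi> m) has_real_derivative \<psi> (Suc m) s) (at s)" if "m < 3" for m s
    unfolding \<psi>_def by (rule deriv_form_has_derivative[OF hC that])
  have "\<exists>t. 0 < t \<and> t < 1 \<and> \<psi> 0 1 = (\<Sum>m<3. \<psi> m 0 / fact m * 1 ^ m) + \<psi> 3 t / fact 3 * 1 ^ 3"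
    by (rule Maclaurin) (use D in auto)
  then obtain t where t: "\<psi> 0 1 = (\<Sum>m<3. \<psi> m 0 / fact m) + \<psi> 3 t / 6" by (auto simp: fact_numeral)
  have "\<bar>\<psi> 3 t\<bar> \<le> L2_set v {..<d} ^ 3" unfolding \<psi>_def by (rule abs_deriv_form_le[OF h3 line_point_Rd]) simp
  moreover have "\<psi> 3 t / 6 = \<psi> 0 1 - \<psi> 0 0 - \<psi> (Suc 0) 0 - \<psi> 2 0 / 2"
    using t by (simp add: numeral_3_eq_3 numeral_2_eq_2)
  ultimately show "\<bar>h (\<lambda>i\<in>{..<d}. x i + v i) - h ?x - (\<Sum>i<d. ?A i * v i) - (\<Sum>i<d. \<Sum>j<d. ?B i j * (v i * v j)) / 2\<bar>
        \<le> L2_set v {..<d} ^ 3 / 6"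
    unfolding \<psi>_def f0 f1 f2 lp0 lp1 by linarith
  have "\<exists>t. 0 < t \<and> t < 1 \<and> \<psi> 0 1 = (\<Sum>m<2. \<psi> m 0 / fact m * 1 ^ m) + \<psi> 2 t / fact 2 * 1 ^ 2"
    by (rule Maclaurin) (use D in auto)
  then obtain t where t: "\<psi> 0 1 = (\<Sum>m<2. \<psi> m 0 / fact m) + \<psi> 2 t / 2" by auto
  have "\<bar>\<psi> 2 t\<bar> \<le> L2_set v {..<d} ^ 2" unfolding \<psi>_def by (rule abs_deriv_form_le[OF h2 line_point_Rd]) simp
  moreover have "\<psi> 2 t / 2 = \<psi> 0 1 - \<psi> 0 0 - \<psi> (Suc 0) 0"
    using t by (simp add: numeral_2_eq_2)
  ultimately show "\<bar>h (\<lambda>i\<in>{..<d}. x i + v i) - h ?x - (\<Sum>i<d. ?A i * v i)\<bar> \<le> L2_set v {..<d} ^ 2 / 2"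
    unfolding \<psi>_def f0 f1 lp0 lp1 by linarith
qed

text \<open>Continuity is known on \<open>Rd d\<close> only. Composed with the restriction map, h is
  continuous on all functions from nat to the reals, where the Borel sets are those of the full
  product; padding by 0 pulls this back to the finite product.\<close>

lemma test_function_measurable:
  assumes h: "h \<in> test_functions d"
  shows "h \<in> borel_measurable (\<Pi>\<^sub>M i\<in>{..<d}. borel)"
proof -
  have "h \<in> C_k d 3" using h by (simp add: test_functions_def)
  then have "continuous_on (Rd d) (iter_partial_deriv [] h)" unfolding C_k_def by force
  then have hc: "continuous_on (Rd d) h" by (simp add: iter_partial_deriv_def)
  have rc: "continuous_on UNIV (\<lambda>x :: nat \<Rightarrow> real. \<lambda>i\<in>{..<d}. x i)"
    unfolding restrict_def
  proof (rule continuous_on_coordinatewise_then_product)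
    fix i
    have "continuous_on UNIV (\<lambda>x :: nat \<Rightarrow> real. x i)"
      by (rule continuous_on_product_then_coordinatewise[OF continuous_on_id])
    then show "continuous_on UNIV (\<lambda>x :: nat \<Rightarrow> real. if i \<in> {..<d} then x i else undefined)"
      by (cases "i \<in> {..<d}") auto
  qed
  have "continuous_on UNIV (\<lambda>x. h (\<lambda>i\<in>{..<d}. x i))"
    by (rule continuous_on_compose2[OF hc rc]) (auto simp: Rd_def split: if_splits)
  then have m1: "(\<lambda>x. h (\<lambda>i\<in>{..<d}. x i)) \<in> borel_measurable (\<Pi>\<^sub>M i\<in>UNIV. borel)"
    by (simp add: borel_measurable_continuous_onI measurable_cong_sets[OF sets_PiM_equal_borel refl])
  have m2: "(\<lambda>x i. if i < d then x i else 0) \<in> measurable (\<Pi>\<^sub>M i\<in>{..<d}. borel :: real measure) (\<Pi>\<^sub>M i\<in>(UNIV :: nat set). borel)"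
  proof (rule measurable_PiM_single')
    fix i :: nat
    show "(\<lambda>x. if i < d then x i else 0) \<in> borel_measurable (\<Pi>\<^sub>M i\<in>{..<d}. borel :: real measure)"
      by (cases "i < d") auto
  qed (auto simp: space_PiM)
  have "(\<lambda>x. h (\<lambda>i\<in>{..<d}. if i < d then x i else 0)) \<in> borel_measurable (\<Pi>\<^sub>M i\<in>{..<d}. borel)"
    using measurable_compose[OF m2 m1] .
  moreover have "(\<lambda>i\<in>{..<d}. if i < d then x i else 0) = x" if "x \<in> space (\<Pi>\<^sub>M i\<in>{..<d}. borel :: real measure)" for x
    using that by (auto simp: space_PiM PiE_def extensional_def fun_eq_iff)
  ultimately show ?thesis by (subst measurable_cong[where g = "\<lambda>x. h (\<lambda>i\<in>{..<d}. if i < d then x i else 0)"]) auto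
qed

subsection \<open>Lindeberg exchange for convolution powers\<close>

abbreviation vecs :: "nat \<Rightarrow> (nat \<Rightarrow> real) measure" where
  "vecs d \<equiv> \<Pi>\<^sub>M i\<in>{..<d}. borel"

definition vadd :: "nat \<Rightarrow> (nat \<Rightarrow> real) \<Rightarrow> (nat \<Rightarrow> real) \<Rightarrow> nat \<Rightarrow> real" where
  "vadd d x y = (\<lambda>i\<in>{..<d}. x i + y i)"

abbreviation vnorm :: "nat \<Rightarrow> (nat \<Rightarrow> real) \<Rightarrow> real" where
  "vnorm d x \<equiv> L2_set x {..<d}"

definition law :: "nat \<Rightarrow> (nat \<Rightarrow> real) measure \<Rightarrow> bool" where
  "law d P \<longleftrightarrow> prob_space P \<and> sets P = sets (vecs d)"

definition cube_law :: "nat \<Rightarrow> (nat \<Rightarrow> real) measure \<Rightarrow> bool" where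
  "cube_law d P \<longleftrightarrow> law d P \<and> integrable P (\<lambda>x. vnorm d x ^ 3)"

definition abs_cube :: "nat \<Rightarrow> (nat \<Rightarrow> real) measure \<Rightarrow> real" where
  "abs_cube d P = (\<integral>x. vnorm d x ^ 3 \<partial>P)"

definition conv :: "nat \<Rightarrow> (nat \<Rightarrow> real) measure \<Rightarrow> (nat \<Rightarrow> real) measure \<Rightarrow> (nat \<Rightarrow> real) measure" where
  "conv d P Q = distr (P \<Otimes>\<^sub>M Q) (vecs d) (\<lambda>(x, y). vadd d x y)"

text \<open>The law of a sum of n independent copies; the point mass at 0 is the unit of
  convolution.\<close>

primrec conv_pow :: "nat \<Rightarrow> (nat \<Rightarrow> real) measure \<Rightarrow> nat \<Rightarrow> (nat \<Rightarrow> real) measure" where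
  "conv_pow d P 0 = return (vecs d) (\<lambda>i\<in>{..<d}. 0)"
| "conv_pow d P (Suc n) = conv d (conv_pow d P n) P"

lemma law_measurable_cong: "law d P \<Longrightarrow> measurable P N = measurable (vecs d) N"
  by (rule measurable_cong_sets) (auto simp: law_def)

lemma vadd_measurable: "(\<lambda>(x, y). vadd d x y) \<in> measurable (vecs d \<Otimes>\<^sub>M vecs d) (vecs d)"
  unfolding vadd_def case_prod_beta by (rule measurable_restrict) measurable

lemma pair_law_measurable:
  assumes "law d P" "law d Q"
  shows "measurable (P \<Otimes>\<^sub>M Q) N = measurable (vecs d \<Otimes>\<^sub>M vecs d) N"
  by (rule measurable_cong_sets) (use assms in \<open>auto simp: law_def intro!: sets_pair_measure_cong\<close>)

lemma vnorm_measurable [measurable]: "(\<lambda>x. vnorm d x) \<in> borel_measurable (vecs d)"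
  unfolding L2_set_def by measurable

lemma vadd_measurable_const: "(\<lambda>y. vadd d x y) \<in> measurable (vecs d) (vecs d)"
  unfolding vadd_def by (rule measurable_restrict) measurable

lemma law_conv:
  assumes "law d P" "law d Q" shows "law d (conv d P Q)"
proof -
  interpret P: prob_space P using assms by (simp add: law_def)
  interpret Q: prob_space Q using assms by (simp add: law_def)
  interpret PQ: pair_prob_space P Q ..
  have "prob_space (conv d P Q)" unfolding conv_def
    by (rule PQ.P.prob_space_distr) (simp add: pair_law_measurable[OF assms] vadd_measurable)
  then show ?thesis by (simp add: law_def conv_def)
qed

lemma vnorm_vadd_le: "vnorm d (vadd d x y) \<le> vnorm d x + vnorm d y"
proof -
  have "vnorm d (vadd d x y) = vnorm d (\<lambda>i. x i + y i)"
    by (rule L2_set_cong) (auto simp: vadd_def)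
  then show ?thesis using L2_set_triangle_ineq[of x y "{..<d}"] by simp
qed

lemma cube_add_le: "0 \<le> a \<Longrightarrow> 0 \<le> b \<Longrightarrow> (a + b) ^ 3 \<le> 4 * (a ^ 3 + b ^ 3)" for a b :: real
proof -
  assume ab: "0 \<le> a" "0 \<le> b"
  have "4 * (a ^ 3 + b ^ 3) - (a + b) ^ 3 = 3 * (a + b) * (a - b)\<^sup>2"
    by (simp add: power3_eq_cube power2_eq_square algebra_simps)
  also have "\<dots> \<ge> 0" using ab by simp
  finally show ?thesis by simp
qed

lemma cube_law_conv:
  assumes P: "cube_law d P" and Q: "cube_law d Q"
  shows "cube_law d (conv d P Q)" and "abs_cube d (conv d P Q) \<le> 4 * (abs_cube d P + abs_cube d Q)"
proof -
  have lP: "law d P" and lQ: "law d Q" using P Q by (auto simp: cube_law_def)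
  interpret P: prob_space P using lP by (simp add: law_def)
  interpret Q: prob_space Q using lQ by (simp add: law_def)
  interpret PQ: pair_prob_space P Q ..
  have iP: "integrable P (\<lambda>x. vnorm d x ^ 3)" and iQ: "integrable Q (\<lambda>x. vnorm d x ^ 3)"
    using P Q by (auto simp: cube_law_def)
  have vm: "(\<lambda>(x, y). vadd d x y) \<in> measurable (P \<Otimes>\<^sub>M Q) (vecs d)"
    by (simp add: pair_law_measurable[OF lP lQ] vadd_measurable)
  have i1: "integrable (P \<Otimes>\<^sub>M Q) (\<lambda>z. vnorm d (fst z) ^ 3)"
    by (rule PQ.Fubini_integrable) (use iP in \<open>auto simp: pair_law_measurable[OF lP lQ] Q.prob_space\<close>)
  have i2: "integrable (P \<Otimes>\<^sub>M Q) (\<lambda>z. vnorm d (snd z) ^ 3)"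
    by (rule PQ.Fubini_integrable) (use iQ in \<open>auto simp: pair_law_measurable[OF lP lQ]\<close>)
  have e1: "(\<integral>z. vnorm d (fst z) ^ 3 \<partial>(P \<Otimes>\<^sub>M Q)) = abs_cube d P"
    using PQ.integral_fst'[OF i1] by (simp add: abs_cube_def Q.prob_space)
  have e2: "(\<integral>z. vnorm d (snd z) ^ 3 \<partial>(P \<Otimes>\<^sub>M Q)) = abs_cube d Q"
    using PQ.integral_fst'[OF i2] by (simp add: abs_cube_def P.prob_space)
  have i3: "integrable (P \<Otimes>\<^sub>M Q) (\<lambda>z. 4 * (vnorm d (fst z) ^ 3 + vnorm d (snd z) ^ 3))"
    using i1 i2 by simp
  have le: "vnorm d (vadd d x y) ^ 3 \<le> 4 * (vnorm d x ^ 3 + vnorm d y ^ 3)" for x y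
  proof -
    have "vnorm d (vadd d x y) ^ 3 \<le> (vnorm d x + vnorm d y) ^ 3"
      by (intro power_mono vnorm_vadd_le L2_set_nonneg)
    also have "\<dots> \<le> 4 * (vnorm d x ^ 3 + vnorm d y ^ 3)" by (intro cube_add_le L2_set_nonneg)
    finally show ?thesis .
  qed
  have nm: "(\<lambda>x. vnorm d x ^ 3) \<in> borel_measurable (vecs d)" by measurable
  have i4: "integrable (P \<Otimes>\<^sub>M Q) (\<lambda>z. vnorm d (case z of (x, y) \<Rightarrow> vadd d x y) ^ 3)"
    by (rule Bochner_Integration.integrable_bound[OF i3])
       (use le measurable_compose[OF vm nm] in \<open>auto simp: case_prod_beta intro!: AE_I2 order_trans[OF le abs_ge_self]\<close>)
  have "integrable (conv d P Q) (\<lambda>x. vnorm d x ^ 3)"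
    unfolding conv_def by (subst integrable_distr_eq[OF vm nm]) (rule i4)
  then show "cube_law d (conv d P Q)" using law_conv[OF lP lQ] by (simp add: cube_law_def)
  have "abs_cube d (conv d P Q) = (\<integral>z. vnorm d (case z of (x, y) \<Rightarrow> vadd d x y) ^ 3 \<partial>(P \<Otimes>\<^sub>M Q))"
    unfolding abs_cube_def conv_def by (rule integral_distr[OF vm nm])
  also have "\<dots> \<le> (\<integral>z. 4 * (vnorm d (fst z) ^ 3 + vnorm d (snd z) ^ 3) \<partial>(P \<Otimes>\<^sub>M Q))"
    by (rule integral_mono[OF i4 i3]) (simp only: case_prod_beta le)
  also have "\<dots> = 4 * (abs_cube d P + abs_cube d Q)" using i1 i2 by (simp add: e1 e2)
  finally show "abs_cube d (conv d P Q) \<le> 4 * (abs_cube d P + abs_cube d Q)" .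
qed

text \<open>Iterating \<open>cube_law_conv\<close> gives a_(n+1) \<le> 4 (a_n + a), whence 4/3 (4^n
  - 1) a. Exponential growth is affordable because n will be a Poisson number of mean at most one,
  and the value 0 at n = 0 makes the Poisson average of the order of the rate.\<close>

lemma cube_law_conv_pow:
  assumes "cube_law d P"
  shows "cube_law d (conv_pow d P n)" "abs_cube d (conv_pow d P n) \<le> 4 / 3 * (4 ^ n - 1) * abs_cube d P"
proof -
  have "cube_law d (conv_pow d P n) \<and> abs_cube d (conv_pow d P n) \<le> 4 / 3 * (4 ^ n - 1) * abs_cube d P"
  proof (induction n)
    case 0
    have z: "(\<lambda>i\<in>{..<d}. 0) \<in> space (vecs d)" by (simp add: space_PiM)
    have v0: "vnorm d (\<lambda>i\<in>{..<d}. 0) = 0"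
      by (subst L2_set_eq_0_iff) auto
    have "law d (return (vecs d) (\<lambda>i\<in>{..<d}. 0))"
      using z by (simp add: law_def prob_space_return)
    moreover have "integrable (return (vecs d) (\<lambda>i\<in>{..<d}. 0)) (\<lambda>x. vnorm d x ^ 3)"
    proof (rule integrableI_bounded)
      have "(\<integral>\<^sup>+x. norm (vnorm d x ^ 3) \<partial>return (vecs d) (\<lambda>i\<in>{..<d}. 0)) = norm (vnorm d (\<lambda>i\<in>{..<d}. 0) ^ 3)"
        using z by (intro nn_integral_return) auto
      then show "(\<integral>\<^sup>+x. norm (vnorm d x ^ 3) \<partial>return (vecs d) (\<lambda>i\<in>{..<d}. 0)) < \<infinity>" by simp
    qed simp
    moreover have "(\<integral>x. vnorm d x ^ 3 \<partial>return (vecs d) (\<lambda>i\<in>{..<d}. 0)) = 0"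
      using z by (subst integral_return) (auto simp: v0)
    ultimately show ?case by (simp add: cube_law_def abs_cube_def)
  next
    case (Suc n)
    then have c: "cube_law d (conv_pow d P n)" by simp
    have "abs_cube d (conv_pow d P (Suc n)) \<le> 4 * (abs_cube d (conv_pow d P n) + abs_cube d P)"
      using cube_law_conv(2)[OF c assms] by simp
    also have "\<dots> \<le> 4 * (4 / 3 * (4 ^ n - 1) * abs_cube d P + abs_cube d P)"
      by (intro mult_left_mono add_right_mono) (use Suc in auto)
    also have "\<dots> = 4 / 3 * (4 ^ Suc n - 1) * abs_cube d P" by (simp add: field_simps)
    finally show ?case using cube_law_conv(1)[OF c assms] by simp
  qed
  then show "cube_law d (conv_pow d P n)" "abs_cube d (conv_pow d P n) \<le> 4 / 3 * (4 ^ n - 1) * abs_cube d P" by auto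
qed

lemma law_conv_pow: "law d P \<Longrightarrow> law d (conv_pow d P n)"
proof (induction n)
  case 0
  then show ?case by (auto simp: law_def space_PiM intro!: prob_space_return)
qed (simp add: law_conv)

lemma cube_law_integrable:
  fixes f :: "(nat \<Rightarrow> real) \<Rightarrow> 'b::{banach, second_countable_topology}"
  assumes P: "cube_law d P" and f: "f \<in> borel_measurable (vecs d)"
    and b: "\<And>x. norm (f x) \<le> C * (1 + vnorm d x ^ 3)"
  shows "integrable P f"
proof -
  have lP: "law d P" using P by (simp add: cube_law_def)
  interpret P: prob_space P using lP by (simp add: law_def)
  have "integrable P (\<lambda>x. C * (1 + vnorm d x ^ 3))" using P by (simp add: cube_law_def)
  then show ?thesis
    by (rule Bochner_Integration.integrable_bound)
       (use f b in \<open>auto simp: law_measurable_cong[OF lP] intro!: AE_I2 order_trans[OF b abs_ge_self]\<close>)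
qed

text \<open>Fubini in both orders: the exchange argument conditions on the last summand as well as
  on the sum of the others.\<close>

lemma integral_conv:
  fixes f :: "(nat \<Rightarrow> real) \<Rightarrow> 'b::{banach, second_countable_topology}"
  assumes P: "law d P" and Q: "law d Q" and f: "f \<in> borel_measurable (vecs d)"
    and i: "integrable (conv d P Q) f"
  shows "(\<integral>z. f z \<partial>conv d P Q) = (\<integral>x. \<integral>y. f (vadd d x y) \<partial>Q \<partial>P)"
    and "(\<integral>z. f z \<partial>conv d P Q) = (\<integral>y. \<integral>x. f (vadd d x y) \<partial>P \<partial>Q)"
    and "integrable P (\<lambda>x. \<integral>y. f (vadd d x y) \<partial>Q)"
    and "integrable Q (\<lambda>y. \<integral>x. f (vadd d x y) \<partial>P)"
proof -
  interpret P: prob_space P using P by (simp add: law_def)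
  interpret Q: prob_space Q using Q by (simp add: law_def)
  interpret PQ: pair_prob_space P Q ..
  have vm: "(\<lambda>(x, y). vadd d x y) \<in> measurable (P \<Otimes>\<^sub>M Q) (vecs d)"
    by (simp add: pair_law_measurable[OF P Q] vadd_measurable)
  have i': "integrable (P \<Otimes>\<^sub>M Q) (\<lambda>(x, y). f (vadd d x y))"
    using i unfolding conv_def by (subst (asm) integrable_distr_eq[OF vm f]) (simp add: case_prod_unfold)
  have e: "(\<integral>z. f z \<partial>conv d P Q) = (\<integral>(x, y). f (vadd d x y) \<partial>(P \<Otimes>\<^sub>M Q))"
    unfolding conv_def by (subst integral_distr[OF vm f]) (simp add: case_prod_unfold)
  show "(\<integral>z. f z \<partial>conv d P Q) = (\<integral>x. \<integral>y. f (vadd d x y) \<partial>Q \<partial>P)"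
    unfolding e using PQ.integral_fst[OF i'] by simp
  show "(\<integral>z. f z \<partial>conv d P Q) = (\<integral>y. \<integral>x. f (vadd d x y) \<partial>P \<partial>Q)"
    unfolding e using PQ.integral_snd[OF i'] by simp
  show "integrable P (\<lambda>x. \<integral>y. f (vadd d x y) \<partial>Q)" using PQ.integrable_fst[OF i'] .
  show "integrable Q (\<lambda>y. \<integral>x. f (vadd d x y) \<partial>P)" using PQ.integrable_snd[OF i'] .
qed

lemma abs_component_le_vnorm: "i < d \<Longrightarrow> \<bar>x i\<bar> \<le> vnorm d x"
  using member_le_L2_set[of "{..<d}" i "\<lambda>i. \<bar>x i\<bar>"] by (simp add: L2_set_def)

lemma power_le_1_cube: "0 \<le> r \<Longrightarrow> r \<le> 1 + r ^ 3" "0 \<le> r \<Longrightarrow> r\<^sup>2 \<le> 1 + r ^ 3" for r :: real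
proof -
  assume r: "0 \<le> r"
  have "r \<le> 1 + r ^ 3 \<and> r\<^sup>2 \<le> 1 + r ^ 3"
  proof (cases "r \<le> 1")
    case True
    have "0 \<le> r ^ 3" using r by simp
    moreover have "r\<^sup>2 \<le> 1" using True r by (simp add: power_le_one)
    ultimately show ?thesis using True by linarith
  next
    case False
    then have "r \<le> r ^ 3" "r ^ 2 \<le> r ^ 3"
      using power_increasing[of 1 3 r] power_increasing[of 2 3 r] by simp_all
    then show ?thesis by simp
  qed
  then show "r \<le> 1 + r ^ 3" "r\<^sup>2 \<le> 1 + r ^ 3" by auto
qed

lemma cube_law_integrable_component:
  assumes P: "cube_law d P" and i: "i < d"
  shows "integrable P (\<lambda>x. x i)"
proof (rule cube_law_integrable[OF P, of _ 1])
  show "norm (x i) \<le> 1 * (1 + vnorm d x ^ 3)" for x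
    using abs_component_le_vnorm[OF i, of x] power_le_1_cube(1)[OF L2_set_nonneg[of x "{..<d}"]] by simp
qed (use i in simp)

lemma cube_law_integrable_component2:
  assumes P: "cube_law d P" and i: "i < d" and j: "j < d"
  shows "integrable P (\<lambda>x. x i * x j)"
proof (rule cube_law_integrable[OF P, of _ 1])
  fix x :: "nat \<Rightarrow> real"
  have "\<bar>x i * x j\<bar> \<le> (vnorm d x)\<^sup>2"
    unfolding abs_mult power2_eq_square by (intro mult_mono abs_component_le_vnorm i j) (auto simp: L2_set_nonneg)
  then show "norm (x i * x j) \<le> 1 * (1 + vnorm d x ^ 3)"
    using power_le_1_cube(2)[OF L2_set_nonneg[of x "{..<d}"]] by simp
qed (use i j in simp)

lemma conv_pow_moments:
  assumes P: "cube_law d P" and m: "\<And>i. i < d \<Longrightarrow> (\<integral>x. x i \<partial>P) = 0"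
  shows "i < d \<Longrightarrow> (\<integral>x. x i \<partial>conv_pow d P n) = 0"
    and "i < d \<Longrightarrow> j < d \<Longrightarrow> (\<integral>x. x i * x j \<partial>conv_pow d P n) = real n * (\<integral>x. x i * x j \<partial>P)"
proof -
  have lP: "law d P" using P by (simp add: cube_law_def)
  interpret P: prob_space P using lP by (simp add: law_def)
  have A: "(\<integral>x. x i \<partial>conv_pow d P n) = 0" if i: "i < d" for i n
  proof (induction n)
    case 0
    show ?case using i by (simp, subst integral_return) (auto simp: space_PiM)
  next
    case (Suc n)
    let ?K = "conv_pow d P n"
    have K: "cube_law d ?K" by (rule cube_law_conv_pow[OF P])
    interpret K: prob_space ?K using K by (simp add: law_def cube_law_def)
    have "(\<integral>x. x i \<partial>conv_pow d P (Suc n)) = (\<integral>x. \<integral>y. vadd d x y i \<partial>P \<partial>?K)"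
      unfolding conv_pow.simps
      by (rule integral_conv(1)) (use i K lP in \<open>auto simp: cube_law_def intro!: cube_law_integrable_component cube_law_conv(1) P\<close>)
    also have "\<dots> = (\<integral>x. x i + 0 \<partial>?K)"
      using i m[OF i] cube_law_integrable_component[OF P i] by (simp add: vadd_def P.prob_space)
    finally show ?case using Suc by simp
  qed
  then show "i < d \<Longrightarrow> (\<integral>x. x i \<partial>conv_pow d P n) = 0" .
  assume i: "i < d" and j: "j < d"
  show "(\<integral>x. x i * x j \<partial>conv_pow d P n) = real n * (\<integral>x. x i * x j \<partial>P)"
  proof (induction n)
    case 0
    show ?case using i j by (simp, subst integral_return) (auto simp: space_PiM)
  next
    case (Suc n)
    let ?K = "conv_pow d P n"
    have K: "cube_law d ?K" by (rule cube_law_conv_pow[OF P])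
    interpret K: prob_space ?K using K by (simp add: law_def cube_law_def)
    have "(\<integral>x. x i * x j \<partial>conv_pow d P (Suc n)) = (\<integral>x. \<integral>y. vadd d x y i * vadd d x y j \<partial>P \<partial>?K)"
      unfolding conv_pow.simps
      by (rule integral_conv(1)[where f = "\<lambda>x. x i * x j"])
         (use i j K lP in \<open>auto simp: cube_law_def intro!: cube_law_integrable_component2 cube_law_conv(1) P\<close>)
    also have "\<dots> = (\<integral>x. \<integral>y. (x i * x j + x i * y j) + (x j * y i + y i * y j) \<partial>P \<partial>?K)"
      using i j by (simp add: vadd_def algebra_simps)
    also have "\<dots> = (\<integral>x. x i * x j + (\<integral>y. y i * y j \<partial>P) \<partial>?K)"
      using m[OF i] m[OF j] cube_law_integrable_component[OF P i] cube_law_integrable_component[OF P j]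
        cube_law_integrable_component2[OF P i j] by (simp add: P.prob_space)
    also have "\<dots> = (\<integral>x. x i * x j \<partial>?K) + (\<integral>y. y i * y j \<partial>P)"
      using cube_law_integrable_component2[OF K i j] by (simp add: K.prob_space)
    finally show ?case using Suc by (simp add: algebra_simps)
  qed
qed

lemma iexp_dot_measurable: "(\<lambda>x. iexp (\<Sum>i<d. a i * x i)) \<in> borel_measurable (vecs d)"
  by measurable

lemma law_integrable_iexp:
  assumes P: "law d P" shows "integrable P (\<lambda>x. iexp (\<Sum>i<d. a i * x i))"
proof -
  interpret P: prob_space P using P by (simp add: law_def)
  have "(\<lambda>x. iexp (\<Sum>i<d. a i * x i)) \<in> borel_measurable P"
    using iexp_dot_measurable by (simp only: law_measurable_cong[OF P])
  then show ?thesis by (intro P.integrable_const_bound[of _ 1]) auto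
qed

lemma conv_pow_char:
  assumes P: "law d P"
  shows "(\<integral>x. iexp (\<Sum>i<d. a i * x i) \<partial>conv_pow d P n) = (\<integral>x. iexp (\<Sum>i<d. a i * x i) \<partial>P) ^ n"
proof (induction n)
  case 0
  have "(\<integral>x. iexp (\<Sum>i<d. a i * x i) \<partial>return (vecs d) (\<lambda>i\<in>{..<d}. 0)) = iexp (\<Sum>i<d. a i * (\<lambda>i\<in>{..<d}. 0) i)"
    by (rule integral_return[OF _ iexp_dot_measurable]) (simp add: space_PiM)
  also have "(\<Sum>i<d. a i * (\<lambda>i\<in>{..<d}. 0) i) = 0" by (rule sum.neutral) auto
  finally show ?case by (simp only: conv_pow.simps power_0 of_real_0 mult_zero_right exp_zero)
next
  case (Suc n)
  let ?K = "conv_pow d P n"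
  have K: "law d ?K" by (rule law_conv_pow[OF P])
  have "(\<integral>x. iexp (\<Sum>i<d. a i * x i) \<partial>conv_pow d P (Suc n)) = (\<integral>x. \<integral>y. iexp (\<Sum>i<d. a i * vadd d x y i) \<partial>P \<partial>?K)"
    unfolding conv_pow.simps
    by (rule integral_conv(1)[OF K P iexp_dot_measurable law_integrable_iexp[OF law_conv[OF K P]]])
  also have "\<dots> = (\<integral>x. \<integral>y. iexp (\<Sum>i<d. a i * x i) * iexp (\<Sum>i<d. a i * y i) \<partial>P \<partial>?K)"
  proof -
    have "iexp (\<Sum>i<d. a i * vadd d x y i) = iexp (\<Sum>i<d. a i * x i) * iexp (\<Sum>i<d. a i * y i)" for x y
    proof -
      have "(\<Sum>i<d. a i * vadd d x y i) = (\<Sum>i<d. a i * x i) + (\<Sum>i<d. a i * y i)"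
        by (simp add: vadd_def distrib_left sum.distrib)
      then show ?thesis by (simp only: of_real_add distrib_left exp_add)
    qed
    then show ?thesis by (simp only:)
  qed
  also have "\<dots> = (\<integral>x. iexp (\<Sum>i<d. a i * x i) \<partial>?K) * (\<integral>y. iexp (\<Sum>i<d. a i * y i) \<partial>P)"
    by (simp only: integral_mult_right_zero integral_mult_left_zero)
  finally show ?case using Suc by (simp only: power_Suc2)
qed

section \<open>Exchange of summands under a test function\<close>

text \<open>Taylor's formula gives at most quadratic growth; it is relaxed to 1 + |v|^3 because that
  is the function which \<open>cube_law\<close> makes integrable.\<close>

lemma test_function_cube_growth:
  assumes h: "h \<in> test_functions d"
  obtains C where "\<And>v. \<bar>h (vadd d y v)\<bar> \<le> C * (1 + vnorm d v ^ 3)"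
proof -
  obtain A B where AB: "\<And>v. \<bar>h (\<lambda>i\<in>{..<d}. y i + v i) - h (\<lambda>i\<in>{..<d}. y i) - (\<Sum>i<d. A i * v i) - (\<Sum>i<d. \<Sum>j<d. B i j * (v i * v j)) / 2\<bar>
        \<le> vnorm d v ^ 3 / 6"
    and A: "\<And>v. \<bar>h (\<lambda>i\<in>{..<d}. y i + v i) - h (\<lambda>i\<in>{..<d}. y i) - (\<Sum>i<d. A i * v i)\<bar> \<le> vnorm d v ^ 2 / 2"
    using test_function_taylor[OF h, of y] by blast
  define c where "c = \<bar>h (\<lambda>i\<in>{..<d}. y i)\<bar>"
  show ?thesis
  proof
    fix v
    let ?r = "1 + vnorm d v ^ 3"
    have r1: "?r \<ge> 1" by (simp add: L2_set_nonneg)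
    have "\<bar>\<Sum>i<d. A i * v i\<bar> \<le> (\<Sum>i<d. \<bar>A i\<bar> * ?r)"
    proof (rule order_trans[OF sum_abs], rule sum_mono)
      fix i assume "i \<in> {..<d}"
      then have "\<bar>v i\<bar> \<le> ?r" using abs_component_le_vnorm[of i d v] power_le_1_cube(1)[OF L2_set_nonneg[of v "{..<d}"]] by simp
      then show "\<bar>A i * v i\<bar> \<le> \<bar>A i\<bar> * ?r" unfolding abs_mult by (intro mult_left_mono) auto
    qed
    also have "\<dots> = (\<Sum>i<d. \<bar>A i\<bar>) * ?r" by (rule sum_distrib_right[symmetric])
    finally have 1: "\<bar>\<Sum>i<d. A i * v i\<bar> \<le> (\<Sum>i<d. \<bar>A i\<bar>) * ?r" .
    have 2: "vnorm d v ^ 2 \<le> ?r" using power_le_1_cube(2)[OF L2_set_nonneg[of v "{..<d}"]] .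
    have 3: "c * 1 \<le> c * ?r" using r1 by (intro mult_left_mono) (auto simp: c_def)
    have "\<bar>h (vadd d y v)\<bar> \<le> c + (\<Sum>i<d. \<bar>A i\<bar>) * ?r + ?r"
      using A[of v] 1 2 r1 unfolding vadd_def c_def by linarith
    also have "\<dots> \<le> (c + (\<Sum>i<d. \<bar>A i\<bar>) + 1) * ?r" using 3 by (simp add: distrib_right)
    finally show "\<bar>h (vadd d y v)\<bar> \<le> (c + (\<Sum>i<d. \<bar>A i\<bar>) + 1) * ?r" .
  qed
qed

lemma test_function_integrable:
  assumes h: "h \<in> test_functions d" and P: "cube_law d P"
  shows "integrable P (\<lambda>v. h (vadd d y v))"
proof -
  obtain C where C: "\<And>v. \<bar>h (vadd d y v)\<bar> \<le> C * (1 + vnorm d v ^ 3)"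
    using test_function_cube_growth[OF h, of y] by blast
  show ?thesis
    by (rule cube_law_integrable[OF P, of _ C])
       (use C measurable_compose[OF vadd_measurable_const test_function_measurable[OF h]] in auto)
qed

text \<open>Equal first and second moments give the quadratic Taylor polynomial \<open>T\<close> at
  y the same expectation under both laws. Each law is off from it by at most one sixth of its third
  absolute moment, whatever y is.\<close>

lemma lindeberg_one_step:
  assumes h: "h \<in> test_functions d" and P: "cube_law d P" and Q: "cube_law d Q"
    and m: "\<And>i. i < d \<Longrightarrow> (\<integral>x. x i \<partial>P) = (\<integral>x. x i \<partial>Q)"
    and c: "\<And>i j. i < d \<Longrightarrow> j < d \<Longrightarrow> (\<integral>x. x i * x j \<partial>P) = (\<integral>x. x i * x j \<partial>Q)"
  shows "\<bar>(\<integral>v. h (vadd d y v) \<partial>P) - (\<integral>v. h (vadd d y v) \<partial>Q)\<bar> \<le> (abs_cube d P + abs_cube d Q) / 6"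
proof -
  obtain A B where AB: "\<And>v. \<bar>h (\<lambda>i\<in>{..<d}. y i + v i) - h (\<lambda>i\<in>{..<d}. y i) - (\<Sum>i<d. A i * v i) - (\<Sum>i<d. \<Sum>j<d. B i j * (v i * v j)) / 2\<bar>
        \<le> vnorm d v ^ 3 / 6"
    and "\<And>v. \<bar>h (\<lambda>i\<in>{..<d}. y i + v i) - h (\<lambda>i\<in>{..<d}. y i) - (\<Sum>i<d. A i * v i)\<bar> \<le> vnorm d v ^ 2 / 2"
    using test_function_taylor[OF h, of y] by blast
  define T where "T v = h (\<lambda>i\<in>{..<d}. y i) + ((\<Sum>i<d. A i * v i) + (\<Sum>i<d. \<Sum>j<d. B i j * (v i * v j)) / 2)" for v
  have gen: "integrable L T \<and> (\<integral>v. T v \<partial>L) = h (\<lambda>i\<in>{..<d}. y i) + ((\<Sum>i<d. A i * (\<integral>v. v i \<partial>L)) + (\<Sum>i<d. \<Sum>j<d. B i j * (\<integral>v. v i * v j \<partial>L)) / 2)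
      \<and> \<bar>(\<integral>v. h (vadd d y v) \<partial>L) - (\<integral>v. T v \<partial>L)\<bar> \<le> abs_cube d L / 6" if L: "cube_law d L" for L
  proof -
    interpret L: prob_space L using L by (simp add: law_def cube_law_def)
    note i1 = cube_law_integrable_component[OF L] and i2 = cube_law_integrable_component2[OF L]
    have iA: "integrable L (\<lambda>v. \<Sum>i<d. A i * v i)"
      by (intro Bochner_Integration.integrable_sum integrable_mult_right i1) simp
    have iB: "integrable L (\<lambda>v. (\<Sum>i<d. \<Sum>j<d. B i j * (v i * v j)) / 2)"
      by (intro integrable_divide Bochner_Integration.integrable_sum integrable_mult_right i2) auto
    have eA: "(\<integral>v. (\<Sum>i<d. A i * v i) \<partial>L) = (\<Sum>i<d. A i * (\<integral>v. v i \<partial>L))"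
      by (subst Bochner_Integration.integral_sum) (auto intro!: integrable_mult_right i1)
    have "(\<integral>v. (\<Sum>i<d. \<Sum>j<d. B i j * (v i * v j)) \<partial>L) = (\<Sum>i<d. \<integral>v. (\<Sum>j<d. B i j * (v i * v j)) \<partial>L)"
      by (rule Bochner_Integration.integral_sum) (intro Bochner_Integration.integrable_sum integrable_mult_right i2, auto)
    also have "\<dots> = (\<Sum>i<d. \<Sum>j<d. \<integral>v. B i j * (v i * v j) \<partial>L)"
      by (intro sum.cong refl Bochner_Integration.integral_sum integrable_mult_right i2) auto
    finally have eB: "(\<integral>v. (\<Sum>i<d. \<Sum>j<d. B i j * (v i * v j)) / 2 \<partial>L) = (\<Sum>i<d. \<Sum>j<d. B i j * (\<integral>v. v i * v j \<partial>L)) / 2"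
      by simp
    have iT: "integrable L T" unfolding T_def
      by (intro Bochner_Integration.integrable_add iA iB L.integrable_const)
    have eT: "(\<integral>v. T v \<partial>L) = h (\<lambda>i\<in>{..<d}. y i) + ((\<Sum>i<d. A i * (\<integral>v. v i \<partial>L)) + (\<Sum>i<d. \<Sum>j<d. B i j * (\<integral>v. v i * v j \<partial>L)) / 2)"
      unfolding T_def
      by (subst Bochner_Integration.integral_add[OF L.integrable_const Bochner_Integration.integrable_add[OF iA iB]],
          subst Bochner_Integration.integral_add[OF iA iB]) (simp only: eA eB, simp add: L.prob_space)
    have ih: "integrable L (\<lambda>v. h (vadd d y v))" by (rule test_function_integrable[OF h L])
    have i3: "integrable L (\<lambda>v. vnorm d v ^ 3)" using L by (simp add: cube_law_def)
    have "\<bar>(\<integral>v. h (vadd d y v) \<partial>L) - (\<integral>v. T v \<partial>L)\<bar> = \<bar>\<integral>v. h (vadd d y v) - T v \<partial>L\<bar>"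
      using ih iT by simp
    also have "\<dots> \<le> (\<integral>v. \<bar>h (vadd d y v) - T v\<bar> \<partial>L)" by (rule integral_abs_bound)
    also have "\<dots> \<le> (\<integral>v. vnorm d v ^ 3 / 6 \<partial>L)"
    proof (rule integral_mono)
      fix v
      show "\<bar>h (vadd d y v) - T v\<bar> \<le> vnorm d v ^ 3 / 6"
        using AB[of v] by (simp add: T_def vadd_def algebra_simps)
    qed (use ih iT i3 in auto)
    also have "\<dots> = abs_cube d L / 6" by (simp add: abs_cube_def)
    finally show ?thesis using iT eT by simp
  qed
  have TT: "(\<integral>v. T v \<partial>P) = (\<integral>v. T v \<partial>Q)"
    using gen[OF P] gen[OF Q] m c by simp
  have "\<bar>(\<integral>v. h (vadd d y v) \<partial>Q) - (\<integral>v. T v \<partial>P)\<bar> \<le> abs_cube d Q / 6"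
    unfolding TT using gen[OF Q] by blast
  moreover have "\<bar>(\<integral>v. h (vadd d y v) \<partial>P) - (\<integral>v. T v \<partial>P)\<bar> \<le> abs_cube d P / 6"
    using gen[OF P] by blast
  ultimately show ?thesis unfolding add_divide_distrib by linarith
qed

lemma vadd_assoc: "vadd d y (vadd d x p) = vadd d (vadd d y x) p" "vadd d y (vadd d x p) = vadd d (vadd d y p) x"
  by (auto simp: vadd_def fun_eq_iff)

text \<open>Induction through the hybrid law of n copies from P and one from Q. The base point y
  stays arbitrary, since fixing one summand turns it into a shift of y.\<close>

lemma lindeberg_conv_pow:
  assumes h: "h \<in> test_functions d" and P: "cube_law d P" and Q: "cube_law d Q"
    and m: "\<And>i. i < d \<Longrightarrow> (\<integral>x. x i \<partial>P) = (\<integral>x. x i \<partial>Q)"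
    and c: "\<And>i j. i < d \<Longrightarrow> j < d \<Longrightarrow> (\<integral>x. x i * x j \<partial>P) = (\<integral>x. x i * x j \<partial>Q)"
  shows "\<bar>(\<integral>v. h (vadd d y v) \<partial>conv_pow d P n) - (\<integral>v. h (vadd d y v) \<partial>conv_pow d Q n)\<bar>
     \<le> real n * ((abs_cube d P + abs_cube d Q) / 6)"
proof (induction n arbitrary: y)
  case (Suc n)
  let ?e = "(abs_cube d P + abs_cube d Q) / 6"
  let ?K = "conv_pow d P n" and ?L = "conv_pow d Q n"
  have K: "cube_law d ?K" and L: "cube_law d ?L" by (rule cube_law_conv_pow P Q)+
  have lP: "law d P" and lQ: "law d Q" and lK: "law d ?K" and lL: "law d ?L"
    using P Q K L by (auto simp: cube_law_def)
  interpret K: prob_space ?K using lK by (simp add: law_def)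
  interpret Q: prob_space Q using lQ by (simp add: law_def)
  have hm: "(\<lambda>v. h (vadd d y v)) \<in> borel_measurable (vecs d)"
    by (rule measurable_compose[OF vadd_measurable_const test_function_measurable[OF h]])
  note ic = integral_conv[OF _ _ hm test_function_integrable[OF h cube_law_conv(1)]]
  \<comment> \<open>The last summand is exchanged: conditionally on the sum x of the others, this is
    one step at the base point y + x.\<close>
  have 1: "\<bar>(\<integral>v. h (vadd d y v) \<partial>conv d ?K P) - (\<integral>v. h (vadd d y v) \<partial>conv d ?K Q)\<bar> \<le> ?e"
  proof -
    have "\<bar>(\<integral>v. h (vadd d y v) \<partial>conv d ?K P) - (\<integral>v. h (vadd d y v) \<partial>conv d ?K Q)\<bar>
        = \<bar>\<integral>x. (\<integral>p. h (vadd d y (vadd d x p)) \<partial>P) - (\<integral>p. h (vadd d y (vadd d x p)) \<partial>Q) \<partial>?K\<bar>"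
      unfolding ic(1)[OF lK lP K P] ic(1)[OF lK lQ K Q]
      using ic(3)[OF lK lP K P] ic(3)[OF lK lQ K Q] by simp
    also have "\<dots> \<le> (\<integral>x. \<bar>(\<integral>p. h (vadd d y (vadd d x p)) \<partial>P) - (\<integral>p. h (vadd d y (vadd d x p)) \<partial>Q)\<bar> \<partial>?K)"
      by (rule integral_abs_bound)
    also have "\<dots> \<le> (\<integral>x. ?e \<partial>?K)"
    proof (rule integral_mono)
      fix x
      show "\<bar>(\<integral>p. h (vadd d y (vadd d x p)) \<partial>P) - (\<integral>p. h (vadd d y (vadd d x p)) \<partial>Q)\<bar> \<le> ?e"
        unfolding vadd_assoc(1) by (rule lindeberg_one_step[OF h P Q m c])
    qed (use ic(3)[OF lK lP K P] ic(3)[OF lK lQ K Q] in auto)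
    finally show ?thesis by (simp add: K.prob_space)
  qed
  \<comment> \<open>The other n summands are exchanged, conditionally on the last one p: the
    induction hypothesis at y + p.\<close>
  have 2: "\<bar>(\<integral>v. h (vadd d y v) \<partial>conv d ?K Q) - (\<integral>v. h (vadd d y v) \<partial>conv d ?L Q)\<bar> \<le> real n * ?e"
  proof -
    have "\<bar>(\<integral>v. h (vadd d y v) \<partial>conv d ?K Q) - (\<integral>v. h (vadd d y v) \<partial>conv d ?L Q)\<bar>
        = \<bar>\<integral>p. (\<integral>x. h (vadd d y (vadd d x p)) \<partial>?K) - (\<integral>x. h (vadd d y (vadd d x p)) \<partial>?L) \<partial>Q\<bar>"
      unfolding ic(2)[OF lK lQ K Q] ic(2)[OF lL lQ L Q]
      using ic(4)[OF lK lQ K Q] ic(4)[OF lL lQ L Q] by simp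
    also have "\<dots> \<le> (\<integral>p. \<bar>(\<integral>x. h (vadd d y (vadd d x p)) \<partial>?K) - (\<integral>x. h (vadd d y (vadd d x p)) \<partial>?L)\<bar> \<partial>Q)"
      by (rule integral_abs_bound)
    also have "\<dots> \<le> (\<integral>p. real n * ?e \<partial>Q)"
    proof (rule integral_mono)
      fix p
      show "\<bar>(\<integral>x. h (vadd d y (vadd d x p)) \<partial>?K) - (\<integral>x. h (vadd d y (vadd d x p)) \<partial>?L)\<bar> \<le> real n * ?e"
        unfolding vadd_assoc(2) by (rule Suc.IH)
    qed (use ic(4)[OF lK lQ K Q] ic(4)[OF lL lQ L Q] in auto)
    finally show ?thesis by (simp add: Q.prob_space)
  qed
  have "\<bar>a - c\<bar> \<le> e + f" if "\<bar>a - b\<bar> \<le> e" "\<bar>b - c\<bar> \<le> f" for a b c e f :: real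
    using that by linarith
  from this[OF 1 2] show ?case unfolding conv_pow.simps by (simp only: of_nat_Suc distrib_right mult_1)
qed simp

subsection \<open>Compound Poisson laws\<close>

lemma poisson_pmf_integral:
  fixes f :: "nat \<Rightarrow> 'b::{banach, second_countable_topology}"
  assumes r: "rate > 0" and s: "summable (\<lambda>k. norm (f k) * (rate ^ k / fact k))"
  shows "integrable (measure_pmf (poisson_pmf rate)) f"
    and "(\<integral>k. f k \<partial>measure_pmf (poisson_pmf rate)) = (\<Sum>k. (rate ^ k / fact k * exp (- rate)) *\<^sub>R f k)"
proof -
  have e: "measure_pmf (poisson_pmf rate) = density (count_space UNIV) (\<lambda>k. ennreal (rate ^ k / fact k * exp (- rate)))"
    unfolding measure_pmf_eq_density using r by simp
  have n: "norm ((rate ^ k / fact k * exp (- rate)) *\<^sub>R f k) = (norm (f k) * (rate ^ k / fact k)) * exp (- rate)" for k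
    using r by simp
  have i: "integrable (count_space UNIV) (\<lambda>k. (rate ^ k / fact k * exp (- rate)) *\<^sub>R f k)"
    unfolding integrable_count_space_nat_iff n by (intro summable_mult2 s)
  show "integrable (measure_pmf (poisson_pmf rate)) f"
    unfolding e by (subst integrable_density) (use i r in auto)
  show "(\<integral>k. f k \<partial>measure_pmf (poisson_pmf rate)) = (\<Sum>k. (rate ^ k / fact k * exp (- rate)) *\<^sub>R f k)"
    unfolding e by (subst integral_density) (use i r in \<open>auto simp: integral_count_space_nat\<close>)
qed

text \<open>The generating function of the Poisson distribution. Here z will be a value of a
  characteristic function for compound laws, and e^(i c) for the counts of a random measure.\<close>

lemma poisson_series_complex:
  fixes z :: complex and rate :: real
  shows "(\<lambda>k. (rate ^ k / fact k * exp (- rate)) *\<^sub>R z ^ k) sums exp (of_real rate * (z - 1))"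
proof -
  have "(\<lambda>k. (of_real rate * z) ^ k /\<^sub>R fact k) sums exp (of_real rate * z)"
    by (rule exp_converges)
  then have "(\<lambda>k. of_real (exp (- rate)) * ((of_real rate * z) ^ k /\<^sub>R fact k)) sums (of_real (exp (- rate)) * exp (of_real rate * z))"
    by (rule sums_mult)
  moreover have "of_real (exp (- rate)) * ((of_real rate * z) ^ k /\<^sub>R fact k) = (rate ^ k / fact k * exp (- rate)) *\<^sub>R z ^ k" for k
    by (simp add: scaleR_conv_of_real power_mult_distrib field_simps)
  moreover have "of_real (exp (- rate)) * exp (of_real rate * z) = exp (of_real rate * (z - 1))"
    unfolding exp_of_real[symmetric] exp_add[symmetric] by (simp add: algebra_simps)
  ultimately show ?thesis by simp
qed

lemma poisson_summable_power: "summable (\<lambda>k. c ^ k * (rate ^ k / fact k))" for c rate :: real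
proof -
  have "summable (\<lambda>k. (c * rate) ^ k /\<^sub>R fact k)" by (rule summable_exp_generic)
  then show ?thesis by (simp add: power_mult_distrib field_simps)
qed

lemma poisson_integral_power:
  fixes z :: complex
  assumes r: "rate > 0"
  shows "(\<integral>k. z ^ k \<partial>measure_pmf (poisson_pmf rate)) = exp (of_real rate * (z - 1))"
proof -
  have "summable (\<lambda>k. norm (z ^ k) * (rate ^ k / fact k))"
    unfolding norm_power by (rule poisson_summable_power)
  from poisson_pmf_integral(2)[OF r this] show ?thesis
    using sums_unique[OF poisson_series_complex[of rate z]] by simp
qed

lemma poisson_integral_power_real:
  fixes c :: real
  assumes r: "rate > 0"
  shows "integrable (measure_pmf (poisson_pmf rate)) (\<lambda>k. c ^ k)"
    and "(\<integral>k. c ^ k \<partial>measure_pmf (poisson_pmf rate)) = exp (rate * (c - 1))"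
proof -
  have s: "summable (\<lambda>k. norm (c ^ k) * (rate ^ k / fact k))"
    using poisson_summable_power[of "\<bar>c\<bar>" rate] by (simp add: power_abs)
  show "integrable (measure_pmf (poisson_pmf rate)) (\<lambda>k. c ^ k)" by (rule poisson_pmf_integral(1)[OF r s])
  have "complex_of_real (\<integral>k. c ^ k \<partial>measure_pmf (poisson_pmf rate)) = (\<integral>k. complex_of_real c ^ k \<partial>measure_pmf (poisson_pmf rate))"
    unfolding integral_complex_of_real[symmetric] by simp
  also have "\<dots> = of_real (exp (rate * (c - 1)))"
    unfolding poisson_integral_power[OF r] exp_of_real[symmetric] by simp
  finally show "(\<integral>k. c ^ k \<partial>measure_pmf (poisson_pmf rate)) = exp (rate * (c - 1))" by (simp only: of_real_eq_iff)
qed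

lemma poisson_integral_id:
  assumes r: "rate > 0"
  shows "integrable (measure_pmf (poisson_pmf rate)) real" and "(\<integral>k. real k \<partial>measure_pmf (poisson_pmf rate)) = rate"
proof -
  have "(\<lambda>k. rate ^ k /\<^sub>R fact k) sums exp rate" by (rule exp_converges)
  then have s0: "(\<lambda>k. rate * (rate ^ k /\<^sub>R fact k)) sums (rate * exp rate)" by (rule sums_mult)
  have "rate * (rate ^ k /\<^sub>R fact k) = real (Suc k) * (rate ^ Suc k / fact (Suc k))" for k
    by (simp add: field_simps del: of_nat_Suc)
  with s0 have "(\<lambda>k. real (Suc k) * (rate ^ Suc k / fact (Suc k))) sums (rate * exp rate)" by simp
  then have s: "(\<lambda>k. real k * (rate ^ k / fact k)) sums (rate * exp rate)"
    by (subst (asm) sums_Suc_iff) simp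
  then have s1: "summable (\<lambda>k. norm (real k) * (rate ^ k / fact k))" by (simp add: sums_iff)
  show "integrable (measure_pmf (poisson_pmf rate)) real" by (rule poisson_pmf_integral(1)[OF r s1])
  have "(\<lambda>k. (rate ^ k / fact k * exp (- rate)) *\<^sub>R real k) sums (exp (- rate) * (rate * exp rate))"
    using sums_mult[OF s, of "exp (- rate)"] by (simp add: mult_ac)
  then show "(\<integral>k. real k \<partial>measure_pmf (poisson_pmf rate)) = rate"
    unfolding poisson_pmf_integral(2)[OF r s1] by (simp add: sums_iff exp_minus)
qed

text \<open>The compound Poisson law is realised as a randomly indexed coordinate of a product, which reduces its
  integrals to those of the convolution powers.\<close>

definition compound :: "nat \<Rightarrow> real \<Rightarrow> (nat \<Rightarrow> real) measure \<Rightarrow> (nat \<Rightarrow> real) measure" where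
  "compound d rate R = distr (measure_pmf (poisson_pmf rate) \<Otimes>\<^sub>M (\<Pi>\<^sub>M k\<in>UNIV. conv_pow d R k)) (vecs d) (\<lambda>(k, \<omega>). \<omega> k)"

text \<open>Fubini over the Poisson index: for fixed k, the k-th marginal of the product is the
  k-fold convolution power. The premise on norms is the integrability condition on the
  product.\<close>

lemma compound_integral:
  fixes f :: "(nat \<Rightarrow> real) \<Rightarrow> 'b::{banach, second_countable_topology}"
  assumes R: "law d R"
  shows "law d (compound d rate R)"
    and "\<lbrakk>f \<in> borel_measurable (vecs d); \<And>k. integrable (conv_pow d R k) f;
       integrable (measure_pmf (poisson_pmf rate)) (\<lambda>k. \<integral>x. norm (f x) \<partial>conv_pow d R k)\<rbrakk> \<Longrightarrow>
     integrable (compound d rate R) f"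
    and "\<lbrakk>f \<in> borel_measurable (vecs d); \<And>k. integrable (conv_pow d R k) f;
       integrable (measure_pmf (poisson_pmf rate)) (\<lambda>k. \<integral>x. norm (f x) \<partial>conv_pow d R k)\<rbrakk> \<Longrightarrow>
     (\<integral>x. f x \<partial>compound d rate R) = (\<integral>k. (\<integral>x. f x \<partial>conv_pow d R k) \<partial>measure_pmf (poisson_pmf rate))"
proof -
  let ?K = "conv_pow d R" and ?\<Omega> = "\<Pi>\<^sub>M k\<in>UNIV. conv_pow d R k" and ?p = "measure_pmf (poisson_pmf rate)"
  have K: "law d (?K k)" for k by (rule law_conv_pow[OF R])
  then have Kp: "prob_space (?K k)" and Ks: "sets (?K k) = sets (vecs d)" for k by (auto simp: law_def)
  interpret O: prob_space ?\<Omega> by (intro prob_space_PiM Kp)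
  interpret p: prob_space ?p by (rule measure_pmf.prob_space_axioms)
  interpret pO: pair_prob_space ?p ?\<Omega> ..
  have comp: "(\<lambda>\<omega>. \<omega> k) \<in> measurable ?\<Omega> (?K k)" for k by (rule measurable_component_singleton) simp
  have comp': "(\<lambda>\<omega>. \<omega> k) \<in> measurable ?\<Omega> (vecs d)" for k
    using comp[of k] by (simp only: measurable_cong_sets[OF refl Ks])
  have m: "(\<lambda>(k, \<omega>). \<omega> k) \<in> measurable (?p \<Otimes>\<^sub>M ?\<Omega>) (vecs d)"
  proof -
    have "(\<lambda>(k, \<omega>). \<omega> k) \<in> measurable (count_space UNIV \<Otimes>\<^sub>M ?\<Omega>) (vecs d)"
      by (rule measurable_pair_measure_countable1) (use comp' in auto)
    moreover have "sets (?p \<Otimes>\<^sub>M ?\<Omega>) = sets (count_space UNIV \<Otimes>\<^sub>M ?\<Omega>)"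
      by (intro sets_pair_measure_cong) auto
    ultimately show ?thesis using measurable_cong_sets by blast
  qed
  show "law d (compound d rate R)"
    unfolding law_def compound_def by (intro conjI pO.P.prob_space_distr[OF m] sets_distr)
  assume f: "f \<in> borel_measurable (vecs d)" and i: "\<And>k. integrable (?K k) f"
    and ii: "integrable ?p (\<lambda>k. \<integral>x. norm (f x) \<partial>?K k)"
  have marg: "distr ?\<Omega> (?K k) (\<lambda>\<omega>. \<omega> k) = ?K k" for k
    by (rule distr_PiM_component) (auto intro: Kp)
  have fK: "f \<in> borel_measurable (?K k)" for k using f by (simp only: law_measurable_cong[OF K])
  have ik: "integrable ?\<Omega> (\<lambda>\<omega>. f (\<omega> k))" for k
    using i[of k] by (subst (asm) marg[symmetric]) (simp only: integrable_distr_eq[OF comp fK])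
  have ek: "(\<integral>\<omega>. g (\<omega> k) \<partial>?\<Omega>) = (\<integral>x. g x \<partial>?K k)" if "g \<in> borel_measurable (?K k)"
    for k and g :: "(nat \<Rightarrow> real) \<Rightarrow> 'c::{banach, second_countable_topology}"
    by (subst (2) marg[symmetric]) (rule integral_distr[OF comp that, symmetric])
  have F: "integrable (?p \<Otimes>\<^sub>M ?\<Omega>) (\<lambda>z. f (case z of (k, \<omega>) \<Rightarrow> \<omega> k))"
  proof (rule pO.Fubini_integrable)
    show "(\<lambda>z. f (case z of (k, \<omega>) \<Rightarrow> \<omega> k)) \<in> borel_measurable (?p \<Otimes>\<^sub>M ?\<Omega>)"
      by (rule measurable_compose[OF m f])
    have "(\<integral>\<omega>. norm (f (\<omega> k)) \<partial>?\<Omega>) = (\<integral>x. norm (f x) \<partial>?K k)" for k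
      by (rule ek) (use fK in measurable)
    then show "integrable ?p (\<lambda>x. \<integral>y. norm (f (case (x, y) of (k, \<omega>) \<Rightarrow> \<omega> k)) \<partial>?\<Omega>)" using ii by simp
  qed (use ik in auto)
  show "integrable (compound d rate R) f"
    unfolding compound_def by (subst integrable_distr_eq[OF m f]) (rule F)
  have "(\<integral>x. f x \<partial>compound d rate R) = (\<integral>z. f (case z of (k, \<omega>) \<Rightarrow> \<omega> k) \<partial>(?p \<Otimes>\<^sub>M ?\<Omega>))"
    unfolding compound_def by (rule integral_distr[OF m f])
  also have "\<dots> = (\<integral>k. \<integral>\<omega>. f (\<omega> k) \<partial>?\<Omega> \<partial>?p)"
    using pO.integral_fst'[OF F] by simp
  also have "\<dots> = (\<integral>k. (\<integral>x. f x \<partial>?K k) \<partial>?p)"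
    by (simp only: ek[OF fK])
  finally show "(\<integral>x. f x \<partial>compound d rate R) = (\<integral>k. (\<integral>x. f x \<partial>?K k) \<partial>?p)" .
qed

section \<open>Characteristic function and moments of compound Poisson laws\<close>

lemma compound_char:
  assumes R: "law d R" and r: "rate > 0"
  shows "(\<integral>x. iexp (\<Sum>i<d. a i * x i) \<partial>compound d rate R) = exp (of_real rate * ((\<integral>x. iexp (\<Sum>i<d. a i * x i) \<partial>R) - 1))"
proof -
  have K: "law d (conv_pow d R k)" for k by (rule law_conv_pow[OF R])
  have n: "(\<integral>x. norm (iexp (\<Sum>i<d. a i * x i)) \<partial>conv_pow d R k) = 1" for k
  proof -
    interpret K: prob_space "conv_pow d R k" using K by (simp add: law_def)
    have "(\<integral>x. norm (iexp (\<Sum>i<d. a i * x i)) \<partial>conv_pow d R k) = (\<integral>x. 1 \<partial>conv_pow d R k)"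
      by (simp only: norm_exp_i_times)
    then show ?thesis by (simp add: K.prob_space)
  qed
  have "(\<integral>x. iexp (\<Sum>i<d. a i * x i) \<partial>compound d rate R) = (\<integral>k. (\<integral>x. iexp (\<Sum>i<d. a i * x i) \<partial>conv_pow d R k) \<partial>measure_pmf (poisson_pmf rate))"
    by (rule compound_integral(3)[OF R iexp_dot_measurable law_integrable_iexp[OF K]]) (simp only: n, simp)
  also have "\<dots> = exp (of_real rate * ((\<integral>x. iexp (\<Sum>i<d. a i * x i) \<partial>R) - 1))"
    unfolding conv_pow_char[OF R] by (rule poisson_integral_power[OF r])
  finally show ?thesis .
qed

lemma abs_cube_nonneg: "abs_cube d P \<ge> 0"
  unfolding abs_cube_def by (intro Bochner_Integration.integral_nonneg) (simp add: L2_set_nonneg)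

text \<open>For a Poisson variable K one has E 4^K = exp (3 rate), which averages the growth factor
  4/3 (4^k - 1) of \<open>cube_law_conv_pow\<close>.\<close>

lemma compound_cube:
  assumes R: "cube_law d R" and r: "rate > 0"
  shows "cube_law d (compound d rate R)"
    and "abs_cube d (compound d rate R) \<le> 4 / 3 * (exp (3 * rate) - 1) * abs_cube d R"
proof -
  have lR: "law d R" using R by (simp add: cube_law_def)
  note K = cube_law_conv_pow[OF R]
  have nm: "(\<lambda>x. vnorm d x ^ 3) \<in> borel_measurable (vecs d)" by measurable
  have n: "(\<integral>x. norm (vnorm d x ^ 3) \<partial>conv_pow d R k) = abs_cube d (conv_pow d R k)" for k
    by (simp add: abs_cube_def L2_set_nonneg)
  have ib: "integrable (measure_pmf (poisson_pmf rate)) (\<lambda>k. 4 / 3 * (4 ^ k - 1) * abs_cube d R)"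
    using poisson_integral_power_real(1)[OF r, of 4] by simp
  have ic: "integrable (measure_pmf (poisson_pmf rate)) (\<lambda>k. abs_cube d (conv_pow d R k))"
    by (rule Bochner_Integration.integrable_bound[OF ib])
       (use K(2) abs_cube_nonneg in \<open>auto intro!: AE_I2 order_trans[OF K(2) abs_ge_self]\<close>)
  have ik: "integrable (conv_pow d R k) (\<lambda>x. vnorm d x ^ 3)" for k using K(1)[of k] by (simp add: cube_law_def)
  have "integrable (compound d rate R) (\<lambda>x. vnorm d x ^ 3)"
    by (rule compound_integral(2)[OF lR nm ik]) (simp only: n ic)
  then show "cube_law d (compound d rate R)" using compound_integral(1)[OF lR] by (simp add: cube_law_def)
  have "abs_cube d (compound d rate R) = (\<integral>k. abs_cube d (conv_pow d R k) \<partial>measure_pmf (poisson_pmf rate))"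
    unfolding abs_cube_def by (rule compound_integral(3)[OF lR nm ik]) (simp only: n ic)
  also have "\<dots> \<le> (\<integral>k. 4 / 3 * (4 ^ k - 1) * abs_cube d R \<partial>measure_pmf (poisson_pmf rate))"
    by (rule integral_mono[OF ic ib]) (rule K(2))
  also have "\<dots> = 4 / 3 * (exp (3 * rate) - 1) * abs_cube d R"
    using poisson_integral_power_real[OF r, of 4] by (simp add: mult.commute)
  finally show "abs_cube d (compound d rate R) \<le> 4 / 3 * (exp (3 * rate) - 1) * abs_cube d R" .
qed

text \<open>Second moments of centred convolution powers are k times those of R, and k has mean
  \<open>rate\<close>. The domination by 1 + |x|^3 justifies the averaging in
  \<open>gen\<close>.\<close>

lemma compound_moments:
  assumes R: "cube_law d R" and r: "rate > 0" and m: "\<And>i. i < d \<Longrightarrow> (\<integral>x. x i \<partial>R) = 0"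
  shows "i < d \<Longrightarrow> (\<integral>x. x i \<partial>compound d rate R) = 0"
    and "i < d \<Longrightarrow> j < d \<Longrightarrow> (\<integral>x. x i * x j \<partial>compound d rate R) = rate * (\<integral>x. x i * x j \<partial>R)"
proof -
  have lR: "law d R" using R by (simp add: cube_law_def)
  note K = cube_law_conv_pow[OF R]
  have gen: "(\<integral>x. f x \<partial>compound d rate R) = (\<integral>k. (\<integral>x. f x \<partial>conv_pow d R k) \<partial>measure_pmf (poisson_pmf rate))"
    if f: "f \<in> borel_measurable (vecs d)" and b: "\<And>x. \<bar>f x\<bar> \<le> 1 + vnorm d x ^ 3" for f :: "(nat \<Rightarrow> real) \<Rightarrow> real"
  proof (rule compound_integral(3)[OF lR f])
    fix k
    show ik: "integrable (conv_pow d R k) f"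
      by (rule cube_law_integrable[OF K(1) f, of 1]) (use b in simp)
  next
    have ib: "integrable (measure_pmf (poisson_pmf rate)) (\<lambda>k. 1 + 4 / 3 * (4 ^ k - 1) * abs_cube d R)"
      using poisson_integral_power_real(1)[OF r, of 4] by simp
    have le: "(\<integral>x. norm (f x) \<partial>conv_pow d R k) \<le> 1 + 4 / 3 * (4 ^ k - 1) * abs_cube d R" for k
    proof -
      interpret K: prob_space "conv_pow d R k" using K(1)[of k] by (simp add: law_def cube_law_def)
      have i3: "integrable (conv_pow d R k) (\<lambda>x. vnorm d x ^ 3)" using K(1)[of k] by (simp add: cube_law_def)
      have "(\<integral>x. norm (f x) \<partial>conv_pow d R k) \<le> (\<integral>x. 1 + vnorm d x ^ 3 \<partial>conv_pow d R k)"
        by (rule integral_mono) (use b i3 cube_law_integrable[OF K(1) f, of 1 k] in \<open>auto intro!: integrable_norm\<close>)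
      also have "\<dots> = 1 + abs_cube d (conv_pow d R k)" using i3 by (simp add: K.prob_space abs_cube_def)
      finally show ?thesis using K(2)[of k] by linarith
    qed
    show "integrable (measure_pmf (poisson_pmf rate)) (\<lambda>k. \<integral>x. norm (f x) \<partial>conv_pow d R k)"
    proof (rule Bochner_Integration.integrable_bound[OF ib])
      have "norm (\<integral>x. norm (f x) \<partial>conv_pow d R k) \<le> norm (1 + 4 / 3 * (4 ^ k - 1) * abs_cube d R)" for k
      proof -
        have "0 \<le> (\<integral>x. norm (f x) \<partial>conv_pow d R k)" by (rule Bochner_Integration.integral_nonneg) simp
        then show ?thesis using le[of k] unfolding real_norm_def by linarith
      qed
      then show "AE k in measure_pmf (poisson_pmf rate). norm (\<integral>x. norm (f x) \<partial>conv_pow d R k)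
          \<le> norm (1 + 4 / 3 * (4 ^ k - 1) * abs_cube d R)" by (intro AE_I2)
    qed simp
  qed
  show "(\<integral>x. x i \<partial>compound d rate R) = 0" if i: "i < d"
  proof -
    have "\<bar>x i\<bar> \<le> 1 + vnorm d x ^ 3" for x
      using abs_component_le_vnorm[OF i, of x] power_le_1_cube(1)[OF L2_set_nonneg[of x "{..<d}"]] by simp
    then show ?thesis using i by (subst gen) (auto simp: conv_pow_moments(1)[OF R m])
  qed
  show "(\<integral>x. x i * x j \<partial>compound d rate R) = rate * (\<integral>x. x i * x j \<partial>R)" if i: "i < d" and j: "j < d"
  proof -
    have "\<bar>x i * x j\<bar> \<le> 1 + vnorm d x ^ 3" for x
    proof -
      have "\<bar>x i * x j\<bar> \<le> (vnorm d x)\<^sup>2"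
        unfolding abs_mult power2_eq_square by (intro mult_mono abs_component_le_vnorm i j) (auto simp: L2_set_nonneg)
      then show ?thesis using power_le_1_cube(2)[OF L2_set_nonneg[of x "{..<d}"]] by simp
    qed
    then have "(\<integral>x. x i * x j \<partial>compound d rate R) = (\<integral>k. (\<integral>x. x i * x j \<partial>conv_pow d R k) \<partial>measure_pmf (poisson_pmf rate))"
      using i j by (intro gen) auto
    also have "\<dots> = (\<integral>k. real k * (\<integral>x. x i * x j \<partial>R) \<partial>measure_pmf (poisson_pmf rate))"
      by (simp only: conv_pow_moments(2)[OF R m i j])
    also have "\<dots> = rate * (\<integral>x. x i * x j \<partial>R)" using poisson_integral_id[OF r] by simp
    finally show ?thesis .
  qed
qed

subsection \<open>Poisson integrals\<close>

text \<open>The Poisson weights already sum to 1 over the finite values, so the value \<infinity>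
  has probability 0. The characteristic function is the limit of the integrals over Y < n, which are
  the partial sums of the Poisson series.\<close>

lemma poisson_count_char:
  assumes M: "prob_space M" and Y[measurable]: "Y \<in> borel_measurable M"
    and p: "\<And>k::nat. measure M {\<omega>\<in>space M. Y \<omega> = of_nat k} = r ^ k / fact k * exp (- r)"
  shows "AE \<omega> in M. (Y \<omega> :: ennreal) < \<infinity>"
    and "(\<integral>\<omega>. iexp (c * enn2real (Y \<omega>)) \<partial>M) = exp (of_real r * (iexp c - 1))"
proof -
  interpret prob_space M by fact
  define E where "E k = {\<omega>\<in>space M. Y \<omega> = of_nat k}" for k :: nat
  have Em[measurable]: "E k \<in> sets M" for k unfolding E_def by measurable
  have disj: "disjoint_family E" by (auto simp: disjoint_family_on_def E_def)
  have "(\<lambda>k. prob (E k)) sums prob (\<Union>k. E k)" using Em disj by (intro finite_measure_UNION) auto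
  moreover have "(\<lambda>k. prob (E k)) sums 1"
  proof -
    have "(\<lambda>k. exp (- r) * (r ^ k /\<^sub>R fact k)) sums (exp (- r) * exp r)" by (intro sums_mult exp_converges)
    moreover have "exp (- r) * (r ^ k /\<^sub>R fact k) = prob (E k)" for k
      unfolding E_def p by (simp add: field_simps)
    ultimately show ?thesis by (simp flip: exp_add)
  qed
  ultimately have "prob (\<Union>k. E k) = 1" by (rule sums_unique2)
  then have AEE: "AE \<omega> in M. \<omega> \<in> (\<Union>k. E k)" by (rule AE_prob_1)
  then show "AE \<omega> in M. Y \<omega> < \<infinity>"
    by eventually_elim (auto simp: E_def less_top[symmetric])
  let ?f = "\<lambda>\<omega>. iexp (c * enn2real (Y \<omega>))"
  define S where "S n \<omega> = (\<Sum>k<n. indicator (E k) \<omega> *\<^sub>R (iexp c) ^ k)" for n \<omega>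
  have Sm: "S n \<in> borel_measurable M" for n
    unfolding S_def[abs_def] by measurable
  have iexpk: "iexp (c * real k) = (iexp c) ^ k" for k
    by (simp add: exp_of_nat_mult[symmetric] mult_ac)
  have SE: "S n \<omega> = (if k < n then iexp c ^ k else 0)" if "\<omega> \<in> E k" for n \<omega> k
  proof -
    have "indicator (E j) \<omega> = (if j = k then 1 else 0 :: real)" for j
      using that disj by (auto simp: indicator_def disjoint_family_on_def)
    then have "S n \<omega> = (\<Sum>j<n. if j = k then iexp c ^ j else 0)" unfolding S_def by (intro sum.cong) auto
    then show ?thesis by simp
  qed
  have a: "(\<lambda>n. \<integral>\<omega>. S n \<omega> \<partial>M) \<longlonglongrightarrow> (\<integral>\<omega>. ?f \<omega> \<partial>M)"
  proof (rule integral_dominated_convergence[where w = "\<lambda>_. 1"])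
    show "AE \<omega> in M. (\<lambda>n. S n \<omega>) \<longlonglongrightarrow> ?f \<omega>" using AEE
    proof eventually_elim
      case (elim \<omega>)
      then obtain k where k: "\<omega> \<in> E k" by auto
      then have "?f \<omega> = iexp c ^ k" unfolding iexpk[symmetric] by (auto simp: E_def)
      then have "\<forall>\<^sub>F n in sequentially. S n \<omega> = ?f \<omega>"
        unfolding SE[OF k] by (auto intro: eventually_sequentiallyI[of "Suc k"])
      then show ?case by (rule tendsto_eventually)
    qed
    show "AE \<omega> in M. norm (S n \<omega>) \<le> 1" for n using AEE
    proof eventually_elim
      case (elim \<omega>)
      then obtain k where k: "\<omega> \<in> E k" by auto
      then show ?case unfolding SE[OF k] by (simp add: norm_power)
    qed
  qed (use Sm in auto)
  have b: "(\<integral>\<omega>. S n \<omega> \<partial>M) = (\<Sum>k<n. (r ^ k / fact k * exp (- r)) *\<^sub>R iexp c ^ k)" for n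
  proof -
    have "(\<integral>\<omega>. S n \<omega> \<partial>M) = (\<Sum>k<n. \<integral>\<omega>. indicator (E k) \<omega> *\<^sub>R iexp c ^ k \<partial>M)"
      unfolding S_def by (rule Bochner_Integration.integral_sum) (auto intro!: integrable_scaleR_left simp: emeasure_eq_measure)
    also have "\<dots> = (\<Sum>k<n. prob (E k) *\<^sub>R iexp c ^ k)"
      by (intro sum.cong refl) (subst integral_scaleR_left, auto simp: emeasure_eq_measure)
    finally show ?thesis unfolding E_def p .
  qed
  have c: "(\<lambda>n. \<Sum>k<n. (r ^ k / fact k * exp (- r)) *\<^sub>R iexp c ^ k) \<longlonglongrightarrow> exp (of_real r * (iexp c - 1))"
    using poisson_series_complex[of r "iexp c"] by (simp add: sums_def)
  show "(\<integral>\<omega>. ?f \<omega> \<partial>M) = exp (of_real r * (iexp c - 1))"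
    using LIMSEQ_unique[OF a[unfolded b] c] .
qed

section \<open>Integrals against a Poisson random measure\<close>

text \<open>Measurability in \<omega> is given for the mass of sets only; it passes to integrals by
  induction over simple functions and monotone limits.\<close>

lemma kernel_nn_integral_measurable:
  assumes s: "\<And>\<omega>. \<omega> \<in> space M \<Longrightarrow> sets (N \<omega>) = sets \<Lambda>"
    and e: "\<And>A. A \<in> sets \<Lambda> \<Longrightarrow> (\<lambda>\<omega>. emeasure (N \<omega>) A) \<in> borel_measurable M"
    and f: "f \<in> borel_measurable \<Lambda>"
  shows "(\<lambda>\<omega>. \<integral>\<^sup>+\<xi>. f \<xi> \<partial>N \<omega>) \<in> borel_measurable M"
proof -
  have m: "g \<in> borel_measurable (N \<omega>)" if "\<omega> \<in> space M" "g \<in> borel_measurable \<Lambda>" for g :: "_ \<Rightarrow> ennreal" and \<omega>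
    using that by (simp cong: measurable_cong_sets add: s)
  have sp: "space (N \<omega>) = space \<Lambda>" if "\<omega> \<in> space M" for \<omega> using s[OF that] by (rule sets_eq_imp_space_eq)
  from f show ?thesis
  proof (induction rule: borel_measurable_induct)
    case (cong f g)
    have eq: "(\<integral>\<^sup>+\<xi>. f \<xi> \<partial>N \<omega>) = (\<integral>\<^sup>+\<xi>. g \<xi> \<partial>N \<omega>)" if "\<omega> \<in> space M" for \<omega>
      by (rule nn_integral_cong) (use cong sp[OF that] in auto)
    from cong show ?case by (simp only: measurable_cong[OF eq])
  next
    case (set A)
    have eq: "(\<integral>\<^sup>+\<xi>. indicator A \<xi> \<partial>N \<omega>) = emeasure (N \<omega>) A" if "\<omega> \<in> space M" for \<omega>
      using set s[OF that] by simp
    from e[OF set] show ?case by (simp only: measurable_cong[OF eq])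
  next
    case (mult u c)
    have eq: "(\<integral>\<^sup>+\<xi>. c * u \<xi> \<partial>N \<omega>) = c * (\<integral>\<^sup>+\<xi>. u \<xi> \<partial>N \<omega>)" if "\<omega> \<in> space M" for \<omega>
      using m[OF that mult(2)] by (rule nn_integral_cmult)
    have "(\<lambda>\<omega>. c * (\<integral>\<^sup>+\<xi>. u \<xi> \<partial>N \<omega>)) \<in> borel_measurable M"
      using mult by (intro borel_measurable_times_ennreal) simp_all
    then show ?case by (simp only: measurable_cong[OF eq])
  next
    case (add u v)
    have eq: "(\<integral>\<^sup>+\<xi>. v \<xi> + u \<xi> \<partial>N \<omega>) = (\<integral>\<^sup>+\<xi>. v \<xi> \<partial>N \<omega>) + (\<integral>\<^sup>+\<xi>. u \<xi> \<partial>N \<omega>)" if "\<omega> \<in> space M" for \<omega>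
      by (rule nn_integral_add)
         (rule m[OF that \<open>v \<in> borel_measurable \<Lambda>\<close>], rule m[OF that \<open>u \<in> borel_measurable \<Lambda>\<close>])
    have "(\<lambda>\<omega>. (\<integral>\<^sup>+\<xi>. v \<xi> \<partial>N \<omega>) + (\<integral>\<^sup>+\<xi>. u \<xi> \<partial>N \<omega>)) \<in> borel_measurable M"
      using add by (intro borel_measurable_add) simp_all
    then show ?case by (simp only: measurable_cong[OF eq])
  next
    case (seq U)
    have eq: "(\<integral>\<^sup>+\<xi>. (SUP i. U i) \<xi> \<partial>N \<omega>) = (SUP i. \<integral>\<^sup>+\<xi>. U i \<xi> \<partial>N \<omega>)" if "\<omega> \<in> space M" for \<omega>
      unfolding SUP_apply
      by (rule nn_integral_monotone_convergence_SUP[OF \<open>incseq U\<close>])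
         (rule m[OF that \<open>\<And>i. U i \<in> borel_measurable \<Lambda>\<close>])
    have "(\<lambda>\<omega>. SUP i. \<integral>\<^sup>+\<xi>. U i \<xi> \<partial>N \<omega>) \<in> borel_measurable M"
      using seq by (intro borel_measurable_SUP) simp_all
    then show ?case by (simp only: measurable_cong[OF eq])
  qed
qed

lemma kernel_integral_measurable:
  fixes g :: "'e \<Rightarrow> real"
  assumes s: "\<And>\<omega>. \<omega> \<in> space M \<Longrightarrow> sets (N \<omega>) = sets \<Lambda>"
    and e: "\<And>A. A \<in> sets \<Lambda> \<Longrightarrow> (\<lambda>\<omega>. emeasure (N \<omega>) A) \<in> borel_measurable M"
    and g[measurable]: "g \<in> borel_measurable \<Lambda>"
  shows "(\<lambda>\<omega>. \<integral>\<xi>. g \<xi> \<partial>N \<omega>) \<in> borel_measurable M"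
proof -
  note k = kernel_nn_integral_measurable[OF s e]
  have k1: "(\<lambda>\<omega>. \<integral>\<^sup>+\<xi>. ennreal (g \<xi>) \<partial>N \<omega>) \<in> borel_measurable M"
    and k2: "(\<lambda>\<omega>. \<integral>\<^sup>+\<xi>. ennreal (- g \<xi>) \<partial>N \<omega>) \<in> borel_measurable M"
    and k3: "(\<lambda>\<omega>. \<integral>\<^sup>+\<xi>. ennreal (norm (g \<xi>)) \<partial>N \<omega>) \<in> borel_measurable M"
    by (auto intro!: k)
  \<comment> \<open>A Bochner integral that does not exist has value 0. The case distinction makes
    the formula valid at every \<omega>, including those where g is not integrable.\<close>
  have eq: "(\<integral>\<xi>. g \<xi> \<partial>N \<omega>) = (if (\<integral>\<^sup>+\<xi>. ennreal (norm (g \<xi>)) \<partial>N \<omega>) < \<infinity>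
      then enn2real (\<integral>\<^sup>+\<xi>. ennreal (g \<xi>) \<partial>N \<omega>) - enn2real (\<integral>\<^sup>+\<xi>. ennreal (- g \<xi>) \<partial>N \<omega>) else 0)"
    if "\<omega> \<in> space M" for \<omega>
  proof -
    have "g \<in> borel_measurable (N \<omega>)" using g by (simp cong: measurable_cong_sets add: s[OF that])
    then have "integrable (N \<omega>) g \<longleftrightarrow> (\<integral>\<^sup>+\<xi>. ennreal (norm (g \<xi>)) \<partial>N \<omega>) < \<infinity>" by (simp add: integrable_iff_bounded)
    then show ?thesis by (auto simp: real_lebesgue_integral_def not_integrable_integral_eq)
  qed
  have "(\<lambda>\<omega>. if u \<omega> < \<infinity> then enn2real (v \<omega>) - enn2real (w \<omega>) else 0 :: real) \<in> borel_measurable M"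
    if [measurable]: "u \<in> borel_measurable M" "v \<in> borel_measurable M" "w \<in> borel_measurable M" for u v w :: "_ \<Rightarrow> ennreal"
    by measurable
  from this[OF k3 k1 k2] have "(\<lambda>\<omega>. if (\<integral>\<^sup>+\<xi>. ennreal (norm (g \<xi>)) \<partial>N \<omega>) < \<infinity>
      then enn2real (\<integral>\<^sup>+\<xi>. ennreal (g \<xi>) \<partial>N \<omega>) - enn2real (\<integral>\<^sup>+\<xi>. ennreal (- g \<xi>) \<partial>N \<omega>) else 0) \<in> borel_measurable M" .
  then show ?thesis by (simp only: measurable_cong[OF eq])
qed

text \<open>Campbell's exponential formula. The integrand g is approximated by step functions
  \<open>G\<close> on the level sets of floor (n g). Counts on these disjoint cells are independent
  Poisson variables, so the formula for \<open>G\<close> is a finite product of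
  \<open>poisson_count_char\<close>; dominated convergence passes to g on both sides.\<close>

lemma poisson_integral_char:
  fixes g :: "'e \<Rightarrow> real"
  assumes M: "prob_space M" and N: "poisson_random_measure M \<Lambda> N"
    and fin: "finite_measure \<Lambda>"
    and g[measurable]: "g \<in> borel_measurable \<Lambda>" and b: "\<And>\<xi>. \<xi> \<in> space \<Lambda> \<Longrightarrow> \<bar>g \<xi>\<bar> \<le> B"
  shows "AE \<omega> in M. finite_measure (N \<omega>)"
    and "(\<lambda>\<omega>. \<integral>\<xi>. g \<xi> \<partial>N \<omega>) \<in> borel_measurable M"
    and "(\<integral>\<omega>. iexp (\<integral>\<xi>. g \<xi> \<partial>N \<omega>) \<partial>M) = exp (\<integral>\<xi>. iexp (g \<xi>) - 1 \<partial>\<Lambda>)"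
proof -
  interpret prob_space M by fact
  interpret L: finite_measure \<Lambda> by fact
  have s: "\<And>\<omega>. \<omega> \<in> space M \<Longrightarrow> sets (N \<omega>) = sets \<Lambda>"
    and e: "\<And>A. A \<in> sets \<Lambda> \<Longrightarrow> (\<lambda>\<omega>. emeasure (N \<omega>) A) \<in> borel_measurable M"
    and p: "\<And>A k::nat. A \<in> sets \<Lambda> \<Longrightarrow> measure M {\<omega>\<in>space M. emeasure (N \<omega>) A = of_nat k}
           = measure \<Lambda> A ^ k / fact k * exp (- measure \<Lambda> A)"
    and ind: "\<And>(A :: nat \<Rightarrow> 'e set) n. (\<And>i. i < n \<Longrightarrow> A i \<in> sets \<Lambda>) \<Longrightarrow> disjoint_family_on A {..<n} \<Longrightarrow>
        indep_vars (\<lambda>_. borel) (\<lambda>i \<omega>. emeasure (N \<omega>) (A i)) {..<n}"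
    using N L.emeasure_finite unfolding poisson_random_measure_def by (auto simp: less_top[symmetric])
  note pc = poisson_count_char[OF M e p]
  have fs: "AE \<omega> in M. finite_measure (N \<omega>)"
    using pc(1)[OF sets.top sets.top] AE_space
  proof eventually_elim
    case (elim \<omega>)
    then show ?case using sets_eq_imp_space_eq[OF s[of \<omega>]] by (intro finite_measureI) (auto simp: less_top)
  qed
  then show "AE \<omega> in M. finite_measure (N \<omega>)" .
  show gm[measurable]: "(\<lambda>\<omega>. \<integral>\<xi>. g \<xi> \<partial>N \<omega>) \<in> borel_measurable M" by (rule kernel_integral_measurable[OF s e g])
  \<comment> \<open>\<open>L0\<close> bounds |n g| with one unit to spare, so the floor lies between
    -L0 and L0, and shifting by L0 indexes the cells by natural numbers.\<close>
  define L0 where "L0 n = nat \<lceil>real n * \<bar>B\<bar>\<rceil> + 1" for n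
  define A where "A n j = {\<xi>\<in>space \<Lambda>. \<lfloor>real n * g \<xi>\<rfloor> = int j - int (L0 n)}" for n j :: nat
  define c where "c n j = (real j - real (L0 n)) / real n" for n j :: nat
  define J where "J n = {..<2 * L0 n + 1}" for n
  have Am[measurable]: "A n j \<in> sets \<Lambda>" for n j unfolding A_def by measurable
  have Aj: "\<exists>j\<in>J n. \<xi> \<in> A n j" if "\<xi> \<in> space \<Lambda>" for n \<xi>
  proof -
    have "\<bar>real n * g \<xi>\<bar> \<le> real n * \<bar>B\<bar>" unfolding abs_mult using b[OF that] by (intro mult_mono) auto
    also have "\<dots> \<le> real (L0 n) - 1" unfolding L0_def using real_nat_ceiling_ge[of "real n * \<bar>B\<bar>"] by simp
    finally have "\<bar>real n * g \<xi>\<bar> \<le> real (L0 n) - 1" .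
    then have "- int (L0 n) \<le> \<lfloor>real n * g \<xi>\<rfloor>" "\<lfloor>real n * g \<xi>\<rfloor> \<le> int (L0 n)" by (auto simp: le_floor_iff floor_le_iff)
    then show ?thesis using that by (intro bexI[of _ "nat (\<lfloor>real n * g \<xi>\<rfloor> + int (L0 n))"]) (auto simp: A_def J_def)
  qed
  have Adisj: "disjoint_family_on (A n) (J n)" for n by (auto simp: disjoint_family_on_def A_def)
  define G where "G n \<xi> = (\<Sum>j\<in>J n. c n j * indicator (A n j) \<xi>)" for n \<xi>
  have GA: "(\<Sum>j\<in>J n. h j * indicator (A n j) \<xi>) = h k" if "\<xi> \<in> A n k" "k \<in> J n" for n \<xi> k and h :: "nat \<Rightarrow> 'z::real_algebra_1"
  proof -
    have "(\<Sum>j\<in>J n. h j * indicator (A n j) \<xi>) = (\<Sum>j\<in>J n. if j = k then h j else 0)"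
      by (intro sum.cong refl) (use that in \<open>auto simp: A_def indicator_def\<close>)
    then show ?thesis using that by (simp add: J_def)
  qed
  have Gd: "\<bar>G n \<xi> - g \<xi>\<bar> \<le> 1 / real n" if \<xi>: "\<xi> \<in> space \<Lambda>" and n: "n > 0" for n \<xi>
  proof -
    obtain k where k: "k \<in> J n" "\<xi> \<in> A n k" using Aj[OF \<xi>] by blast
    have "G n \<xi> = c n k" unfolding G_def using GA[OF k(2,1)] .
    moreover have "real_of_int \<lfloor>real n * g \<xi>\<rfloor> = real k - real (L0 n)" using k(2) by (simp add: A_def)
    then have "\<bar>(real k - real (L0 n)) - real n * g \<xi>\<bar> \<le> 1" using floor_correct[of "real n * g \<xi>"] by linarith
    moreover have "c n k - g \<xi> = ((real k - real (L0 n)) - real n * g \<xi>) / real n" using n by (simp add: c_def field_simps)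
    ultimately show ?thesis using n by (simp add: abs_divide divide_right_mono)
  qed
  have Gm: "G n \<in> borel_measurable \<Lambda>" for n unfolding G_def by measurable
  have Glim: "(\<lambda>n. G n \<xi>) \<longlonglongrightarrow> g \<xi>" if "\<xi> \<in> space \<Lambda>" for \<xi>
  proof -
    have "(\<lambda>n. G n \<xi> - g \<xi>) \<longlonglongrightarrow> 0"
      by (rule Lim_null_comparison[OF _ lim_1_over_n])
         (use Gd[OF that] in \<open>auto intro!: eventually_sequentiallyI[of 1]\<close>)
    then show ?thesis by (rule LIM_zero_cancel)
  qed
  have Gb: "\<bar>G n \<xi>\<bar> \<le> B + 1" if "\<xi> \<in> space \<Lambda>" "n > 0" for n \<xi>
  proof -
    have "1 / real n \<le> 1" using that(2) by simp
    then show ?thesis using Gd[OF that] b[OF that(1)] by linarith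
  qed
  define X where "X n \<omega> = (\<Sum>j\<in>J n. c n j * enn2real (emeasure (N \<omega>) (A n j)))" for n \<omega>
  have Xm: "X n \<in> borel_measurable M" for n unfolding X_def using e[OF Am] by measurable
  have X: "AE \<omega> in M. \<forall>n. X n \<omega> = (\<integral>\<xi>. G n \<xi> \<partial>N \<omega>)" using fs AE_space
  proof eventually_elim
    case (elim \<omega>)
    interpret F: finite_measure "N \<omega>" by fact
    have "A n j \<in> sets (N \<omega>)" for n j using s[OF elim(2)] by simp
    then show ?case
      unfolding X_def G_def by (subst Bochner_Integration.integral_sum) (auto simp: measure_def intro!: integrable_mult_right F.integrable_const_bound[of _ 1])
  qed
  have Xlim: "AE \<omega> in M. (\<lambda>n. X n \<omega>) \<longlonglongrightarrow> (\<integral>\<xi>. g \<xi> \<partial>N \<omega>)" using X fs AE_space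
  proof eventually_elim
    case (elim \<omega>)
    interpret F: finite_measure "N \<omega>" by fact
    have sp: "space (N \<omega>) = space \<Lambda>" using s[OF elim(3)] by (rule sets_eq_imp_space_eq)
    \<comment> \<open>The index starts at 1, because the bound B + 1 rests on 1 / n \<le> 1 for n >
      0.\<close>
    have "(\<lambda>n. \<integral>\<xi>. G (Suc n) \<xi> \<partial>N \<omega>) \<longlonglongrightarrow> (\<integral>\<xi>. g \<xi> \<partial>N \<omega>)"
    proof (rule integral_dominated_convergence[where w = "\<lambda>_. B + 1"])
      show "g \<in> borel_measurable (N \<omega>)" "\<And>i. G (Suc i) \<in> borel_measurable (N \<omega>)"
        using g Gm by (auto cong: measurable_cong_sets simp: s[OF elim(3)])
      show "AE x in N \<omega>. (\<lambda>i. G (Suc i) x) \<longlonglongrightarrow> g x" using Glim sp by (auto intro!: AE_I2 LIMSEQ_Suc)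
      show "AE x in N \<omega>. norm (G (Suc i) x) \<le> B + 1" for i using Gb sp by (auto intro!: AE_I2)
    qed simp
    then have "(\<lambda>n. \<integral>\<xi>. G n \<xi> \<partial>N \<omega>) \<longlonglongrightarrow> (\<integral>\<xi>. g \<xi> \<partial>N \<omega>)"
      by (rule filterlim_sequentially_Suc[THEN iffD1])
    then show ?case using elim(1) by simp
  qed
  have Xc: "(\<integral>\<omega>. iexp (X n \<omega>) \<partial>M) = exp (\<integral>\<xi>. iexp (G n \<xi>) - 1 \<partial>\<Lambda>)" for n
  proof -
    have "indep_vars (\<lambda>_. borel) (\<lambda>j \<omega>. emeasure (N \<omega>) (A n j)) (J n)"
      unfolding J_def by (rule ind) (use Adisj[of n] in \<open>auto simp: J_def\<close>)
    then have "indep_vars (\<lambda>_. borel) (\<lambda>j. (\<lambda>y. c n j * enn2real y) \<circ> (\<lambda>\<omega>. emeasure (N \<omega>) (A n j))) (J n)"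
      by (rule indep_vars_compose) simp
    then have iv: "indep_vars (\<lambda>_. borel) (\<lambda>j \<omega>. c n j * enn2real (emeasure (N \<omega>) (A n j))) (J n)" by (simp add: comp_def)
    have "(\<integral>\<omega>. iexp (X n \<omega>) \<partial>M) = char (distr M borel (X n)) 1"
      unfolding char_def by (subst integral_distr[OF Xm]) auto
    also have "\<dots> = (\<Prod>j\<in>J n. char (distr M borel (\<lambda>\<omega>. c n j * enn2real (emeasure (N \<omega>) (A n j)))) 1)"
      unfolding X_def by (rule char_distr_sum[OF iv])
    also have "\<dots> = (\<Prod>j\<in>J n. exp (of_real (measure \<Lambda> (A n j)) * (iexp (c n j) - 1)))"
    proof (rule prod.cong[OF refl])
      fix j
      have "char (distr M borel (\<lambda>\<omega>. c n j * enn2real (emeasure (N \<omega>) (A n j)))) 1 = (\<integral>\<omega>. iexp (c n j * enn2real (emeasure (N \<omega>) (A n j))) \<partial>M)"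
        unfolding char_def using e[OF Am] by (subst integral_distr) auto
      then show "char (distr M borel (\<lambda>\<omega>. c n j * enn2real (emeasure (N \<omega>) (A n j)))) 1 = exp (of_real (measure \<Lambda> (A n j)) * (iexp (c n j) - 1))"
        using pc(2)[OF Am Am] by simp
    qed
    also have "\<dots> = exp (\<Sum>j\<in>J n. of_real (measure \<Lambda> (A n j)) * (iexp (c n j) - 1))"
      by (rule exp_sum[symmetric]) (simp add: J_def)
    also have "(\<Sum>j\<in>J n. of_real (measure \<Lambda> (A n j)) * (iexp (c n j) - 1)) = (\<integral>\<xi>. (\<Sum>j\<in>J n. indicator (A n j) \<xi> *\<^sub>R (iexp (c n j) - 1)) \<partial>\<Lambda>)"
      by (subst Bochner_Integration.integral_sum)
         (auto simp: scaleR_conv_of_real L.emeasure_finite less_top[symmetric] intro!: integrable_scaleR_left)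
    also have "\<dots> = (\<integral>\<xi>. iexp (G n \<xi>) - 1 \<partial>\<Lambda>)"
    proof (rule Bochner_Integration.integral_cong[OF refl])
      fix \<xi> assume "\<xi> \<in> space \<Lambda>"
      then obtain k where k: "k \<in> J n" "\<xi> \<in> A n k" using Aj by blast
      have "(\<Sum>j\<in>J n. indicator (A n j) \<xi> *\<^sub>R (iexp (c n j) - 1)) = (\<Sum>j\<in>J n. (iexp (c n j) - 1) * indicator (A n j) \<xi>)"
        by (intro sum.cong refl) (simp add: indicator_def)
      also have "\<dots> = iexp (c n k) - 1" by (rule GA[OF k(2,1)])
      also have "c n k = G n \<xi>" unfolding G_def using GA[OF k(2,1), symmetric] .
      finally show "(\<Sum>j\<in>J n. indicator (A n j) \<xi> *\<^sub>R (iexp (c n j) - 1)) = iexp (G n \<xi>) - 1" .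
    qed
    finally show ?thesis .
  qed
  have l1: "(\<lambda>n. \<integral>\<omega>. iexp (X n \<omega>) \<partial>M) \<longlonglongrightarrow> (\<integral>\<omega>. iexp (\<integral>\<xi>. g \<xi> \<partial>N \<omega>) \<partial>M)"
  proof (rule integral_dominated_convergence[where w = "\<lambda>_. 1"])
    show "AE \<omega> in M. (\<lambda>n. iexp (X n \<omega>)) \<longlonglongrightarrow> iexp (\<integral>\<xi>. g \<xi> \<partial>N \<omega>)" using Xlim
      by eventually_elim (intro tendsto_intros)
  qed (use Xm gm in auto)
  have l2: "(\<lambda>n. \<integral>\<xi>. iexp (G n \<xi>) - 1 \<partial>\<Lambda>) \<longlonglongrightarrow> (\<integral>\<xi>. iexp (g \<xi>) - 1 \<partial>\<Lambda>)"
  proof (rule integral_dominated_convergence[where w = "\<lambda>_. 2"])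
    show "AE \<xi> in \<Lambda>. (\<lambda>n. iexp (G n \<xi>) - 1) \<longlonglongrightarrow> iexp (g \<xi>) - 1"
      by (rule AE_I2) (intro tendsto_intros Glim)
    show "AE \<xi> in \<Lambda>. norm (iexp (G n \<xi>) - 1) \<le> 2" for n
      by (rule AE_I2) (rule order_trans[OF norm_triangle_ineq4], simp)
  qed (use Gm in auto)
  have "(\<lambda>n. exp (\<integral>\<xi>. iexp (G n \<xi>) - 1 \<partial>\<Lambda>)) \<longlonglongrightarrow> exp (\<integral>\<xi>. iexp (g \<xi>) - 1 \<partial>\<Lambda>)"
    by (intro tendsto_intros l2)
  with l1 show "(\<integral>\<omega>. iexp (\<integral>\<xi>. g \<xi> \<partial>N \<omega>) \<partial>M) = exp (\<integral>\<xi>. iexp (g \<xi>) - 1 \<partial>\<Lambda>)"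
    unfolding Xc by (rule LIMSEQ_unique)
qed

subsection \<open>Gaussian vectors and the comparison\<close>

text \<open>A constant with mean 0 is 0, which fits all the formulas with variance 0. Otherwise the
  third absolute moment is 2 sqrt (2 / \<pi>) \<sigma>^3, of which only 2 \<sigma>^3 is
  kept.\<close>

lemma univariate_normal_centred:
  assumes M: "prob_space M" and n: "univariate_normal M Y" and m: "(\<integral>\<omega>. Y \<omega> \<partial>M) = 0"
  shows "Y \<in> borel_measurable M"
    and "integrable M Y"
    and "integrable M (\<lambda>\<omega>. (Y \<omega>)\<^sup>2)"
    and "integrable M (\<lambda>\<omega>. \<bar>Y \<omega>\<bar> ^ 3)"
    and "(\<integral>\<omega>. \<bar>Y \<omega>\<bar> ^ 3 \<partial>M) \<le> 2 * sqrt (\<integral>\<omega>. (Y \<omega>)\<^sup>2 \<partial>M) ^ 3"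
    and "(\<integral>\<omega>. iexp (Y \<omega>) \<partial>M) = of_real (exp (- (\<integral>\<omega>. (Y \<omega>)\<^sup>2 \<partial>M) / 2))"
proof -
  interpret prob_space M by fact
  have "Y \<in> borel_measurable M \<and> integrable M Y \<and> integrable M (\<lambda>\<omega>. (Y \<omega>)\<^sup>2) \<and> integrable M (\<lambda>\<omega>. \<bar>Y \<omega>\<bar> ^ 3)
    \<and> (\<integral>\<omega>. \<bar>Y \<omega>\<bar> ^ 3 \<partial>M) \<le> 2 * sqrt (\<integral>\<omega>. (Y \<omega>)\<^sup>2 \<partial>M) ^ 3
    \<and> (\<integral>\<omega>. iexp (Y \<omega>) \<partial>M) = of_real (exp (- (\<integral>\<omega>. (Y \<omega>)\<^sup>2 \<partial>M) / 2))"
    using n unfolding univariate_normal_def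
  proof (elim disjE conjE exE)
    fix c assume c: "AE \<omega> in M. Y \<omega> = c" and Y[measurable]: "Y \<in> borel_measurable M"
    have "(\<integral>\<omega>. Y \<omega> \<partial>M) = (\<integral>\<omega>. c \<partial>M)" using c by (intro integral_cong_AE) auto
    then have "c = 0" using m by (simp add: prob_space)
    then have Y0: "AE \<omega> in M. Y \<omega> = 0" using c by simp
    have i: "integrable M Y \<longleftrightarrow> integrable M (\<lambda>_. 0 :: real)" using Y0 by (intro integrable_cong_AE) auto
    have i2: "integrable M (\<lambda>\<omega>. (Y \<omega>)\<^sup>2) \<longleftrightarrow> integrable M (\<lambda>_. 0 :: real)" using Y0 by (intro integrable_cong_AE) auto
    have i3: "integrable M (\<lambda>\<omega>. \<bar>Y \<omega>\<bar> ^ 3) \<longleftrightarrow> integrable M (\<lambda>_. 0 :: real)" using Y0 by (intro integrable_cong_AE) auto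
    have e2: "(\<integral>\<omega>. (Y \<omega>)\<^sup>2 \<partial>M) = (\<integral>\<omega>. 0 \<partial>M)" using Y0 by (intro integral_cong_AE) auto
    have e3: "(\<integral>\<omega>. \<bar>Y \<omega>\<bar> ^ 3 \<partial>M) = (\<integral>\<omega>. 0 \<partial>M)" using Y0 by (intro integral_cong_AE) auto
    have e4: "(\<integral>\<omega>. iexp (Y \<omega>) \<partial>M) = (\<integral>\<omega>. 1 \<partial>M)" using Y0 by (intro integral_cong_AE) auto
    show ?thesis using i i2 i3 Y unfolding e2 e3 e4 by (simp add: prob_space)
  next
    fix \<mu> \<sigma> :: real assume s: "\<sigma> > 0" and D: "distributed M lborel Y (normal_density \<mu> \<sigma>)"
    have Y[measurable]: "Y \<in> borel_measurable M" using distributed_measurable[OF D] by simp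
    have mu: "\<mu> = 0" using normal_distributed_expectation[OF s D] m by simp
    note D0 = D[unfolded mu]
    have v: "(\<integral>\<omega>. (Y \<omega>)\<^sup>2 \<partial>M) = \<sigma>\<^sup>2" using normal_distributed_variance[OF s D] m by simp
    have int: "integrable lborel (\<lambda>x. normal_density 0 \<sigma> x * g x) \<longleftrightarrow> integrable M (\<lambda>\<omega>. g (Y \<omega>))"
      if "g \<in> borel_measurable borel" for g :: "real \<Rightarrow> real"
      by (rule distributed_integrable[OF D0]) (use that in auto)
    have I1: "integrable M Y"
      using integrable_normal_moment[OF s, of 0 1] int[of "\<lambda>x. x"] by simp
    have I2: "integrable M (\<lambda>\<omega>. (Y \<omega>)\<^sup>2)"
      using integrable_normal_moment[OF s, of 0 2] int[of "\<lambda>x. x\<^sup>2"] by simp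
    have I3: "integrable M (\<lambda>\<omega>. \<bar>Y \<omega>\<bar> ^ 3)"
      using integrable_normal_moment_abs[OF s, of 0 3] int[of "\<lambda>x. \<bar>x\<bar> ^ 3"] by simp
    have "(\<integral>x. normal_density 0 \<sigma> x * \<bar>x\<bar> ^ 3 \<partial>lborel) = (\<integral>\<omega>. \<bar>Y \<omega>\<bar> ^ 3 \<partial>M)"
      by (rule distributed_integral[OF D0]) auto
    moreover have "(\<integral>x. normal_density 0 \<sigma> x * \<bar>x\<bar> ^ 3 \<partial>lborel) = 2 * \<sigma> ^ 3 * sqrt (2 / pi)"
      using integral_normal_moment_abs_odd[OF s, of 0 1] by (simp add: eval_nat_numeral)
    moreover have "2 * \<sigma> ^ 3 * sqrt (2 / pi) \<le> 2 * \<sigma> ^ 3 * 1"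
      using s pi_gt3 by (intro mult_left_mono) auto
    ultimately have I4: "(\<integral>\<omega>. \<bar>Y \<omega>\<bar> ^ 3 \<partial>M) \<le> 2 * \<sigma> ^ 3" by linarith
    have D1: "distributed M lborel (\<lambda>\<omega>. Y \<omega> / \<sigma>) std_normal_density"
      using normal_standard_normal_convert[OF s, of Y 0] D0 by simp
    have "(\<integral>\<omega>. iexp (Y \<omega>) \<partial>M) = (\<integral>\<omega>. iexp (\<sigma> * (Y \<omega> / \<sigma>)) \<partial>M)" using s by simp
    also have "\<dots> = (\<integral>x. iexp (\<sigma> * x) \<partial>distr M lborel (\<lambda>\<omega>. Y \<omega> / \<sigma>))"
      by (subst integral_distr) auto
    also have "\<dots> = char std_normal_distribution \<sigma>"
      unfolding distributed_distr_eq_density[OF D1] char_def by simp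
    also have "\<dots> = of_real (exp (- \<sigma>\<^sup>2 / 2))" by (simp add: char_std_normal_distribution)
    finally have I5: "(\<integral>\<omega>. iexp (Y \<omega>) \<partial>M) = of_real (exp (- \<sigma>\<^sup>2 / 2))" .
    show ?thesis unfolding v using I1 I2 I3 I4 I5 s Y by simp
  qed
  then show "Y \<in> borel_measurable M" "integrable M Y" "integrable M (\<lambda>\<omega>. (Y \<omega>)\<^sup>2)" "integrable M (\<lambda>\<omega>. \<bar>Y \<omega>\<bar> ^ 3)"
    "(\<integral>\<omega>. \<bar>Y \<omega>\<bar> ^ 3 \<partial>M) \<le> 2 * sqrt (\<integral>\<omega>. (Y \<omega>)\<^sup>2 \<partial>M) ^ 3"
    "(\<integral>\<omega>. iexp (Y \<omega>) \<partial>M) = of_real (exp (- (\<integral>\<omega>. (Y \<omega>)\<^sup>2 \<partial>M) / 2))" by auto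
qed

lemma integrable_mult_of_squares:
  fixes f g :: "'a \<Rightarrow> real"
  assumes [measurable]: "f \<in> borel_measurable M" "g \<in> borel_measurable M"
    and "integrable M (\<lambda>x. (f x)\<^sup>2)" "integrable M (\<lambda>x. (g x)\<^sup>2)"
  shows "integrable M (\<lambda>x. f x * g x)"
proof (rule Bochner_Integration.integrable_bound)
  show "integrable M (\<lambda>x. (f x)\<^sup>2 + (g x)\<^sup>2)" using assms by simp
  have "\<bar>a * b\<bar> \<le> a\<^sup>2 + b\<^sup>2" for a b :: real
  proof -
    have "2 * \<bar>a * b\<bar> \<le> a\<^sup>2 + b\<^sup>2" using sum_squares_bound[of "\<bar>a\<bar>" "\<bar>b\<bar>"] by (simp add: abs_mult)
    then show ?thesis using abs_ge_zero[of "a * b"] by linarith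
  qed
  then show "AE x in M. norm (f x * g x) \<le> norm ((f x)\<^sup>2 + (g x)\<^sup>2)" by simp
qed simp

text \<open>Joint quantities are reached through scalar ones: coordinates are linear combinations,
  hence normal with finite third moments, and a general combination is centred normal with variance
  given by the quadratic form of \<Gamma>.\<close>

lemma centred_gaussian_vector_facts:
  assumes M: "prob_space M" and Z: "centred_gaussian_vector M d \<Gamma> Z"
  shows "Z \<in> measurable M (vecs d)"
    and "i < d \<Longrightarrow> integrable M (\<lambda>\<omega>. Z \<omega> i)"
    and "i < d \<Longrightarrow> j < d \<Longrightarrow> integrable M (\<lambda>\<omega>. Z \<omega> i * Z \<omega> j) \<and> (\<integral>\<omega>. Z \<omega> i * Z \<omega> j \<partial>M) = \<Gamma> i j"
    and "i < d \<Longrightarrow> integrable M (\<lambda>\<omega>. \<bar>Z \<omega> i\<bar> ^ 3) \<and> (\<integral>\<omega>. \<bar>Z \<omega> i\<bar> ^ 3 \<partial>M) \<le> 2 * sqrt (\<Gamma> i i) ^ 3"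
    and "(\<integral>\<omega>. iexp (\<Sum>i<d. a i * Z \<omega> i) \<partial>M) = of_real (exp (- (\<Sum>i<d. \<Sum>j<d. a i * a j * \<Gamma> i j) / 2))"
proof -
  interpret prob_space M by fact
  show Zm: "Z \<in> measurable M (vecs d)" using Z by (simp add: centred_gaussian_vector_def gaussian_vector_def)
  have un: "univariate_normal M (\<lambda>\<omega>. \<Sum>i<d. a i * Z \<omega> i)" for a
    using Z by (simp add: centred_gaussian_vector_def gaussian_vector_def)
  have mz: "(\<integral>\<omega>. Z \<omega> i \<partial>M) = 0" if "i < d" for i using Z that by (simp add: centred_gaussian_vector_def)
  have cv: "(\<integral>\<omega>. Z \<omega> i * Z \<omega> j \<partial>M) = \<Gamma> i j" if "i < d" "j < d" for i j
    using Z that mz[OF that(1)] mz[OF that(2)] by (auto simp: centred_gaussian_vector_def covariance_def)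
  have coord: "(\<Sum>k<d. (if k = i then 1 else 0) * Z \<omega> k) = Z \<omega> i" if "i < d" for i \<omega>
    using that by (simp add: if_distrib[of "\<lambda>u. u * _"] cong: if_cong)
  have ui: "univariate_normal M (\<lambda>\<omega>. Z \<omega> i)" if "i < d" for i
    using un[of "\<lambda>k. if k = i then 1 else 0"] by (simp only: coord[OF that])
  note ni = univariate_normal_centred[OF M ui mz]
  show "integrable M (\<lambda>\<omega>. Z \<omega> i)" if "i < d" for i using ni(2)[OF that that] .
  have i2: "integrable M (\<lambda>\<omega>. Z \<omega> i * Z \<omega> j)" if "i < d" "j < d" for i j
    by (rule integrable_mult_of_squares) (use ni(1,3) that in auto)
  then show "i < d \<Longrightarrow> j < d \<Longrightarrow> integrable M (\<lambda>\<omega>. Z \<omega> i * Z \<omega> j) \<and> (\<integral>\<omega>. Z \<omega> i * Z \<omega> j \<partial>M) = \<Gamma> i j"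
    using cv by simp
  show "integrable M (\<lambda>\<omega>. \<bar>Z \<omega> i\<bar> ^ 3) \<and> (\<integral>\<omega>. \<bar>Z \<omega> i\<bar> ^ 3 \<partial>M) \<le> 2 * sqrt (\<Gamma> i i) ^ 3" if "i < d"
    using ni(4)[OF that that] ni(5)[OF that that] cv[OF that that] by (simp add: power2_eq_square)
  have i1: "integrable M (\<lambda>\<omega>. Z \<omega> i)" if "i < d" for i using ni(2)[OF that that] .
  have m0: "(\<integral>\<omega>. (\<Sum>i<d. a i * Z \<omega> i) \<partial>M) = 0"
  proof -
    have "(\<integral>\<omega>. (\<Sum>i<d. a i * Z \<omega> i) \<partial>M) = (\<Sum>i<d. \<integral>\<omega>. a i * Z \<omega> i \<partial>M)"
      by (rule Bochner_Integration.integral_sum) (use i1 in auto)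
    also have "\<dots> = 0" by (intro sum.neutral) (use mz in auto)
    finally show ?thesis .
  qed
  have "(\<integral>\<omega>. (\<Sum>i<d. a i * Z \<omega> i)\<^sup>2 \<partial>M) = (\<integral>\<omega>. (\<Sum>i<d. \<Sum>j<d. (a i * a j) * (Z \<omega> i * Z \<omega> j)) \<partial>M)"
    by (intro Bochner_Integration.integral_cong refl) (simp add: power2_eq_square sum_product mult_ac)
  also have "\<dots> = (\<Sum>i<d. \<integral>\<omega>. (\<Sum>j<d. (a i * a j) * (Z \<omega> i * Z \<omega> j)) \<partial>M)"
    by (rule Bochner_Integration.integral_sum) (intro Bochner_Integration.integrable_sum integrable_mult_right i2, auto)
  also have "\<dots> = (\<Sum>i<d. \<Sum>j<d. \<integral>\<omega>. (a i * a j) * (Z \<omega> i * Z \<omega> j) \<partial>M)"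
    by (intro sum.cong refl Bochner_Integration.integral_sum integrable_mult_right i2) auto
  also have "\<dots> = (\<Sum>i<d. \<Sum>j<d. a i * a j * \<Gamma> i j)"
    by (intro sum.cong refl) (simp add: cv)
  finally have v: "(\<integral>\<omega>. (\<Sum>i<d. a i * Z \<omega> i)\<^sup>2 \<partial>M) = (\<Sum>i<d. \<Sum>j<d. a i * a j * \<Gamma> i j)" .
  show "(\<integral>\<omega>. iexp (\<Sum>i<d. a i * Z \<omega> i) \<partial>M) = of_real (exp (- (\<Sum>i<d. \<Sum>j<d. a i * a j * \<Gamma> i j) / 2))"
    using univariate_normal_centred(6)[OF M un m0] unfolding v .
qed

section \<open>Third moments of random vectors\<close>

text \<open>|v|^3 is |v|^2 times |v|, hence at most the double sum of |v_i|^2 |v_j|, and a^2 b \<le>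
  a^3 + b^3. Together with the sum over coordinates this is where d^2 in the final bound
  arises.\<close>

lemma vnorm_cube_le: "vnorm d v ^ 3 \<le> 2 * real d * (\<Sum>i<d. \<bar>v i\<bar> ^ 3)"
proof -
  have sq: "a\<^sup>2 * b \<le> a ^ 3 + b ^ 3" if "0 \<le> a" "0 \<le> b" for a b :: real
  proof (cases "a \<le> b")
    case True
    then have "a\<^sup>2 * b \<le> b\<^sup>2 * b" using that by (intro mult_right_mono power_mono) auto
    then show ?thesis using that by (simp add: power3_eq_cube power2_eq_square add_increasing)
  next
    case False
    then have "a\<^sup>2 * b \<le> a\<^sup>2 * a" using that by (intro mult_left_mono) auto
    then show ?thesis using that by (simp add: power3_eq_cube power2_eq_square add_increasing2)
  qed
  have "vnorm d v \<le> (\<Sum>j<d. \<bar>v j\<bar>)" by (rule L2_set_le_sum_abs)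
  moreover have "(vnorm d v)\<^sup>2 = (\<Sum>i<d. \<bar>v i\<bar>\<^sup>2)" by (simp add: L2_set_def sum_nonneg)
  ultimately have "vnorm d v ^ 3 \<le> (\<Sum>i<d. \<bar>v i\<bar>\<^sup>2) * (\<Sum>j<d. \<bar>v j\<bar>)"
    by (simp add: power3_eq_cube flip: power2_eq_square) (metis mult_left_mono sum_nonneg zero_le_power2)
  also have "\<dots> = (\<Sum>i<d. \<Sum>j<d. \<bar>v i\<bar>\<^sup>2 * \<bar>v j\<bar>)" by (rule sum_product)
  also have "\<dots> \<le> (\<Sum>i<d. \<Sum>j<d. \<bar>v i\<bar> ^ 3 + \<bar>v j\<bar> ^ 3)" by (intro sum_mono sq) auto
  also have "\<dots> = 2 * real d * (\<Sum>i<d. \<bar>v i\<bar> ^ 3)"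
    by (simp add: sum.distrib sum_distrib_left mult.assoc)
  finally show ?thesis .
qed

lemma law_distr:
  assumes "prob_space M" "X \<in> measurable M (vecs d)"
  shows "law d (distr M (vecs d) X)"
  using prob_space.prob_space_distr[OF assms] by (simp add: law_def)

lemma cube_law_distr:
  assumes M: "prob_space M" and X: "X \<in> measurable M (vecs d)"
    and i: "\<And>i. i < d \<Longrightarrow> integrable M (\<lambda>\<omega>. \<bar>X \<omega> i\<bar> ^ 3)" and b: "\<And>i. i < d \<Longrightarrow> (\<integral>\<omega>. \<bar>X \<omega> i\<bar> ^ 3 \<partial>M) \<le> B"
  shows "cube_law d (distr M (vecs d) X)" and "abs_cube d (distr M (vecs d) X) \<le> 2 * (real d)\<^sup>2 * B"
proof -
  have nm: "(\<lambda>x. vnorm d x ^ 3) \<in> borel_measurable (vecs d)" by measurable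
  have s: "integrable M (\<lambda>\<omega>. 2 * real d * (\<Sum>i<d. \<bar>X \<omega> i\<bar> ^ 3))"
    by (intro integrable_mult_right Bochner_Integration.integrable_sum i) auto
  have iv: "integrable M (\<lambda>\<omega>. vnorm d (X \<omega>) ^ 3)"
    by (rule Bochner_Integration.integrable_bound[OF s measurable_compose[OF X nm]])
       (auto intro!: AE_I2 order_trans[OF vnorm_cube_le abs_ge_self] simp: L2_set_nonneg)
  then have "integrable (distr M (vecs d) X) (\<lambda>x. vnorm d x ^ 3)"
    by (subst integrable_distr_eq[OF X nm])
  then show "cube_law d (distr M (vecs d) X)" using law_distr[OF M X] by (simp add: cube_law_def)
  have "abs_cube d (distr M (vecs d) X) = (\<integral>\<omega>. vnorm d (X \<omega>) ^ 3 \<partial>M)"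
    unfolding abs_cube_def by (rule integral_distr[OF X nm])
  also have "\<dots> \<le> (\<integral>\<omega>. 2 * real d * (\<Sum>i<d. \<bar>X \<omega> i\<bar> ^ 3) \<partial>M)"
    by (rule integral_mono[OF iv s vnorm_cube_le])
  also have "\<dots> = 2 * real d * (\<Sum>i<d. \<integral>\<omega>. \<bar>X \<omega> i\<bar> ^ 3 \<partial>M)"
    by (subst integral_mult_right_zero, subst Bochner_Integration.integral_sum) (use i in auto)
  also have "\<dots> \<le> 2 * real d * (\<Sum>i<d. B)" by (intro mult_left_mono sum_mono b) auto
  finally show "abs_cube d (distr M (vecs d) X) \<le> 2 * (real d)\<^sup>2 * B" by (simp add: power2_eq_square mult_ac)
qed

section \<open>The uniform law on the sphere and the representation by convolution powers\<close>

lemma scale_measure_eq_density: "scale_measure (ennreal c) M = density M (\<lambda>_. ennreal c)"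
  by (rule measure_eqI) (simp_all add: emeasure_density nn_integral_cmult_indicator)

lemma integral_scale_measure:
  fixes f :: "'a \<Rightarrow> 'b::{banach, second_countable_topology}"
  assumes "c \<ge> 0" "f \<in> borel_measurable M"
  shows "(\<integral>x. f x \<partial>scale_measure (ennreal c) M) = c *\<^sub>R (\<integral>x. f x \<partial>M)"
  unfolding scale_measure_eq_density using assms by (subst integral_density) auto

lemma integrable_scale_measure:
  fixes f :: "'a \<Rightarrow> 'b::{banach, second_countable_topology}"
  assumes "c \<ge> 0" "integrable M f"
  shows "integrable (scale_measure (ennreal c) M) f"
  unfolding scale_measure_eq_density using assms by (subst integrable_density) auto

abbreviation uniform_sphere :: "(real ^ 3) measure" where
  "uniform_sphere \<equiv> scale_measure (ennreal (1 / (4 * pi))) sphere_measure"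

lemma prob_space_uniform_sphere: "prob_space uniform_sphere"
proof (rule prob_spaceI)
  have "emeasure uniform_sphere (space uniform_sphere) = ennreal (1 / (4 * pi)) * ennreal (4 * pi)"
    by (simp add: space_scale_measure space_sphere_measure emeasure_sphere_measure_sphere)
  also have "\<dots> = 1" by (simp flip: ennreal_mult)
  finally show "emeasure uniform_sphere (space uniform_sphere) = 1" .
qed

text \<open>The jump law of the compound Poisson representation: a vector of function values at one
  point chosen uniformly on the sphere.\<close>

definition sphere_law :: "nat \<Rightarrow> (nat \<Rightarrow> real ^ 3 \<Rightarrow> real) \<Rightarrow> (nat \<Rightarrow> real) measure" where
  "sphere_law d f = distr uniform_sphere (vecs d) (\<lambda>\<xi>. \<lambda>i\<in>{..<d}. f i \<xi>)"

lemma sphere_map_measurable: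
  assumes "\<And>i. i < d \<Longrightarrow> continuous_on UNIV (f i)"
  shows "(\<lambda>\<xi> :: real ^ 3. \<lambda>i\<in>{..<d}. (f i \<xi> :: real)) \<in> measurable uniform_sphere (vecs d)"
proof (rule measurable_restrict)
  fix i assume "i \<in> {..<d}"
  then have "f i \<in> borel_measurable sphere_measure"
    by (intro borel_measurable_sphere_measure borel_measurable_continuous_onI assms) simp
  then show "f i \<in> borel_measurable uniform_sphere" by simp
qed

lemma integral_sphere_law:
  fixes g :: "(nat \<Rightarrow> real) \<Rightarrow> 'b::{banach, second_countable_topology}"
  assumes f: "\<And>i. i < d \<Longrightarrow> continuous_on UNIV (f i)" and g: "g \<in> borel_measurable (vecs d)"
  shows "(\<integral>x. g x \<partial>sphere_law d f) = (1 / (4 * pi)) *\<^sub>R (\<integral>\<xi>. g (\<lambda>i\<in>{..<d}. f i \<xi>) \<partial>sphere_measure)"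
proof -
  have "(\<lambda>\<xi>. g (\<lambda>i\<in>{..<d}. f i \<xi>)) \<in> borel_measurable uniform_sphere"
    by (rule measurable_compose[OF sphere_map_measurable[OF f] g])
  then have m: "(\<lambda>\<xi>. g (\<lambda>i\<in>{..<d}. f i \<xi>)) \<in> borel_measurable sphere_measure" by simp
  have "(\<integral>x. g x \<partial>sphere_law d f) = (\<integral>\<xi>. g (\<lambda>i\<in>{..<d}. f i \<xi>) \<partial>uniform_sphere)"
    unfolding sphere_law_def by (rule integral_distr[OF sphere_map_measurable[OF f] g])
  also have "\<dots> = (1 / (4 * pi)) *\<^sub>R (\<integral>\<xi>. g (\<lambda>i\<in>{..<d}. f i \<xi>) \<partial>sphere_measure)"
    by (rule integral_scale_measure[OF _ m]) simp
  finally show ?thesis .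
qed

text \<open>Both sides have a characteristic function of the form exp (\<nu> times the integral of
  e^(i g) - 1 over the sphere), g being the sum of a_i f_i. On the left this is
  \<open>poisson_integral_char\<close> for the single integrand g; on the right, n factors of rate 4
  \<pi> \<nu> / n multiply to the total mass 4 \<pi> \<nu>. \<open>cramer_wold\<close> then
  identifies the laws.\<close>

lemma poisson_vector_law:
  fixes f :: "nat \<Rightarrow> real ^ 3 \<Rightarrow> real"
  assumes M: "prob_space M" and \<nu>: "\<nu> > 0"
    and N: "poisson_random_measure M (scale_measure (ennreal \<nu>) sphere_measure) N"
    and f: "\<And>i. i < d \<Longrightarrow> continuous_on UNIV (f i)" and n: "n \<ge> 1"
  defines "X \<equiv> \<lambda>\<omega>. \<lambda>i\<in>{..<d}. \<integral>\<xi>. f i \<xi> \<partial>N \<omega>"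
  shows "X \<in> measurable M (vecs d)"
    and "distr M (vecs d) X = conv_pow d (compound d (4 * pi * \<nu> / real n) (sphere_law d f)) n"
proof -
  interpret prob_space M by fact
  let ?\<Lambda> = "scale_measure (ennreal \<nu>) sphere_measure"
  let ?R = "sphere_law d f" and ?r = "4 * pi * \<nu> / real n"
  have fin: "finite_measure ?\<Lambda>"
    by (rule finite_measureI)
       (simp add: space_scale_measure space_sphere_measure emeasure_sphere_measure_sphere ennreal_mult_eq_top_iff)
  have sp: "space ?\<Lambda> = sphere 0 1" by (simp add: space_scale_measure space_sphere_measure)
  have bd: "\<exists>B. \<forall>\<xi>\<in>sphere 0 1. \<bar>g \<xi>\<bar> \<le> B" if "continuous_on UNIV g" for g :: "real ^ 3 \<Rightarrow> real"
  proof -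
    have "bounded (g ` sphere 0 1)"
      by (intro compact_imp_bounded compact_continuous_image continuous_on_subset[OF that]) auto
    then obtain B where "\<forall>z\<in>g ` sphere 0 1. norm z \<le> B" unfolding bounded_iff by blast
    then show ?thesis by auto
  qed
  have meas: "g \<in> borel_measurable ?\<Lambda>" if "continuous_on UNIV g" for g :: "real ^ 3 \<Rightarrow> real"
    using borel_measurable_sphere_measure[OF borel_measurable_continuous_onI[OF that]] by simp
  have pic: "AE \<omega> in M. finite_measure (N \<omega>)" "(\<lambda>\<omega>. \<integral>\<xi>. g \<xi> \<partial>N \<omega>) \<in> borel_measurable M"
    "(\<integral>\<omega>. iexp (\<integral>\<xi>. g \<xi> \<partial>N \<omega>) \<partial>M) = exp (\<integral>\<xi>. iexp (g \<xi>) - 1 \<partial>?\<Lambda>)"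
    if g: "continuous_on UNIV g" for g :: "real ^ 3 \<Rightarrow> real"
  proof -
    obtain B where B: "\<forall>\<xi>\<in>sphere 0 1. \<bar>g \<xi>\<bar> \<le> B" using bd[OF g] by blast
    have b: "\<xi> \<in> space ?\<Lambda> \<Longrightarrow> \<bar>g \<xi>\<bar> \<le> B" for \<xi> using B sp by blast
    note * = poisson_integral_char[OF M N fin meas[OF g] b]
    show "AE \<omega> in M. finite_measure (N \<omega>)" by (rule *(1))
    show "(\<lambda>\<omega>. \<integral>\<xi>. g \<xi> \<partial>N \<omega>) \<in> borel_measurable M" by (rule *(2))
    show "(\<integral>\<omega>. iexp (\<integral>\<xi>. g \<xi> \<partial>N \<omega>) \<partial>M) = exp (\<integral>\<xi>. iexp (g \<xi>) - 1 \<partial>?\<Lambda>)" by (rule *(3))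
  qed
  show Xm: "X \<in> measurable M (vecs d)"
    unfolding X_def by (rule measurable_restrict) (use pic(2) f in simp)
  have lR: "law d ?R"
    unfolding sphere_law_def by (rule law_distr[OF prob_space_uniform_sphere sphere_map_measurable[OF f]])
  have r: "?r > 0" using \<nu> n by simp
  have lC: "law d (compound d ?r ?R)" by (rule compound_integral(1)[OF lR])
  let ?K = "conv_pow d (compound d ?r ?R) n"
  have lK: "law d ?K" by (rule law_conv_pow[OF lC])
  have idm: "(\<lambda>x. x) \<in> measurable ?K (vecs d)" by (rule measurable_ident_sets) (use lK in \<open>simp add: law_def\<close>)
  have ns: "sets (N \<omega>) = sets ?\<Lambda>" if "\<omega> \<in> space M" for \<omega>
    using N that by (simp add: poisson_random_measure_def)
  have "distr M (vecs d) X = distr ?K (vecs d) (\<lambda>x. x)"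
  proof (rule cramer_wold[OF M _ Xm idm])
    show "prob_space ?K" using lK by (simp add: law_def)
    fix a
    define g where "g \<xi> = (\<Sum>i<d. a i * f i \<xi>)" for \<xi>
    have gc: "continuous_on UNIV g" unfolding g_def by (intro continuous_intros f) auto
    \<comment> \<open>Linearity of the integral requires integrability under N \<omega>, which comes
      from N \<omega> being finite almost surely.\<close>
    have lin: "AE \<omega> in M. (\<Sum>i<d. a i * X \<omega> i) = (\<integral>\<xi>. g \<xi> \<partial>N \<omega>)"
      using pic(1)[OF gc] AE_space
    proof eventually_elim
      case (elim \<omega>)
      interpret F: finite_measure "N \<omega>" by fact
      have spN: "space (N \<omega>) = sphere 0 1" using sets_eq_imp_space_eq[OF ns[OF elim(2)]] sp by simp
      have fi: "integrable (N \<omega>) (f i)" if i: "i < d" for i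
      proof -
        obtain B where B: "\<forall>\<xi>\<in>sphere 0 1. \<bar>f i \<xi>\<bar> \<le> B" using bd[OF f[OF i]] by blast
        have "f i \<in> borel_measurable (N \<omega>)"
          using meas[OF f[OF i]] by (simp only: measurable_cong_sets[OF ns[OF elim(2)] refl])
        then show ?thesis by (rule F.integrable_const_bound[of _ B, rotated]) (use B spN in \<open>auto intro!: AE_I2\<close>)
      qed
      have "(\<integral>\<xi>. g \<xi> \<partial>N \<omega>) = (\<Sum>i<d. \<integral>\<xi>. a i * f i \<xi> \<partial>N \<omega>)"
        unfolding g_def by (rule Bochner_Integration.integral_sum) (use fi in auto)
      then show ?case by (simp add: X_def)
    qed
    have Xi: "(\<lambda>\<omega>. X \<omega> i) \<in> borel_measurable M" if "i < d" for i
      using measurable_compose[OF Xm measurable_component_singleton[of i]] that by simp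
    have ig: "integrable sphere_measure (\<lambda>\<xi>. iexp (g \<xi>))"
      by (intro integrable_sphere_continuous continuous_intros gc)
    have one: "(\<integral>\<xi>. 1 \<partial>sphere_measure) = complex_of_real (4 * pi)"
      by (simp add: measure_def space_sphere_measure emeasure_sphere_measure_sphere scaleR_conv_of_real)
    interpret S: finite_measure sphere_measure by (rule finite_measure_sphere_measure)
    have "(\<integral>\<omega>. iexp (\<Sum>i<d. a i * X \<omega> i) \<partial>M) = (\<integral>\<omega>. iexp (\<integral>\<xi>. g \<xi> \<partial>N \<omega>) \<partial>M)"
    proof (rule integral_cong_AE)
      show "(\<lambda>\<omega>. iexp (\<Sum>i<d. a i * X \<omega> i)) \<in> borel_measurable M" using Xi by measurable
      show "(\<lambda>\<omega>. iexp (\<integral>\<xi>. g \<xi> \<partial>N \<omega>)) \<in> borel_measurable M"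
        using measurable_compose[OF pic(2)[OF gc], of "\<lambda>x. iexp x"] by simp
      show "AE \<omega> in M. iexp (\<Sum>i<d. a i * X \<omega> i) = iexp (\<integral>\<xi>. g \<xi> \<partial>N \<omega>)"
        using lin by eventually_elim simp
    qed
    also have "\<dots> = exp (\<integral>\<xi>. iexp (g \<xi>) - 1 \<partial>?\<Lambda>)" by (rule pic(3)[OF gc])
    also have "(\<integral>\<xi>. iexp (g \<xi>) - 1 \<partial>?\<Lambda>) = of_real \<nu> * ((\<integral>\<xi>. iexp (g \<xi>) \<partial>sphere_measure) - of_real (4 * pi))"
    proof -
      have "(\<integral>\<xi>. iexp (g \<xi>) - 1 \<partial>?\<Lambda>) = \<nu> *\<^sub>R (\<integral>\<xi>. iexp (g \<xi>) - 1 \<partial>sphere_measure)"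
        using \<nu> ig by (intro integral_scale_measure) auto
      also have "(\<integral>\<xi>. iexp (g \<xi>) - 1 \<partial>sphere_measure) = (\<integral>\<xi>. iexp (g \<xi>) \<partial>sphere_measure) - (\<integral>\<xi>. 1 \<partial>sphere_measure)"
        by (rule Bochner_Integration.integral_diff[OF ig S.integrable_const])
      finally show ?thesis unfolding one by (simp add: scaleR_conv_of_real)
    qed
    also have "\<dots> = of_nat n * (of_real ?r * ((\<integral>x. iexp (\<Sum>i<d. a i * x i) \<partial>?R) - 1))"
    proof -
      have "(\<integral>x. iexp (\<Sum>i<d. a i * x i) \<partial>?R) = (1 / (4 * pi)) *\<^sub>R (\<integral>\<xi>. iexp (g \<xi>) \<partial>sphere_measure)"
        by (subst integral_sphere_law[OF f iexp_dot_measurable]) (auto simp: g_def)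
      moreover have "of_nat n * (of_real ?r * (z :: complex)) = of_real \<nu> * (of_real (4 * pi) * z)" for z
        using n by simp
      ultimately show ?thesis using n by (simp add: scaleR_conv_of_real right_diff_distrib)
    qed
    also have "exp \<dots> = exp (of_real ?r * ((\<integral>x. iexp (\<Sum>i<d. a i * x i) \<partial>?R) - 1)) ^ n"
      by (rule exp_of_nat_mult)
    also have "\<dots> = (\<integral>x. iexp (\<Sum>i<d. a i * x i) \<partial>?K)"
      unfolding conv_pow_char[OF lC] compound_char[OF lR r] ..
    finally show "(\<integral>\<omega>. iexp (\<Sum>i<d. a i * X \<omega> i) \<partial>M) = (\<integral>x. iexp (\<Sum>i<d. a i * x i) \<partial>?K)" .
  qed
  also have "distr ?K (vecs d) (\<lambda>x. x) = ?K"
    by (rule distr_id2) (use lK in \<open>simp add: law_def\<close>)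
  finally show "distr M (vecs d) X = ?K" .
qed

text \<open>Scaling by 1 / sqrt n divides the quadratic exponent of the characteristic function by
  n, and the n-th power restores it.\<close>

lemma gaussian_vector_law:
  assumes M: "prob_space M" and Z: "centred_gaussian_vector M d \<Gamma> Z" and n: "n \<ge> 1"
  shows "distr M (vecs d) Z = conv_pow d (distr M (vecs d) (\<lambda>\<omega>. \<lambda>i\<in>{..<d}. Z \<omega> i / sqrt (real n))) n"
proof -
  interpret prob_space M by fact
  note zf = centred_gaussian_vector_facts[OF M Z]
  let ?Y = "\<lambda>\<omega>. \<lambda>i\<in>{..<d}. Z \<omega> i / sqrt (real n)"
  have Zi: "(\<lambda>\<omega>. Z \<omega> i) \<in> borel_measurable M" if "i < d" for i
    using measurable_compose[OF zf(1) measurable_component_singleton[of i]] that by simp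
  have Ym: "?Y \<in> measurable M (vecs d)" by (rule measurable_restrict) (use Zi in auto)
  let ?Q = "distr M (vecs d) ?Y"
  have lQ: "law d ?Q" by (rule law_distr[OF M Ym])
  let ?K = "conv_pow d ?Q n"
  have lK: "law d ?K" by (rule law_conv_pow[OF lQ])
  have idm: "(\<lambda>x. x) \<in> measurable ?K (vecs d)" by (rule measurable_ident_sets) (use lK in \<open>simp add: law_def\<close>)
  have "distr M (vecs d) Z = distr ?K (vecs d) (\<lambda>x. x)"
  proof (rule cramer_wold[OF M _ zf(1) idm])
    show "prob_space ?K" using lK by (simp add: law_def)
    fix a
    have "(\<integral>x. iexp (\<Sum>i<d. a i * x i) \<partial>?Q) = (\<integral>\<omega>. iexp (\<Sum>i<d. a i * ?Y \<omega> i) \<partial>M)"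
      by (rule integral_distr[OF Ym iexp_dot_measurable])
    also have "\<dots> = (\<integral>\<omega>. iexp (\<Sum>i<d. (a i / sqrt (real n)) * Z \<omega> i) \<partial>M)"
    proof -
      have "(\<Sum>i<d. a i * ?Y \<omega> i) = (\<Sum>i<d. (a i / sqrt (real n)) * Z \<omega> i)" for \<omega>
        by (intro sum.cong refl) simp
      then show ?thesis by (simp only:)
    qed
    also have "\<dots> = of_real (exp (- (\<Sum>i<d. \<Sum>j<d. (a i / sqrt (real n)) * (a j / sqrt (real n)) * \<Gamma> i j) / 2))"
      by (rule zf(5))
    also have "(\<Sum>i<d. \<Sum>j<d. (a i / sqrt (real n)) * (a j / sqrt (real n)) * \<Gamma> i j) = (\<Sum>i<d. \<Sum>j<d. a i * a j * \<Gamma> i j) / real n"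
      unfolding sum_divide_distrib using n by (intro sum.cong refl) (simp add: field_simps flip: real_sqrt_mult)
    finally have q: "(\<integral>x. iexp (\<Sum>i<d. a i * x i) \<partial>?Q) = of_real (exp (- ((\<Sum>i<d. \<Sum>j<d. a i * a j * \<Gamma> i j) / real n) / 2))" .
    have "(\<integral>x. iexp (\<Sum>i<d. a i * x i) \<partial>?K) = of_real (exp (- ((\<Sum>i<d. \<Sum>j<d. a i * a j * \<Gamma> i j) / real n) / 2) ^ n)"
      unfolding conv_pow_char[OF lQ] q of_real_power ..
    also have "exp (- ((\<Sum>i<d. \<Sum>j<d. a i * a j * \<Gamma> i j) / real n) / 2) ^ n = exp (- (\<Sum>i<d. \<Sum>j<d. a i * a j * \<Gamma> i j) / 2)"
      unfolding exp_of_nat_mult[symmetric] using n by simp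
    finally show "(\<integral>\<omega>. iexp (\<Sum>i<d. a i * Z \<omega> i) \<partial>M) = (\<integral>x. iexp (\<Sum>i<d. a i * x i) \<partial>?K)"
      unfolding zf(5) ..
  qed
  also have "distr ?K (vecs d) (\<lambda>x. x) = ?K"
    by (rule distr_id2) (use lK in \<open>simp add: law_def\<close>)
  finally show ?thesis .
qed

section \<open>Moments of the wave kernel and the bound on the distance\<close>

definition wave_kernel :: "nat \<Rightarrow> real ^ 3 \<Rightarrow> real ^ 3 \<Rightarrow> real" where
  "wave_kernel l x \<xi> = sqrt ((2 * real l + 1) / (4 * pi)) * poly (legendre_poly l) (x \<bullet> \<xi>)"

lemma continuous_wave_kernel [continuous_intros]: "continuous_on A (wave_kernel l x)"
  unfolding wave_kernel_def by (intro continuous_intros)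

text \<open>For l \<ge> 1 the kernel is orthogonal to constants, so the jumps are centred, and the
  reproducing property makes their covariance proportional to P_l (x . z). In the third moment the
  powers of l cancel: (2l + 1) / (4 \<pi>) times 10 / l is at most 3.\<close>

lemma wave_kernel_integrals:
  assumes x: "norm x = 1" and z: "norm z = 1" and l: "l \<ge> 1"
  shows "(\<integral>\<xi>. wave_kernel l x \<xi> \<partial>sphere_measure) = 0"
    and "(\<integral>\<xi>. wave_kernel l x \<xi> * wave_kernel l z \<xi> \<partial>sphere_measure) = poly (legendre_poly l) (x \<bullet> z)"
    and "(\<integral>\<xi>. \<bar>wave_kernel l x \<xi>\<bar> ^ 3 \<partial>sphere_measure) \<le> 3 powr (3/2) * sphere_L3_const"
proof -
  define q where "q = (2 * real l + 1) / (4 * pi)"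
  have q: "q > 0" by (simp add: q_def add_nonneg_pos)
  show "(\<integral>\<xi>. wave_kernel l x \<xi> \<partial>sphere_measure) = 0"
    unfolding wave_kernel_def using integral_legendre_product(2)[OF x z, of l] l by simp
  have "(\<integral>\<xi>. wave_kernel l x \<xi> * wave_kernel l z \<xi> \<partial>sphere_measure)
      = (\<integral>\<xi>. q * (poly (legendre_poly l) (x \<bullet> \<xi>) * poly (legendre_poly l) (z \<bullet> \<xi>)) \<partial>sphere_measure)"
  proof -
    have "wave_kernel l x \<xi> * wave_kernel l z \<xi> = (sqrt q * sqrt q) * (poly (legendre_poly l) (x \<bullet> \<xi>) * poly (legendre_poly l) (z \<bullet> \<xi>))" for \<xi>
      unfolding wave_kernel_def q_def[symmetric] by (simp only: mult_ac)
    then show ?thesis using q by simp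
  qed
  also have "\<dots> = q * (4 * pi / (2 * real l + 1) * poly (legendre_poly l) (x \<bullet> z))"
    by (simp only: integral_mult_right_zero integral_legendre_product(1)[OF x z])
  also have "\<dots> = (q * (4 * pi / (2 * real l + 1))) * poly (legendre_poly l) (x \<bullet> z)" by (simp only: mult.assoc)
  also have "q * (4 * pi / (2 * real l + 1)) = 1"
  proof -
    have "2 * real l + 1 \<noteq> 0" by (simp add: add_nonneg_eq_0_iff)
    then show ?thesis by (simp add: q_def)
  qed
  finally show "(\<integral>\<xi>. wave_kernel l x \<xi> * wave_kernel l z \<xi> \<partial>sphere_measure) = poly (legendre_poly l) (x \<bullet> z)" by simp
  have "(\<integral>\<xi>. \<bar>wave_kernel l x \<xi>\<bar> ^ 3 \<partial>sphere_measure) = sqrt q ^ 3 * (\<integral>\<xi>. \<bar>poly (legendre_poly l) (x \<bullet> \<xi>)\<bar> ^ 3 \<partial>sphere_measure)"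
    unfolding wave_kernel_def q_def[symmetric] using q by (simp add: abs_mult power_mult_distrib)
  also have "\<dots> \<le> sqrt q ^ 3 * ((10 / real l) powr (3/2) * sphere_L3_const)"
    using q by (intro mult_left_mono integral_legendre_cube_le x l) auto
  also have "sqrt q ^ 3 = q powr (3/2)"
    using q by (simp add: powr_half_sqrt[symmetric] powr_powr flip: powr_numeral)
  also have "q powr (3/2) * ((10 / real l) powr (3/2) * sphere_L3_const) = (q * (10 / real l)) powr (3/2) * sphere_L3_const"
    by (simp only: powr_mult mult.assoc)
  also have "\<dots> \<le> 3 powr (3/2) * sphere_L3_const"
  proof (intro mult_right_mono powr_mono2)
    have "(2 * real l + 1) * 10 \<le> 3 * (4 * 3 * real l)" using l by simp
    also have "\<dots> \<le> 3 * (4 * pi * real l)" using pi_gt3 l by (intro mult_left_mono mult_right_mono) auto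
    finally show "q * (10 / real l) \<le> 3" using l by (simp add: q_def field_simps)
  qed (use q sphere_L3_const_nonneg in auto)
  finally show "(\<integral>\<xi>. \<bar>wave_kernel l x \<xi>\<bar> ^ 3 \<partial>sphere_measure) \<le> 3 powr (3/2) * sphere_L3_const" .
qed

text \<open>The first summand belongs to the compound Poisson copies: 4/3 from the convolution
  powers times 3 e^3 from exp (3 r) - 1 \<le> 3 r e^3, then 2 from \<open>vnorm_cube_le\<close> and
  the third moment of the kernel. The summand 4 is the Gaussian part, 2 from the norm and 2 from the
  normal third moment.\<close>

definition wave_const :: real where
  "wave_const = 4 * exp 3 * (2 * (3 powr (3/2) * sphere_L3_const)) + 4"

lemma wave_const_nonneg: "wave_const \<ge> 0"
  using sphere_L3_const_nonneg by (simp add: wave_const_def)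

lemma integral_eq_law:
  assumes M: "prob_space M" and X: "X \<in> measurable M (vecs d)" and h: "h \<in> test_functions d"
    and K: "distr M (vecs d) X = K"
  shows "(\<integral>\<omega>. h (X \<omega>) \<partial>M) = (\<integral>v. h (vadd d (\<lambda>_. 0) v) \<partial>K)"
proof -
  have hm: "(\<lambda>v. h (vadd d (\<lambda>_. 0) v)) \<in> borel_measurable (vecs d)"
    by (rule measurable_compose[OF vadd_measurable_const test_function_measurable[OF h]])
  have "(\<integral>v. h (vadd d (\<lambda>_. 0) v) \<partial>K) = (\<integral>\<omega>. h (vadd d (\<lambda>_. 0) (X \<omega>)) \<partial>M)"
    unfolding K[symmetric] by (rule integral_distr[OF X hm])
  also have "\<dots> = (\<integral>\<omega>. h (X \<omega>) \<partial>M)"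
  proof (rule Bochner_Integration.integral_cong[OF refl])
    fix \<omega> assume "\<omega> \<in> space M"
    then have "X \<omega> \<in> extensional {..<d}" using measurable_space[OF X] by (auto simp: space_PiM PiE_def)
    then have "vadd d (\<lambda>_. 0) (X \<omega>) = X \<omega>" by (auto simp: vadd_def fun_eq_iff extensional_def)
    then show "h (vadd d (\<lambda>_. 0) (X \<omega>)) = h (X \<omega>)" by simp
  qed
  finally show ?thesis by simp
qed

text \<open>Both vectors are sums of \<open>n = \<lceil>4 \<pi> \<nu>\<rceil>\<close> independent copies with the same first two moments. The number of
  points in a compound Poisson copy then has mean at most one, so each replacement costs order \<open>n powr (-3/2)\<close>.\<close>

lemma wave_gaussian_distance:
  fixes x :: "nat \<Rightarrow> real ^ 3"
  assumes M: "prob_space M" and M': "prob_space M'" and \<nu>: "\<nu> > 0" and l: "l \<ge> 1"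
    and N: "poisson_random_measure M (scale_measure (ennreal \<nu>) sphere_measure) N"
    and x: "\<And>i. i < d \<Longrightarrow> x i \<in> sphere 0 1"
    and F: "\<And>\<omega>. F \<omega> = (\<lambda>i\<in>{..<d}. poisson_wave l \<nu> N (x i) \<omega>)"
    and Z: "centred_gaussian_vector M' d (\<lambda>i j. poly (legendre_poly l) (x i \<bullet> x j)) Z"
    and h: "h \<in> test_functions d"
  shows "\<bar>(\<integral>\<omega>. h (F \<omega>) \<partial>M) - (\<integral>\<omega>. h (Z \<omega>) \<partial>M')\<bar> \<le> wave_const * (real d)\<^sup>2 / sqrt \<nu>"
proof -
  interpret M': prob_space M' by fact
  have nx: "norm (x i) = 1" if "i < d" for i using x[OF that] by simp
  define n where "n = nat \<lceil>4 * pi * \<nu>\<rceil>"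
  have np: "4 * pi * \<nu> > 0" using \<nu> by simp
  have n_ge: "4 * pi * \<nu> \<le> real n" unfolding n_def by (rule real_nat_ceiling_ge)
  then have n1: "n \<ge> 1" using np by (cases n) auto
  define r where "r = 4 * pi * \<nu> / real n"
  have r: "r > 0" "r \<le> 1" "real n * r = 4 * pi * \<nu>" using np n_ge n1 by (auto simp: r_def)
  define f where "f i \<xi> = (1 / sqrt \<nu>) * wave_kernel l (x i) \<xi>" for i \<xi>
  have fc: "continuous_on UNIV (f i)" for i unfolding f_def by (intro continuous_intros)
  define R where "R = sphere_law d f"
  define P where "P = compound d r R"
  define Q where "Q = distr M' (vecs d) (\<lambda>\<omega>. \<lambda>i\<in>{..<d}. Z \<omega> i / sqrt (real n))"
  note zf = centred_gaussian_vector_facts[OF M' Z]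

  have Feq: "F = (\<lambda>\<omega>. \<lambda>i\<in>{..<d}. \<integral>\<xi>. f i \<xi> \<partial>N \<omega>)"
    by (rule ext) (simp add: F poisson_wave_def f_def wave_kernel_def)
  have Fm: "F \<in> measurable M (vecs d)" and Flaw: "distr M (vecs d) F = conv_pow d P n"
    using poisson_vector_law[OF M \<nu> N fc n1] unfolding Feq P_def R_def r_def by auto
  have Zlaw: "distr M' (vecs d) Z = conv_pow d Q n"
    unfolding Q_def by (rule gaussian_vector_law[OF M' Z n1])

  \<comment> \<open>Bound for the third moment of one coordinate of a jump: \<nu>^(-3/2) from the
    factor 1 / sqrt \<nu> of the wave, 1 / (4 \<pi>) from the uniform law.\<close>
  let ?B = "(1 / sqrt \<nu>) ^ 3 * ((1 / (4 * pi)) * (3 powr (3/2) * sphere_L3_const))"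
  have R: "cube_law d R" "abs_cube d R \<le> 2 * (real d)\<^sup>2 * ?B"
  proof -
    have m: "(\<lambda>\<xi>. \<bar>f i \<xi>\<bar> ^ 3) \<in> borel_measurable sphere_measure" for i
      by (intro borel_measurable_sphere_measure borel_measurable_continuous_onI continuous_intros fc)
    have i3: "integrable uniform_sphere (\<lambda>\<xi>. \<bar>(\<lambda>i\<in>{..<d}. f i \<xi>) i\<bar> ^ 3)" if "i < d" for i
      using that by simp (intro integrable_scale_measure integrable_sphere_continuous continuous_intros fc, simp)
    have b3: "(\<integral>\<xi>. \<bar>(\<lambda>i\<in>{..<d}. f i \<xi>) i\<bar> ^ 3 \<partial>uniform_sphere) \<le> ?B" if "i < d" for i
    proof -
      have "(\<integral>\<xi>. \<bar>(\<lambda>i\<in>{..<d}. f i \<xi>) i\<bar> ^ 3 \<partial>uniform_sphere) = (1 / (4 * pi)) * (\<integral>\<xi>. \<bar>f i \<xi>\<bar> ^ 3 \<partial>sphere_measure)"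
        using that integral_scale_measure[OF _ m, of "1 / (4 * pi)"] by simp
      also have "(\<integral>\<xi>. \<bar>f i \<xi>\<bar> ^ 3 \<partial>sphere_measure) = (1 / sqrt \<nu>) ^ 3 * (\<integral>\<xi>. \<bar>wave_kernel l (x i) \<xi>\<bar> ^ 3 \<partial>sphere_measure)"
        unfolding f_def using \<nu> by (simp add: abs_mult power_mult_distrib power_divide abs_divide)
      also have "\<dots> \<le> (1 / sqrt \<nu>) ^ 3 * (3 powr (3/2) * sphere_L3_const)"
        using \<nu> by (intro mult_left_mono wave_kernel_integrals(3)[OF nx[OF that] nx[OF that] l]) auto
      finally show ?thesis by (simp add: mult_left_mono mult_ac divide_right_mono)
    qed
    show "cube_law d R" "abs_cube d R \<le> 2 * (real d)\<^sup>2 * ?B"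
      unfolding R_def sphere_law_def
      by (rule cube_law_distr[OF prob_space_uniform_sphere sphere_map_measurable[OF fc] i3 b3]; assumption)+
  qed
  have Rm: "(\<integral>v. v i \<partial>R) = 0" if "i < d" for i
    unfolding R_def using that wave_kernel_integrals(1)[OF nx[OF that] nx[OF that] l]
    by (subst integral_sphere_law[OF fc]) (auto simp: f_def)
  have Rc: "(\<integral>v. v i * v j \<partial>R) = poly (legendre_poly l) (x i \<bullet> x j) / (4 * pi * \<nu>)" if "i < d" "j < d" for i j
  proof -
    have "(\<integral>v. v i * v j \<partial>R) = (1 / (4 * pi)) * (\<integral>\<xi>. f i \<xi> * f j \<xi> \<partial>sphere_measure)"
      unfolding R_def using that by (subst integral_sphere_law[OF fc]) auto
    also have "(\<integral>\<xi>. f i \<xi> * f j \<xi> \<partial>sphere_measure) = (\<integral>\<xi>. (1 / \<nu>) * (wave_kernel l (x i) \<xi> * wave_kernel l (x j) \<xi>) \<partial>sphere_measure)"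
    proof -
      have "f i \<xi> * f j \<xi> = (1 / (sqrt \<nu> * sqrt \<nu>)) * (wave_kernel l (x i) \<xi> * wave_kernel l (x j) \<xi>)" for \<xi>
        by (simp add: f_def)
      then show ?thesis using \<nu> by simp
    qed
    also have "\<dots> = (1 / \<nu>) * poly (legendre_poly l) (x i \<bullet> x j)"
      by (simp only: integral_mult_right_zero wave_kernel_integrals(2)[OF nx[OF that(1)] nx[OF that(2)] l])
    finally show ?thesis by simp
  qed
  have P: "cube_law d P" "abs_cube d P \<le> 4 / 3 * (exp (3 * r) - 1) * abs_cube d R"
    unfolding P_def by (rule compound_cube[OF R(1) r(1)])+
  have Pm: "(\<integral>v. v i \<partial>P) = 0" if "i < d" for i
    unfolding P_def by (rule compound_moments(1)[OF R(1) r(1) Rm that])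
  have Pc: "(\<integral>v. v i * v j \<partial>P) = poly (legendre_poly l) (x i \<bullet> x j) / real n" if "i < d" "j < d" for i j
  proof -
    have "(\<integral>v. v i * v j \<partial>P) = r * (\<integral>v. v i * v j \<partial>R)"
      unfolding P_def by (rule compound_moments(2)[OF R(1) r(1) Rm that])
    also have "\<dots> = poly (legendre_poly l) (x i \<bullet> x j) / real n"
      unfolding Rc[OF that] using \<nu> by (simp add: r_def)
    finally show ?thesis .
  qed

  have Zi: "(\<lambda>\<omega>. Z \<omega> i) \<in> borel_measurable M'" if "i < d" for i
    using measurable_compose[OF zf(1) measurable_component_singleton[of i]] that by simp
  have Ym: "(\<lambda>\<omega>. \<lambda>i\<in>{..<d}. Z \<omega> i / sqrt (real n)) \<in> measurable M' (vecs d)"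
    by (rule measurable_restrict) (use Zi in auto)
  have sn: "sqrt (real n) > 0" using n1 by simp
  have Q: "cube_law d Q" "abs_cube d Q \<le> 2 * (real d)\<^sup>2 * (2 / sqrt (real n) ^ 3)"
  proof -
    have i3: "integrable M' (\<lambda>\<omega>. \<bar>(\<lambda>i\<in>{..<d}. Z \<omega> i / sqrt (real n)) i\<bar> ^ 3)" if "i < d" for i
      using that zf(4)[OF that] by (simp add: abs_divide power_divide)
    have b3: "(\<integral>\<omega>. \<bar>(\<lambda>i\<in>{..<d}. Z \<omega> i / sqrt (real n)) i\<bar> ^ 3 \<partial>M') \<le> 2 / sqrt (real n) ^ 3" if "i < d" for i
    proof -
      have "x i \<bullet> x i = 1" using nx[OF that] by (simp add: norm_eq_1)
      then have "(\<integral>\<omega>. \<bar>Z \<omega> i\<bar> ^ 3 \<partial>M') \<le> 2" using zf(4)[OF that] by (simp add: poly_legendre_poly_1)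
      then show ?thesis using that sn by (simp add: abs_divide power_divide divide_right_mono)
    qed
    show "cube_law d Q" "abs_cube d Q \<le> 2 * (real d)\<^sup>2 * (2 / sqrt (real n) ^ 3)"
      unfolding Q_def by (rule cube_law_distr[OF M' Ym i3 b3]; assumption)+
  qed
  have cm: "(\<lambda>v. v i) \<in> borel_measurable (vecs d)" if "i < d" for i using that by simp
  have Qm: "(\<integral>v. v i \<partial>Q) = 0" if "i < d" for i
  proof -
    have "(\<integral>v. v i \<partial>Q) = (\<integral>\<omega>. Z \<omega> i / sqrt (real n) \<partial>M')"
      unfolding Q_def using that by (subst integral_distr[OF Ym cm]) auto
    then show ?thesis using Z that by (simp add: centred_gaussian_vector_def)
  qed
  have Qc: "(\<integral>v. v i * v j \<partial>Q) = poly (legendre_poly l) (x i \<bullet> x j) / real n" if "i < d" "j < d" for i j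
  proof -
    have "(\<integral>v. v i * v j \<partial>Q) = (\<integral>\<omega>. (Z \<omega> i * Z \<omega> j) / (sqrt (real n) * sqrt (real n)) \<partial>M')"
      unfolding Q_def using that by (subst integral_distr[OF Ym]) auto
    then show ?thesis using zf(3)[OF that] by simp
  qed

  have "\<bar>(\<integral>\<omega>. h (F \<omega>) \<partial>M) - (\<integral>\<omega>. h (Z \<omega>) \<partial>M')\<bar> \<le> real n * ((abs_cube d P + abs_cube d Q) / 6)"
    unfolding integral_eq_law[OF M Fm h Flaw] integral_eq_law[OF M' zf(1) h Zlaw]
    by (rule lindeberg_conv_pow[OF h P(1) Q(1)]) (simp_all add: Pm Qm Pc Qc)
  also have "\<dots> \<le> real n * abs_cube d P + real n * abs_cube d Q"
    using mult_nonneg_nonneg[of "real n" "abs_cube d P"] mult_nonneg_nonneg[of "real n" "abs_cube d Q"] abs_cube_nonneg[of d P] abs_cube_nonneg[of d Q]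
    by (simp add: distrib_left)
  also have "\<dots> \<le> 4 * exp 3 * (2 * (3 powr (3/2) * sphere_L3_const)) * ((real d)\<^sup>2 / sqrt \<nu>) + 4 * ((real d)\<^sup>2 / sqrt \<nu>)"
  proof (rule add_mono)
    \<comment> \<open>Linearity in r matters, since n r = 4 \<pi> \<nu> holds exactly, for small
      \<nu> as well; r \<le> 1 replaces exp (3 r) by e^3.\<close>
    have e: "exp (3 * r) - 1 \<le> 3 * r * exp 3"
    proof -
      have "1 + (- (3 * r)) \<le> exp (- (3 * r))" by (rule exp_ge_add_one_self)
      then have "(1 + (- (3 * r))) * exp (3 * r) \<le> exp (- (3 * r)) * exp (3 * r)" by (intro mult_right_mono) auto
      then have "exp (3 * r) - 1 \<le> 3 * r * exp (3 * r)" by (simp add: algebra_simps flip: exp_add)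
      also have "\<dots> \<le> 3 * r * exp 3" using r by (intro mult_left_mono) auto
      finally show ?thesis .
    qed
    have "real n * abs_cube d P \<le> real n * (4 / 3 * (3 * r * exp 3) * (2 * (real d)\<^sup>2 * ?B))"
    proof (intro mult_left_mono order_trans[OF P(2)] mult_mono e R(2))
      show "0 \<le> 4 / 3 * (3 * r * exp 3)" using r by simp
    qed (auto simp: abs_cube_nonneg)
    also have "\<dots> = 4 * exp 3 * (real n * r) * (2 * (real d)\<^sup>2 * ?B)" by (simp add: mult_ac)
    also have "\<dots> = 4 * exp 3 * (2 * (3 powr (3/2) * sphere_L3_const)) * ((real d)\<^sup>2 * (\<nu> * (1 / sqrt \<nu>) ^ 3))"
      unfolding r(3) by (simp add: mult_ac)
    also have "\<nu> * (1 / sqrt \<nu>) ^ 3 = 1 / sqrt \<nu>"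
      using \<nu> by (simp add: power3_eq_cube power_divide field_simps)
    finally show "real n * abs_cube d P \<le> 4 * exp 3 * (2 * (3 powr (3/2) * sphere_L3_const)) * ((real d)\<^sup>2 / sqrt \<nu>)" by simp
    have "real n * abs_cube d Q \<le> real n * (2 * (real d)\<^sup>2 * (2 / sqrt (real n) ^ 3))"
      by (intro mult_left_mono Q(2)) auto
    also have "\<dots> = 4 * (real d)\<^sup>2 * (real n / sqrt (real n) ^ 3)" by simp
    also have "real n / sqrt (real n) ^ 3 = 1 / sqrt (real n)"
      using sn by (simp add: power3_eq_cube field_simps)
    also have "1 / sqrt (real n) \<le> 1 / sqrt \<nu>"
    proof -
      have "1 * \<nu> \<le> 4 * pi * \<nu>" using pi_gt3 \<nu> by (intro mult_right_mono) auto
      then have "sqrt \<nu> \<le> sqrt (real n)" using n_ge by simp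
      then show ?thesis using \<nu> by (intro divide_left_mono) auto
    qed
    finally show "real n * abs_cube d Q \<le> 4 * ((real d)\<^sup>2 / sqrt \<nu>)" by (simp add: mult_left_mono)
  qed
  also have "\<dots> = wave_const * (real d)\<^sup>2 / sqrt \<nu>" by (simp add: wave_const_def distrib_right add_divide_distrib)
  finally show ?thesis .
qed

section \<open>Nonnegativity of the main term\<close>

text \<open>In \<open>ereal\<close> the supremum over the empty set is -\<infinity>; d \<ge> 1
  provides a unit vector and rules this out.\<close>

lemma op_norm_nonneg:
  assumes "d \<ge> 1" shows "0 \<le> op_norm d j \<psi>"
proof -
  define u where "u = (\<lambda>i\<in>{..<d}. if i = 0 then 1 else 0 :: real)"
  have "L2_set u {..<d} = L2_set (\<lambda>i. if i = 0 then 1 else 0) {..<d}" by (rule L2_set_cong) (auto simp: u_def)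
  also have "\<dots> = 1" using assms by (simp add: L2_set_def if_distrib[of "\<lambda>z. z\<^sup>2"] cong: if_cong)
  finally have "L2_set u {..<d} = 1" .
  moreover have "u \<in> Rd d" by (simp add: u_def Rd_def)
  ultimately have "ereal \<bar>\<psi> (\<lambda>_. u)\<bar> \<le> op_norm d j \<psi>" unfolding op_norm_def by (intro SUP_upper) auto
  then show ?thesis by (rule order_trans[rotated]) simp
qed

text \<open>Again the supremum must not be empty: for d \<ge> 1 the constant vectors 0 and 1 are
  distinct points.\<close>

lemma M_lip_nonneg:
  assumes "d \<ge> 1" shows "0 \<le> M_lip d k g"
proof -
  define a b where "a = (\<lambda>i\<in>{..<d}. 0 :: real)" and "b = (\<lambda>i\<in>{..<d}. 1 :: real)"
  have "a 0 \<noteq> b 0" using assms by (simp add: a_def b_def)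
  then have ab: "a \<noteq> b" by auto
  have "a \<in> Rd d" "b \<in> Rd d" by (auto simp: a_def b_def Rd_def)
  then have "op_norm d (k - 1) (\<lambda>u. deriv_form d (k - 1) g a u - deriv_form d (k - 1) g b u)
          / ereal (L2_set (\<lambda>i. a i - b i) {..<d}) \<le> M_lip d k g"
    unfolding M_lip_def using ab by (intro SUP_upper2[of "(a, b)"]) auto
  moreover have "0 \<le> op_norm d (k - 1) (\<lambda>u. deriv_form d (k - 1) g a u - deriv_form d (k - 1) g b u)
          / ereal (L2_set (\<lambda>i. a i - b i) {..<d})"
    by (intro zero_le_divide_ereal op_norm_nonneg assms) (simp add: L2_set_nonneg)
  ultimately show ?thesis by (rule order_trans[rotated])
qed

lemma zero_test_function: "(\<lambda>_. 0) \<in> test_functions d"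
proof -
  have z: "iter_partial_deriv is (\<lambda>_. 0) = (\<lambda>_. 0)" for "is"
    by (induction "is") (auto simp: iter_partial_deriv_def partial_deriv_def)
  have "deriv_sup_norm d j (\<lambda>_. 0) \<le> 1" for j
    unfolding deriv_sup_norm_def op_norm_def by (intro SUP_least) (simp add: deriv_form_def z)
  then show ?thesis by (auto simp: test_functions_def C_k_def z)
qed

lemma SUP_B_3_nonneg:
  assumes "d \<ge> 1" shows "0 \<le> (SUP g \<in> test_functions d. B_3 g d)"
proof (rule SUP_upper2[OF zero_test_function])
  show "0 \<le> B_3 (\<lambda>_. 0) d"
    unfolding B_3_def by (intro add_nonneg_nonneg ereal_0_le_mult M_lip_nonneg assms) auto
qed

theorem theorem2p3:
  fixes \<nu> :: "real \<Rightarrow> real"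
    and M :: "real \<Rightarrow> 'w measure"
    and N :: "real \<Rightarrow> 'w \<Rightarrow> (real ^ 3) measure"
    and d :: "nat \<Rightarrow> real \<Rightarrow> nat"
    and x :: "nat \<Rightarrow> real \<Rightarrow> nat \<Rightarrow> real ^ 3"
    and M' :: "nat \<Rightarrow> real \<Rightarrow> 'v measure"
    and F :: "nat \<Rightarrow> real \<Rightarrow> 'w \<Rightarrow> nat \<Rightarrow> real"
    and Z :: "nat \<Rightarrow> real \<Rightarrow> 'v \<Rightarrow> nat \<Rightarrow> real"
  assumes "\<And>t. t > 0 \<Longrightarrow> \<nu> t > 0"
    and "filterlim \<nu> at_top at_top"
    and "\<And>t. t > 0 \<Longrightarrow> prob_space (M t)"
    and "\<And>t. t > 0 \<Longrightarrow>
           poisson_random_measure (M t) (scale_measure (ennreal (\<nu> t)) sphere_measure) (N t)"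
    and "\<And>l t. t > 0 \<Longrightarrow> d l t \<ge> 1"
    and "\<And>l t i. t > 0 \<Longrightarrow> i < d l t \<Longrightarrow> x l t i \<in> sphere 0 1"
    and "\<And>l t \<omega>. F l t \<omega> = (\<lambda>i\<in>{..<d l t}. poisson_wave l (\<nu> t) (N t) (x l t i) \<omega>)"
    and "\<And>l t. t > 0 \<Longrightarrow> prob_space (M' l t)"
    and "\<And>l t. t > 0 \<Longrightarrow> centred_gaussian_vector (M' l t) (d l t)
           (\<lambda>i j. poly (legendre_poly l) (x l t i \<bullet> x l t j)) (Z l t)"
  shows "\<exists>r :: nat \<Rightarrow> real \<Rightarrow> real.
     (\<lambda>(l, t). r l t) \<in> o[sequentially \<times>\<^sub>F at_top](
         \<lambda>(l, t). (real (d l t))\<^sup>2 * sqrt (ln (real l) / \<nu> t)) \<and>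
     (\<forall>\<^sub>F (l, t) in sequentially \<times>\<^sub>F at_top.
        dist_3 (d l t) (M t) (F l t) (M' l t) (Z l t)
          \<le> (SUP g \<in> test_functions (d l t). B_3 g (d l t))
              * ereal (sqrt (3 / (2 * pi ^ 3)) * real (d l t) * sqrt (ln (real l) / \<nu> t))
            + ereal (r l t))"
proof (intro exI conjI)
  \<comment> \<open>The remainder takes the entire bound on the distance. It is smaller than its
    comparison function by the factor sqrt (log l) up to a constant, uniformly in d and
    \<nu>.\<close>
  let ?r = "\<lambda>l t. wave_const * (real (d l t))\<^sup>2 / sqrt (\<nu> t)"
  have ev_t: "\<forall>\<^sub>F t :: real in at_top. t > 0" by (rule eventually_gt_at_top)
  show "(\<lambda>(l, t). ?r l t) \<in> o[sequentially \<times>\<^sub>F at_top](\<lambda>(l, t). (real (d l t))\<^sup>2 * sqrt (ln (real l) / \<nu> t))"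
  proof (rule landau_o.smallI)
    fix c :: real assume c: "c > 0"
    have "filterlim (\<lambda>l. sqrt (ln (real l))) at_top sequentially"
      by (intro filterlim_compose[OF sqrt_at_top] filterlim_compose[OF ln_at_top] filterlim_real_sequentially)
    then have "\<forall>\<^sub>F l in sequentially. wave_const / c \<le> sqrt (ln (real l))"
      by (simp add: filterlim_at_top)
    from eventually_prodI[OF this ev_t]
    show "\<forall>\<^sub>F p in sequentially \<times>\<^sub>F at_top. norm (case p of (l, t) \<Rightarrow> ?r l t)
        \<le> c * norm (case p of (l, t) \<Rightarrow> (real (d l t))\<^sup>2 * sqrt (ln (real l) / \<nu> t))"
    proof eventually_elim
      case (elim p)
      obtain l t where p: "p = (l, t)" by (cases p)
      have t: "t > 0" and L: "wave_const / c \<le> sqrt (ln (real l))" using elim by (auto simp: p)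
      have v: "sqrt (\<nu> t) > 0" using assms(1)[OF t] by simp
      have L': "wave_const \<le> c * sqrt (ln (real l))" using L c by (simp add: pos_divide_le_eq mult.commute)
      have "0 \<le> wave_const / c" using wave_const_nonneg c by simp
      then have s0: "sqrt (ln (real l)) \<ge> 0" using L by linarith
      have "norm (?r l t) = wave_const * ((real (d l t))\<^sup>2 / sqrt (\<nu> t))"
        using wave_const_nonneg v by simp
      also have "\<dots> \<le> c * sqrt (ln (real l)) * ((real (d l t))\<^sup>2 / sqrt (\<nu> t))"
        using v by (intro mult_right_mono L') auto
      also have "\<dots> = c * norm ((real (d l t))\<^sup>2 * sqrt (ln (real l) / \<nu> t))"
        using v s0 by (simp add: real_sqrt_divide abs_mult)
      finally show ?case by (simp add: p)
    qed
  qed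
  have "\<forall>\<^sub>F l in sequentially. (l :: nat) \<ge> 1" by (rule eventually_ge_at_top)
  from eventually_prodI[OF this ev_t]
  show "\<forall>\<^sub>F (l, t) in sequentially \<times>\<^sub>F at_top.
        dist_3 (d l t) (M t) (F l t) (M' l t) (Z l t)
          \<le> (SUP g \<in> test_functions (d l t). B_3 g (d l t))
              * ereal (sqrt (3 / (2 * pi ^ 3)) * real (d l t) * sqrt (ln (real l) / \<nu> t))
            + ereal (?r l t)"
  proof eventually_elim
    case (elim p)
    obtain l t where p: "p = (l, t)" by (cases p)
    have t: "t > 0" and l: "l \<ge> 1" using elim by (auto simp: p)
    note \<nu> = assms(1)[OF t]
    have "dist_3 (d l t) (M t) (F l t) (M' l t) (Z l t) \<le> ereal (?r l t)"
      unfolding dist_3_def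
    proof (rule SUP_least)
      fix h assume h: "h \<in> test_functions (d l t)"
      show "ereal \<bar>(\<integral>\<omega>. h (F l t \<omega>) \<partial>M t) - (\<integral>\<omega>. h (Z l t \<omega>) \<partial>M' l t)\<bar> \<le> ereal (?r l t)"
        using wave_gaussian_distance[OF assms(3)[OF t] assms(8)[OF t] \<nu> l assms(4)[OF t] assms(6)[OF t] assms(7) assms(9)[OF t] h]
        by simp
    qed
    \<comment> \<open>A nonnegative main term may be added on the right; l \<ge> 1 keeps the
      logarithm under its root nonnegative.\<close>
    moreover have "0 \<le> ln (real l) / \<nu> t" using l \<nu> by simp
    then have "0 \<le> (SUP g \<in> test_functions (d l t). B_3 g (d l t))
              * ereal (sqrt (3 / (2 * pi ^ 3)) * real (d l t) * sqrt (ln (real l) / \<nu> t))"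
      by (intro ereal_0_le_mult SUP_B_3_nonneg assms(5)[OF t]) simp
    ultimately show ?case unfolding p prod.case by (rule add_increasing[rotated])
  qed
qed

end
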